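(* Let $p\ge 0$ be real and let $\mathbf{X}_1,\dots,\mathbf{X}_N$ be $N$ independent uniformly distributed random points on $\mathbb{S}^2$. Let $f_2$ be the number of facets of their convex hull and $\rho_1,\dots,\rho_{f_2}$ the associated Euclidean hole radii. Then, as $N\to\infty$, $$\mathbb{E}\Big[\sum_{k=1}^{f_2}(\rho_k)^p\Big]=(2N-4)\,2^p\,\frac{\Gamma(2+\frac p2)\,\Gamma(N+1)}{\Gamma(N+1+p/2)}\,\{1+o(1)\},$$ where the $o(1)$ term goes to zero exponentially fast as $N\to\infty$, and consequently, for every positive integer $L$, $$\mathbb{E}\Big[\sum_{k=1}^{f_2}(\rho_k)^p\Big]=(2N-4)\,2^p\,\Gamma\big(2+\tfrac p2\big)\,N^{-p/2}\left\{1+\sum_{\ell=1}^{L-1}\frac{\binom{-p/2}{\ell}\,B_\ell^{(1-p/2)}(1)}{N^\ell}+\mathcal{O}\Big(\frac{1}{N^L}\Big)\right\}.$$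
   Context: $\mathbb{S}^2$ is the unit sphere in $\mathbb{R}^3$; uniform means with respect to normalized surface area measure. $B_\ell^{(a)}(x)$ denotes the generalized Bernoulli polynomial, defined by $\left(\frac{t}{e^t-1}\right)^a e^{xt}=\sum_{\ell\ge 0}B_\ell^{(a)}(x)\frac{t^\ell}{\ell!}$ (so that $B_1^{(1-p/2)}(1)=(1+p/2)/2$). Holes: the plane spanned by the $k$th facet of the convex hull divides $\mathbb{S}^2$ into an open spherical cap containing none of the points and a complementary closed cap containing all of them. If $\alpha_k\in[0,\pi]$ is the geodesic radius of the open cap (angle from its center to its boundary), the Euclidean hole radius is $\rho_k:=2\sin(\alpha_k/2)$. *)

theory Defs
  imports "HOL-Probability.Probability" "HOL-Computational_Algebra.Formal_Power_Series"
begin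

text \<open>
  Surface area measure on the unit sphere of three-space, as a Borel measure on the ambient space:
  the measure \<open>\<sigma>\<close> of the polar coordinates formula \<open>dx = r\<^sup>2 dr d\<sigma>\<close>, that is, \<open>\<sigma>(A)\<close> is three times
  the volume of the cone \<open>{t a | 0 < t \<le> 1, a \<in> A}\<close>.
\<close>

definition sphere_area :: "(real^3) measure" where
  "sphere_area =
     scale_measure 3 (distr (restrict_space lborel (cball 0 1)) borel (\<lambda>x. x /\<^sub>R norm x))"

lemma emeasure_sphere_area:
  assumes A: "A \<in> sets borel" "A \<subseteq> sphere 0 1"
  shows "emeasure sphere_area A = 3 * emeasure lborel {t *\<^sub>R a | t a. 0 < t \<and> t \<le> 1 \<and> a \<in> A}"
proof -
  have m: "(\<lambda>x::real^3. x /\<^sub>R norm x) \<in> measurable (restrict_space lborel (cball 0 1)) borel"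
    by (rule measurable_restrict_space1) measurable
  have eq: "(\<lambda>x::real^3. x /\<^sub>R norm x) -` A \<inter> cball 0 1 =
      {t *\<^sub>R a | t a. 0 < t \<and> t \<le> 1 \<and> a \<in> A}" (is "?L = ?R")
  proof (intro equalityI subsetI)
    fix x assume x: "x \<in> ?L"
    then have x0: "x \<noteq> 0" using A(2) by auto
    have "x = norm x *\<^sub>R (x /\<^sub>R norm x)" using x0 by simp
    moreover have "0 < norm x" "norm x \<le> 1" "x /\<^sub>R norm x \<in> A" using x x0 by auto
    ultimately show "x \<in> ?R" by blast
  next
    fix x assume "x \<in> ?R"
    then obtain t a where *: "x = t *\<^sub>R a" "0 < t" "t \<le> 1" "a \<in> A" by blast
    moreover have "norm a = 1" using * A(2) by auto
    ultimately show "x \<in> ?L" by auto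
  qed
  then have sub: "?R \<subseteq> cball 0 1" by blast
  show ?thesis
    unfolding sphere_area_def emeasure_scale_measure
    using A m sub by (simp add: emeasure_distr space_restrict_space emeasure_restrict_space eq)
qed

lemma emeasure_sphere_area_sphere: "emeasure sphere_area (sphere 0 1) = ennreal (4 * pi)"
proof -
  have m: "(\<lambda>x::real^3. x /\<^sub>R norm x) \<in> measurable (restrict_space lborel (cball 0 1)) borel"
    by (rule measurable_restrict_space1) measurable
  have eq: "(\<lambda>x::real^3. x /\<^sub>R norm x) -` sphere 0 1 \<inter> cball 0 1 = cball 0 1 - {0}"
    by auto
  have "emeasure lborel (cball (0::real^3) 1 - {0}) = emeasure lborel (cball (0::real^3) 1)"
    by (rule emeasure_Diff_null_set) (auto simp: null_sets_def)
  also have "\<dots> = ennreal (4 / 3 * pi)"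
    by (simp add: emeasure_cball unit_ball_vol_3)
  finally show ?thesis
    unfolding sphere_area_def emeasure_scale_measure using m
    by (simp add: emeasure_distr space_restrict_space emeasure_restrict_space eq
        flip: ennreal_numeral ennreal_mult)
qed

definition uniform_sphere :: "(real^3) measure" where
  "uniform_sphere = uniform_measure sphere_area (sphere 0 1)"

text \<open>The geodesic distance between points \<open>c\<close>, \<open>y\<close> of the unit sphere is \<open>arccos (c \<bullet> y)\<close>.\<close>

definition open_cap :: "real^3 \<Rightarrow> real \<Rightarrow> (real^3) set" where
  "open_cap c r = {y \<in> sphere 0 1. arccos (c \<bullet> y) < r}"

definition cap_boundary :: "real^3 \<Rightarrow> real \<Rightarrow> (real^3) set" where
  "cap_boundary c r = {y \<in> sphere 0 1. arccos (c \<bullet> y) = r}"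

text \<open>
  For a finite set \<open>P\<close> of points of the sphere, not all in one plane, and a facet \<open>F\<close> of its convex
  hull, the plane spanned by \<open>F\<close> bounds two open caps with opposite centers, and exactly one of them
  contains no point of \<open>P\<close>. The description is not meaningful for coplanar \<open>P\<close>, an event of
  probability zero for at least four independent uniform points.
\<close>

definition hole_angle :: "(real^3) set \<Rightarrow> (real^3) set \<Rightarrow> real" where
  "hole_angle P F =
     (THE r. 0 \<le> r \<and> r \<le> pi \<and>
        (\<exists>c \<in> sphere 0 1. cap_boundary c r = affine hull F \<inter> sphere 0 1 \<and> open_cap c r \<inter> P = {}))"

definition hole_radius :: "(real^3) set \<Rightarrow> (real^3) set \<Rightarrow> real" where
  "hole_radius P F = 2 * sin (hole_angle P F / 2)"

definition hole_power_sum :: "real \<Rightarrow> (real^3) set \<Rightarrow> real" where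
  "hole_power_sum p P = (\<Sum>F | F facet_of (convex hull P). hole_radius P F powr p)"

text \<open>
  The expectation is taken with respect to the completion of the probability measure, so that the
  values on null events of coplanar configurations are irrelevant, also for measurability. For
  measurable integrands this is the ordinary expectation (\<open>integral_completion\<close>).
\<close>

definition expected_hole_power_sum ::
    "real \<Rightarrow> nat \<Rightarrow> 'a measure \<Rightarrow> (nat \<Rightarrow> 'a \<Rightarrow> real^3) \<Rightarrow> real" where
  "expected_hole_power_sum p N M X =
     (\<integral>\<omega>. hole_power_sum p ((\<lambda>i. X i \<omega>) ` {1..N}) \<partial>completion M)"

text \<open>
  The generating function is read as a formal power series in \<open>t\<close>: the series \<open>t / (e\<^sup>t - 1)\<close> has
  constant term \<open>1\<close>, so its \<open>a\<close>-th power is the binomial series \<open>(1 + u)\<^sup>a\<close> composed with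
  \<open>u = t / (e\<^sup>t - 1) - 1\<close>.
\<close>

definition gen_bernpoly :: "nat \<Rightarrow> real \<Rightarrow> real \<Rightarrow> real" where
  "gen_bernpoly l a x =
     fact l * fps_nth ((fps_binomial a oo (fps_X / (fps_exp 1 - 1) - 1)) * fps_exp x) l"

lemma gen_bernpoly_0: "gen_bernpoly 0 a x = 1"
  by (simp add: gen_bernpoly_def)

lemma gen_bernpoly_1: "gen_bernpoly 1 a x = x - a / 2"
proof -
  define B :: "real fps" where "B = fps_X / (fps_exp 1 - 1)"
  define E :: "real fps" where "E = fps_exp 1 - 1"
  have E0: "fps_nth E 0 = 0" and E1: "fps_nth E 1 = 1" and E2: "fps_nth E 2 = 1 / 2"
    by (simp_all add: E_def fact_numeral)
  have "subdegree E = 1"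
    using E0 E1 by (intro subdegreeI) auto
  then have "E dvd fps_X"
    using E1 by (subst fps_dvd_iff) auto
  then have BE: "B * E = fps_X"
    by (simp add: B_def E_def)
  have "fps_nth (B * E) 1 = 1" by (simp add: BE)
  then have B0: "fps_nth B 0 = 1" using E0 E1 by (simp add: fps_mult_nth)
  have "fps_nth (B * E) 2 = 0" by (simp add: BE)
  then have B1: "fps_nth B 1 = - 1 / 2" using E0 E1 E2 B0
    by (simp add: fps_mult_nth numeral_2_eq_2)
  have C0: "fps_nth (fps_binomial a oo (B - 1)) 0 = 1" by simp
  have C1: "fps_nth (fps_binomial a oo (B - 1)) 1 = - a / 2"
    using B0 B1 by (simp add: fps_compose_nth)
  show ?thesis
    unfolding gen_bernpoly_def B_def[symmetric]
    using C0 C1 by (simp add: fps_mult_nth)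
qed

end

theory Submission
  imports Defs
begin

text \<open>
  The formula of the theorem is exact for \<open>N \<ge> 4\<close>: the error term \<open>\<epsilon>\<close> can be chosen to be \<open>0\<close>, because
  every facet has exactly one hole, whichever side of the facet the origin is on.

  Almost surely no four of the points are coplanar. Then the facets of the convex hull are the
  triangles spanned by those triples whose plane leaves all other points on one side
  (\<open>hole_power_sum_eq\<close>, \<open>facet_value_triple\<close>), and a plane with unit normal \<open>c\<close> and offset \<open>h\<close>
  that has the other points in \<open>c \<bullet> y < h\<close> has hole radius \<open>sqrt (2 (1 - h))\<close>
  (\<open>hole_radius_triple\<close>). A cap \<open>{y. c \<bullet> y < h}\<close> has measure \<open>(1 + h) / 2\<close>
  (\<open>emeasure_uniform_sphere_cap\<close>), so given the triple the other \<open>N - 3\<close> points lie in it with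
  probability \<open>((1 + h) / 2) ^ (N - 3)\<close> (\<open>nn_integral_empty_cap\<close>).

  What remains is the law of the offset of the plane through three random points. Its absolute value
  has density \<open>3/2 (1 - h\<^sup>2)\<close> on \<open>[0, 1]\<close> (\<open>nn_integral_plane_offset\<close>). By rotation
  invariance the first point can be taken to be the south pole. Stereographic projection from there
  (\<open>nn_integral_uniform_sphere_stereo\<close>) makes the other two points independent in the plane with
  density proportional to \<open>(1 + u\<^sup>2 + v\<^sup>2) powr -2\<close>, and turns the plane through the three points into
  the line through these two. Using the line as coordinate (\<open>nn_integral_pairs_by_lines\<close>), the
  density factors after completing a square, and the law of the distance of the line from the origin
  can be read off up to a constant, which normalization determines. Summation over the triples then
  gives \<open>(N choose 3) * 12 * 2 powr p * Beta (2 + p/2) (N - 1)\<close>.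

  The expansion in powers of \<open>1 / N\<close> is Watson's lemma: \<open>Gamma (N + 1) / Gamma (N + 1 + s)\<close> is, up to
  \<open>Gamma s\<close>, the Laplace transform at \<open>N\<close> of \<open>t powr (s - 1)\<close> times the generating function of the
  values \<open>gen_bernpoly l (1 - s) 1\<close>, taken at \<open>- t\<close> (\<open>has_bochner_integral_Beta_bern_kernel\<close>,
  \<open>Gamma_ratio_expansion\<close>).
\<close>

section \<open>Substitution on open intervals\<close>

text \<open>
  Substitution on compact intervals passes to an open, possibly unbounded, interval by monotone
  convergence along an exhaustion. It is used for \<open>1 - exp (- t)\<close> in the Beta integral, for a
  radial coordinate in the stereographic projection, and to pass from slopes to sines.
\<close>

lemma nn_integral_substitution_open:
  fixes f :: "real \<Rightarrow> ennreal" and a b :: ereal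
  assumes f: "f \<in> borel_measurable borel" and ab: "a < b"
    and deriv: "\<And>x. x \<in> einterval a b \<Longrightarrow> (g has_real_derivative g' x) (at x)"
    and cont: "\<And>x. x \<in> einterval a b \<Longrightarrow> isCont g' x"
    and nonneg: "\<And>x. x \<in> einterval a b \<Longrightarrow> 0 \<le> g' x"
  shows "(\<integral>\<^sup>+x. f x * indicator (g ` einterval a b) x \<partial>lborel) =
         (\<integral>\<^sup>+x. f (g x) * g' x * indicator (einterval a b) x \<partial>lborel)"
proof -
  from einterval_Icc_approximation[OF ab] obtain u l where
    ul: "einterval a b = (\<Union>i. {l i .. u i})" "incseq u" "decseq l" "\<And>i. l i < u i"
      "\<And>i. a < ereal (l i)" "\<And>i. ereal (u i) < b"
      "(\<lambda>i. ereal (l i)) \<longlonglongrightarrow> a" "(\<lambda>i. ereal (u i)) \<longlonglongrightarrow> b"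
    by this auto
  have sub: "{l i..u i} \<subseteq> einterval a b" for i using ul(1) by blast
  have mono: "{l i..u i} \<subseteq> {l j..u j}" if "i \<le> j" for i j
    using that ul(2,3) by (auto simp: incseq_def decseq_def intro: order_trans)
  have gmono: "g x \<le> g y" if "x \<in> {l i..u i}" "y \<in> {l i..u i}" "x \<le> y" for x y i
  proof (rule DERIV_nonneg_imp_nondecreasing[OF that(3)])
    fix z assume "x \<le> z" "z \<le> y"
    then have "z \<in> einterval a b" using that sub[of i] by (auto simp: subset_iff)
    then show "\<exists>d. (g has_real_derivative d) (at z) \<and> 0 \<le> d" using deriv nonneg by blast
  qed
  have img: "g ` {l i..u i} = {g (l i)..g (u i)}" for i
  proof
    show "g ` {l i..u i} \<subseteq> {g (l i)..g (u i)}"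
    proof
      fix y assume "y \<in> g ` {l i..u i}"
      then obtain x where x: "y = g x" "x \<in> {l i..u i}" by blast
      show "y \<in> {g (l i)..g (u i)}"
        using gmono[of "l i" i x] gmono[of x i "u i"] x ul(4)[of i] by simp
    qed
    show "{g (l i)..g (u i)} \<subseteq> g ` {l i..u i}"
    proof
      fix y assume "y \<in> {g (l i)..g (u i)}"
      moreover have "isCont g x" if "l i \<le> x" "x \<le> u i" for x
        using that sub[of i] by (intro DERIV_isCont[OF deriv]) auto
      ultimately obtain x where "l i \<le> x" "x \<le> u i" "g x = y"
        using IVT[of g "l i" y "u i"] ul(4)[of i] less_imp_le by (metis atLeastAtMost_iff)
      then show "y \<in> g ` {l i..u i}" by auto
    qed
  qed
  have imgU: "g ` einterval a b = (\<Union>i. {g (l i)..g (u i)})"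
    unfolding ul(1) image_UN img ..
  have mono': "{g (l i)..g (u i)} \<subseteq> {g (l j)..g (u j)}" if "i \<le> j" for i j
    using mono[OF that] unfolding img[symmetric] by (rule image_mono)
  have step: "(\<integral>\<^sup>+x. f x * indicator {g (l i)..g (u i)} x \<partial>lborel) =
      (\<integral>\<^sup>+x. f (g x) * g' x * indicator {l i..u i} x \<partial>lborel)" for i
  proof (rule nn_integral_substitution_aux)
    show "continuous_on {l i..u i} g'"
      using sub[of i] cont by (intro continuous_at_imp_continuous_on) auto
  qed (use f sub[of i] deriv nonneg ul(4) in auto)
  have gm: "(\<lambda>x. f (g x) * g' x * indicator {l i..u i} x) \<in> borel_measurable borel" for i
  proof -
    have "continuous_on {l i..u i} g" "continuous_on {l i..u i} g'"
      using sub[of i] cont DERIV_isCont[OF deriv]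
      by (blast intro: continuous_at_imp_continuous_on)+
    then have [measurable]: "(\<lambda>x. indicator {l i..u i} x *\<^sub>R g x) \<in> borel_measurable borel"
       "(\<lambda>x. indicator {l i..u i} x *\<^sub>R g' x) \<in> borel_measurable borel"
      by - (rule borel_measurable_continuous_on_indicator; simp)+
    note f[measurable]
    have "(\<lambda>x. f (indicator {l i..u i} x *\<^sub>R g x) * ennreal (indicator {l i..u i} x *\<^sub>R g' x) * indicator {l i..u i} x)
       \<in> borel_measurable borel" by measurable
    also have "(\<lambda>x. f (indicator {l i..u i} x *\<^sub>R g x) * ennreal (indicator {l i..u i} x *\<^sub>R g' x) * indicator {l i..u i} x)
       = (\<lambda>x. f (g x) * g' x * indicator {l i..u i} x)"
      by (auto simp: indicator_def fun_eq_iff)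
    finally show ?thesis .
  qed
  have SUPind: "(SUP i. c * indicator (A i) x) = c * indicator (\<Union>i. A i) x"
    for c :: ennreal and A :: "nat \<Rightarrow> real set" and x
  proof (cases "x \<in> (\<Union>i. A i)")
    case True
    then obtain k where "x \<in> A k" by blast
    then have "c * indicator (A k) x = c" by simp
    then have "(SUP i. c * indicator (A i) x) = c"
      by (intro antisym SUP_least SUP_upper2[of k]) (auto simp: indicator_def)
    with True show ?thesis by simp
  qed auto
  have incind: "incseq (\<lambda>i x. h x * indicator (A i) x)"
    if "\<And>i j. i \<le> j \<Longrightarrow> A i \<subseteq> A j" for h :: "real \<Rightarrow> ennreal" and A :: "nat \<Rightarrow> real set"
    using that unfolding incseq_def le_fun_def
    by (intro allI impI mult_left_mono indicator_leI) auto
  have "(\<integral>\<^sup>+x. f x * indicator (g ` einterval a b) x \<partial>lborel) =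
      (\<integral>\<^sup>+x. (SUP i. f x * indicator {g (l i)..g (u i)} x) \<partial>lborel)"
    unfolding imgU SUPind ..
  also have "\<dots> = (SUP i. \<integral>\<^sup>+x. f x * indicator {g (l i)..g (u i)} x \<partial>lborel)"
    by (rule nn_integral_monotone_convergence_SUP[OF incind[OF mono']]) (use f in simp_all)
  also have "\<dots> = (SUP i. \<integral>\<^sup>+x. f (g x) * g' x * indicator {l i..u i} x \<partial>lborel)"
    unfolding step ..
  also have "\<dots> = (\<integral>\<^sup>+x. (SUP i. f (g x) * g' x * indicator {l i..u i} x) \<partial>lborel)"
    by (rule nn_integral_monotone_convergence_SUP[symmetric, OF incind[OF mono]]) (use gm in simp_all)
  also have "\<dots> = (\<integral>\<^sup>+x. f (g x) * g' x * indicator (einterval a b) x \<partial>lborel)"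
    unfolding ul(1) SUPind ..
  finally show ?thesis .
qed

section \<open>Expansion of a quotient of Gamma functions\<close>

text \<open>
  The remainder is \<open>x ^ n\<close> times a function that again has a power series expansion and is therefore
  bounded near \<open>0\<close>.
\<close>

lemma has_fps_expansion_truncate_bigo:
  fixes f :: "real \<Rightarrow> real"
  assumes "f has_fps_expansion F"
  shows "(\<lambda>x. f x - (\<Sum>k<n. fps_nth F k * x ^ k)) \<in> O[at 0](\<lambda>x. x ^ n)"
proof -
  define G where "G = F - (\<Sum>k<n. fps_const (fps_nth F k) * fps_X ^ k)"
  define r where "r = (\<lambda>x. f x - (\<Sum>k<n. fps_nth F k * x ^ k))"
  have r: "r has_fps_expansion G"
    unfolding r_def G_def by (intro fps_expansion_intros assms)
  have G: "fps_nth G k = 0" if "k < n" for k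
    using that by (simp add: G_def fps_sum_nth if_distrib cong: if_cong)
  show ?thesis
  proof (cases "G = 0")
    case True
    then have "eventually (\<lambda>x. r x = 0) (nhds 0)"
      using r by (auto simp: has_fps_expansion_def elim: eventually_mono)
    then have "eventually (\<lambda>x. r x = 0) (at 0)"
      using eventually_nhds_conv_at by blast
    then show ?thesis
      unfolding r_def[symmetric] by (rule bigoI[where c=1, OF eventually_mono]) simp
  next
    case False
    define h where "h = (\<lambda>x. if x = 0 then fps_nth G n else r x / x ^ n)"
    have "n \<le> subdegree G" using G False by (intro subdegree_geI) auto
    then have "h has_fps_expansion fps_shift n G"
      unfolding h_def by (intro has_fps_expansion_shift[OF r]) auto
    then have "h \<in> O[at 0](\<lambda>_. 1)"
      using has_fps_expansion_imp_continuous[of h "fps_shift n G" UNIV]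
      by (intro bigoI_tendsto[where c="h 0"]) (auto simp: continuous_at)
    then have "(\<lambda>x. h x * x ^ n) \<in> O[at 0](\<lambda>x. 1 * x ^ n)"
      by (rule landau_o.big.mult) simp
    also have "?this \<longleftrightarrow> r \<in> O[at 0](\<lambda>x. 1 * x ^ n)"
      by (intro landau_o.big.in_cong) (auto simp: eventually_at_filter h_def)
    finally show ?thesis by (simp add: r_def)
  qed
qed

lemma has_fps_expansion_binomial_real:
  "(\<lambda>x::real. (1 + x) powr a) has_fps_expansion fps_binomial a"
proof -
  have "eventually (\<lambda>z::real. z \<in> ball 0 1) (nhds 0)"
    by (intro eventually_nhds_in_open) auto
  then have "eventually (\<lambda>z. eval_fps (fps_binomial a) z = (1 + z) powr a) (nhds 0)"
    by eventually_elim (use gen_binomial_real[of _ a] in \<open>simp add: sums_iff eval_fps_def\<close>)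
  then show ?thesis
    by (auto simp: has_fps_expansion_def fps_conv_radius_binomial)
qed

text \<open>
  The function whose Taylor coefficients at \<open>0\<close> are \<open>gen_bernpoly l a 1 / fact l\<close>. Its value at \<open>0\<close>
  itself is \<open>0\<close> because of \<open>0 / 0 = 0\<close>, so the statements below concern punctured neighbourhoods.
\<close>

definition bern_kernel :: "real \<Rightarrow> real \<Rightarrow> real" where
  "bern_kernel a t = (t / (exp t - 1)) powr a * exp t"

text \<open>
  With \<open>u = t / (exp t - 1) - 1 = O(t)\<close>, cutting off the binomial series of \<open>(1 + u) powr a\<close> after
  \<open>n\<close> terms costs \<open>O(t ^ n)\<close>. What is left is a polynomial in \<open>u\<close> times \<open>exp t\<close>, whose power series
  agrees below degree \<open>n\<close> with the formal composition that defines \<open>gen_bernpoly\<close>.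
\<close>

lemma bern_kernel_taylor:
  "(\<lambda>t. bern_kernel a t - (\<Sum>l<n. gen_bernpoly l a 1 / fact l * t ^ l)) \<in> O[at 0](\<lambda>t. t ^ n)"
proof -
  define U :: "real fps" where "U = fps_X / (fps_exp 1 - 1) - 1"
  define u :: "real \<Rightarrow> real" where "u = (\<lambda>t. (if t = 0 then 1 else t / (exp t - 1)) - 1)"
  define E :: "real fps" where "E = fps_exp 1 - 1"
  have E0: "fps_nth E 0 = 0" and E1: "fps_nth E 1 = 1" by (simp_all add: E_def)
  have sE: "subdegree E = 1" using E0 E1 by (intro subdegreeI) auto
  have EX: "(\<lambda>t::real. if t = 0 then 1 else t / (exp t - 1)) has_fps_expansion fps_X / E"
    unfolding E_def using sE E1
    by (intro has_fps_expansion_divide fps_expansion_intros) (auto simp: E_def)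
  have u: "u has_fps_expansion U"
    unfolding u_def U_def E_def[symmetric] by (intro fps_expansion_intros EX)
  have "u 0 = 0" by (simp add: u_def)
  then have U0: "fps_nth U 0 = 0" 
    using u by (auto simp: has_fps_expansion_def eval_fps_at_0 dest!: eventually_nhds_x_imp_x)
  have "(\<lambda>t. u t - (\<Sum>k<1. fps_nth U k * t ^ k)) \<in> O[at 0](\<lambda>t. t ^ 1)"
    by (rule has_fps_expansion_truncate_bigo[OF u])
  then have ubig: "u \<in> O[at 0](\<lambda>t. t)" using U0 by simp
  have ulim: "(u \<longlongrightarrow> 0) (at 0)"
    using has_fps_expansion_imp_continuous[OF u, of UNIV] \<open>u 0 = 0\<close> by (simp add: continuous_at)
  define b where "b = (\<lambda>x::real. (1 + x) powr a - (\<Sum>k<n. fps_nth (fps_binomial a) k * x ^ k))"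
  have b: "b \<in> O[at 0](\<lambda>x. x ^ n)"
    unfolding b_def by (rule has_fps_expansion_truncate_bigo[OF has_fps_expansion_binomial_real])
  then obtain c where c: "eventually (\<lambda>x. norm (b x) \<le> c * norm (x ^ n)) (at 0)"
    by (elim landau_o.bigE)
  have "eventually (\<lambda>x. norm (b x) \<le> max c 1 * norm (x ^ n)) (at 0)"
    using c by eventually_elim (smt (verit) mult_right_mono norm_ge_zero)
  moreover have "norm (b 0) \<le> max c 1 * norm ((0::real) ^ n)"
    by (cases n) (auto simp: b_def lessThan_Suc_eq_insert_0 sum.reindex)
  ultimately have "eventually (\<lambda>x. norm (b x) \<le> max c 1 * norm (x ^ n)) (nhds 0)"
    by (simp add: eventually_nhds_conv_at)
  then have "eventually (\<lambda>t. norm (b (u t)) \<le> max c 1 * norm (u t ^ n)) (at 0)"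
    using ulim by (auto simp: filterlim_iff)
  then have "(\<lambda>t. b (u t)) \<in> O[at 0](\<lambda>t. u t ^ n)"
    by (rule bigoI)
  also have "(\<lambda>t. u t ^ n) \<in> O[at 0](\<lambda>t. t ^ n)" by (rule landau_o.big_power[OF ubig])
  finally have "(\<lambda>t. b (u t)) \<in> O[at 0](\<lambda>t. t ^ n)" .
  moreover have "(\<lambda>t::real. exp t) \<in> O[at 0](\<lambda>t. 1)"
    by (intro bigoI_tendsto[where c=1]) (auto intro!: tendsto_eq_intros)
  ultimately have R1: "(\<lambda>t. b (u t) * exp t) \<in> O[at 0](\<lambda>t. t ^ n * 1)"
    by (rule landau_o.big.mult)
  have upow: "(\<lambda>t. u t ^ k) has_fps_expansion U ^ k" for k
    by (induction k) (auto intro!: fps_expansion_intros u)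
  define G where "G = (\<Sum>k<n. fps_const (fps_nth (fps_binomial a) k) * U ^ k) * fps_exp 1"
  define g where "g = (\<lambda>t. (\<Sum>k<n. fps_nth (fps_binomial a) k * u t ^ k) * exp t)"
  have g: "g has_fps_expansion G"
    unfolding g_def G_def by (intro fps_expansion_intros upow)
  have comp: "fps_nth (\<Sum>k<n. fps_const (fps_nth (fps_binomial a) k) * U ^ k) l =
      fps_nth (fps_binomial a oo U) l" if "l < n" for l
  proof -
    have "(\<Sum>k<n. fps_nth (fps_binomial a) k * fps_nth (U ^ k) l) =
          (\<Sum>k=0..l. fps_nth (fps_binomial a) k * fps_nth (U ^ k) l)"
      using that U0 by (intro sum.mono_neutral_right) (auto simp: startsby_zero_power_prefix)
    then show ?thesis by (simp add: fps_sum_nth fps_compose_nth)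
  qed
  have G: "fps_nth G l = gen_bernpoly l a 1 / fact l" if "l < n" for l
    using that comp by (simp add: G_def gen_bernpoly_def U_def[symmetric] fps_mult_nth)
  have R2: "(\<lambda>t. g t - (\<Sum>l<n. gen_bernpoly l a 1 / fact l * t ^ l)) \<in> O[at 0](\<lambda>t. t ^ n)"
    using has_fps_expansion_truncate_bigo[OF g, of n] G by simp
  have "(\<lambda>t. b (u t) * exp t + (g t - (\<Sum>l<n. gen_bernpoly l a 1 / fact l * t ^ l))) \<in> O[at 0](\<lambda>t. t ^ n)"
    using sum_in_bigo(1)[OF R1[unfolded mult_1_right] R2] .
  also have "?this \<longleftrightarrow> ?thesis"
  proof (intro landau_o.big.in_cong)
    have eq: "b (u t) * exp t + g t = bern_kernel a t" if "t \<noteq> 0" for t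
      unfolding b_def g_def left_diff_distrib using that by (simp add: bern_kernel_def u_def)
    have "b (u t) * exp t + (g t - S) = bern_kernel a t - S" if "t \<noteq> 0" for t S
      using eq[OF that] by linarith
    then show "\<forall>\<^sub>F t in at 0. b (u t) * exp t + (g t - (\<Sum>l<n. gen_bernpoly l a 1 / fact l * t ^ l)) =
        bern_kernel a t - (\<Sum>l<n. gen_bernpoly l a 1 / fact l * t ^ l)"
      by (simp add: eventually_at_filter)
  qed
  finally show ?thesis .
qed

lemma has_bochner_integral_powr_exp:
  fixes s n :: real
  assumes s: "s > 0" and n: "n > 0"
  shows "has_bochner_integral lborel (\<lambda>t. indicator {0<..} t * (t powr (s - 1) * exp (- (n * t))))
           (Gamma s / n powr s)"
proof (rule has_bochner_integral_nn_integral)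
  have "(\<integral>\<^sup>+t. ennreal (indicator {0<..} t * (t powr (s - 1) * exp (- (n * t)))) \<partial>lborel) =
      (\<integral>\<^sup>+t. ennreal (n powr (- s)) * (ennreal n * ennreal (indicator {0..} (0 + n * t) *
          (0 + n * t) powr (s - 1) / exp (0 + n * t))) \<partial>lborel)"
  proof (rule nn_integral_cong_AE, rule eventually_mono[OF AE_lborel_singleton[of 0]])
    fix t :: real assume "t \<noteq> 0"
    then show "ennreal (indicator {0<..} t * (t powr (s - 1) * exp (- (n * t)))) =
      ennreal (n powr (- s)) * (ennreal n * ennreal (indicator {0..} (0 + n * t) *
          (0 + n * t) powr (s - 1) / exp (0 + n * t)))"
      using n by (auto simp: indicator_def zero_le_mult_iff powr_mult powr_diff powr_minus exp_minus
          field_simps simp flip: ennreal_mult)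
  qed
  also have "\<dots> = ennreal (n powr (- s)) * (\<bar>n\<bar> * (\<integral>\<^sup>+t. ennreal (indicator {0..} (0 + n * t) *
          (0 + n * t) powr (s - 1) / exp (0 + n * t)) \<partial>lborel))"
    using n by (simp add: nn_integral_cmult)
  also have "\<dots> = ennreal (n powr (- s)) * ennreal (Gamma s)"
    using n by (subst nn_integral_real_affine[where c=n and t=0, symmetric])
      (simp_all add: Gamma_conv_nn_integral_real[OF s])
  also have "\<dots> = ennreal (Gamma s / n powr s)"
    using n s by (simp add: powr_minus field_simps Gamma_real_pos less_imp_le flip: ennreal_mult)
  finally show "(\<integral>\<^sup>+t. ennreal (indicator {0<..} t * (t powr (s - 1) * exp (- (n * t)))) \<partial>lborel) =
     ennreal (Gamma s / n powr s)" .
  show "0 \<le> Gamma s / n powr s" using s by (simp add: Gamma_real_pos less_imp_le)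
qed (auto simp: indicator_def)

text \<open>
  The substitution \<open>x = 1 - exp (- t)\<close> turns Euler's integral for \<open>Beta s (n + 1)\<close> into a Laplace
  transform in \<open>n\<close>; the factor that appears next to \<open>t powr (s - 1)\<close> is the generating function at
  \<open>- t\<close>.
\<close>

lemma has_bochner_integral_Beta_bern_kernel:
  fixes s n :: real
  assumes s: "s > 0" and n: "n > 0"
  shows "has_bochner_integral lborel
     (\<lambda>t. indicator {0<..} t * (t powr (s - 1) * exp (- (n * t))) * bern_kernel (1 - s) (- t))
           (Beta s (n + 1))"
proof (rule has_bochner_integral_nn_integral)
  let ?f = "\<lambda>x::real. ennreal (x powr (s - 1) * (1 - x) powr n)"
  have img: "(\<lambda>t::real. 1 - exp (- t)) ` einterval 0 \<infinity> = {0<..<1}"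
  proof (intro equalityI subsetI)
    fix x :: real assume "x \<in> {0<..<1}"
    then have "x = 1 - exp (- (- ln (1 - x)))" "- ln (1 - x) \<in> einterval 0 \<infinity>"
      by (auto simp: einterval_def)
    then show "x \<in> (\<lambda>t. 1 - exp (- t)) ` einterval 0 \<infinity>" by blast
  qed (auto simp: einterval_def)
  have "ennreal (Beta s (n + 1)) =
      (\<integral>\<^sup>+x. ennreal (indicator {0..1} x * (x powr (s - 1) * (1 - x) powr (n + 1 - 1))) \<partial>lborel)"
    using nn_integral_has_integral_lebesgue[OF _ has_integral_Beta_real[of s "n + 1"]] s n by simp
  also have "\<dots> = (\<integral>\<^sup>+x. ?f x * indicator {0<..<1} x \<partial>lborel)"
  proof (intro nn_integral_cong_AE)
    have "AE x in lborel. x \<noteq> 0 \<and> x \<noteq> (1::real)"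
      using AE_lborel_singleton[of 0] AE_lborel_singleton[of 1] by eventually_elim simp
    then show "AE x in lborel. ennreal (indicator {0..1} x * (x powr (s - 1) * (1 - x) powr (n + 1 - 1))) =
       ?f x * indicator {0<..<1} x"
      by eventually_elim (auto simp: indicator_def)
  qed
  also have "\<dots> = (\<integral>\<^sup>+t. ?f (1 - exp (- t)) * ennreal (exp (- t)) * indicator (einterval 0 \<infinity>) t \<partial>lborel)"
    unfolding img[symmetric]
    by (rule nn_integral_substitution_open) (auto intro!: derivative_eq_intros)
  also have "\<dots> = (\<integral>\<^sup>+t. ennreal (indicator {0<..} t * (t powr (s - 1) * exp (- (n * t))) * bern_kernel (1 - s) (- t)) \<partial>lborel)"
  proof (intro nn_integral_cong)
    fix t :: real
    show "?f (1 - exp (- t)) * ennreal (exp (- t)) * indicator (einterval 0 \<infinity>) t =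
      ennreal (indicator {0<..} t * (t powr (s - 1) * exp (- (n * t))) * bern_kernel (1 - s) (- t))"
    proof (cases "t > 0")
      case True
      then have e: "0 < 1 - exp (- t)" by simp
      have "- t / (exp (- t) - 1) = t / (1 - exp (- t))"
        using minus_divide_divide[of t "1 - exp (- t)"] by simp
      then have "bern_kernel (1 - s) (- t) = (t / (1 - exp (- t))) powr (1 - s) * exp (- t)"
        by (simp add: bern_kernel_def)
      also have "\<dots> = t powr (1 - s) * (1 - exp (- t)) powr (s - 1) * exp (- t)"
        using True e powr_minus_divide[of "1 - exp (- t)" "1 - s"] by (simp add: powr_divide)
      finally have b: "bern_kernel (1 - s) (- t) = t powr (1 - s) * (1 - exp (- t)) powr (s - 1) * exp (- t)" .
      have "t powr (s - 1) * t powr (1 - s) = 1"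
        using True by (simp flip: powr_add)
      then have main: "t powr (s - 1) * exp (- (n * t)) * bern_kernel (1 - s) (- t) =
          (1 - exp (- t)) powr (s - 1) * exp (- (n * t)) * exp (- t)"
        unfolding b by (simp add: mult_ac)
      moreover have "exp (- t) powr n = exp (- (n * t))" by (simp add: powr_def)
      ultimately show ?thesis
        using True e by (simp add: einterval_def indicator_def main flip: ennreal_mult)
    qed (auto simp: einterval_def indicator_def)
  qed
  finally show "(\<integral>\<^sup>+t. ennreal (indicator {0<..} t * (t powr (s - 1) * exp (- (n * t))) * bern_kernel (1 - s) (- t)) \<partial>lborel)
     = ennreal (Beta s (n + 1))" ..
  show "0 \<le> Beta s (n + 1)"
    using s n by (simp add: Beta_def Gamma_real_pos less_imp_le)
qed (auto simp: indicator_def bern_kernel_def)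

text \<open>
  The quotient \<open>t / (1 - exp (- t))\<close> lies between \<open>1\<close> and \<open>exp t\<close>, so its power with exponent
  \<open>1 - s < 1\<close> is at most \<open>exp t\<close> and is compensated by the factor \<open>exp (- t)\<close>.
\<close>

lemma bern_kernel_le_1:
  assumes s: "s > 0" and t: "t > 0"
  shows "\<bar>bern_kernel (1 - s) (- t)\<bar> \<le> 1"
proof -
  have e: "0 < 1 - exp (- t)" "1 - exp (- t) \<le> t"
    using t exp_ge_add_one_self[of "- t"] by auto
  have "- t / (exp (- t) - 1) = t / (1 - exp (- t))"
    using minus_divide_divide[of t "1 - exp (- t)"] by simp
  then have b: "bern_kernel (1 - s) (- t) = (t / (1 - exp (- t))) powr (1 - s) * exp (- t)"
    by (simp add: bern_kernel_def)
  have q1: "1 \<le> t / (1 - exp (- t))" using e by simp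
  have "t * exp (- t) \<le> 1 - exp (- t)"
    using exp_ge_add_one_self[of t] by (simp add: exp_minus field_simps)
  then have q2: "t / (1 - exp (- t)) \<le> exp t"
    using e mult_right_mono[of "t * exp (- t)" "1 - exp (- t)" "exp t"]
    by (simp add: pos_divide_le_eq mult_ac flip: exp_add)
  have "(t / (1 - exp (- t))) powr (1 - s) \<le> (t / (1 - exp (- t))) powr 1"
    using q1 s by (intro powr_mono) auto
  also have "\<dots> \<le> exp t" using q1 q2 by (subst powr_one) auto
  finally show ?thesis unfolding b by (simp add: exp_minus field_simps)
qed

text \<open>
  The Taylor estimate near \<open>0\<close> extends to the whole half-line, because away from \<open>0\<close> the kernel and
  all monomials of degree at most \<open>n\<close> are bounded by multiples of \<open>t ^ n\<close>.
\<close>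

lemma bern_kernel_remainder:
  assumes s: "s > 0"
  obtains C where "C \<ge> 0" "\<And>t. t > 0 \<Longrightarrow>
    \<bar>bern_kernel (1 - s) (- t) - (\<Sum>l<n. gen_bernpoly l (1 - s) 1 / fact l * (- t) ^ l)\<bar> \<le> C * t ^ n"
proof -
  define b where "b l = gen_bernpoly l (1 - s) 1 / fact l" for l
  obtain c where c: "eventually (\<lambda>t. norm (bern_kernel (1 - s) t - (\<Sum>l<n. b l * t ^ l)) \<le> c * norm (t ^ n)) (at 0)"
    using bern_kernel_taylor[of "1 - s" n] unfolding b_def by (elim landau_o.bigE)
  then obtain d where d: "d > 0" "\<And>t. t \<noteq> 0 \<Longrightarrow> \<bar>t\<bar> < d \<Longrightarrow>
      \<bar>bern_kernel (1 - s) t - (\<Sum>l<n. b l * t ^ l)\<bar> \<le> c * \<bar>t ^ n\<bar>"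
    by (auto simp: eventually_at dist_norm)
  (* The second argument of max serves for t at least d, where t ^ l is at most t ^ n / d ^ (n - l). *)
  define C where "C = max c (1 / d ^ n + (\<Sum>l<n. \<bar>b l\<bar> / d ^ (n - l)))"
  have "\<bar>bern_kernel (1 - s) (- t) - (\<Sum>l<n. b l * (- t) ^ l)\<bar> \<le> C * t ^ n" if t: "t > 0" for t
  proof (cases "t < d")
    case True
    then have "\<bar>bern_kernel (1 - s) (- t) - (\<Sum>l<n. b l * (- t) ^ l)\<bar> \<le> c * \<bar>(- t) ^ n\<bar>"
      using t by (intro d(2)) auto
    also have "\<dots> \<le> C * t ^ n"
      using t by (auto simp: C_def power_abs intro!: mult_right_mono)
    finally show ?thesis .
  next
    case False
    have pw: "t ^ l \<le> t ^ n / d ^ (n - l)" if "l \<le> n" for l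
    proof -
      have "t ^ l * d ^ (n - l) \<le> t ^ l * t ^ (n - l)"
        using False t d(1) by (intro mult_left_mono power_mono) auto
      also have "\<dots> = t ^ n" using that by (simp flip: power_add)
      finally show ?thesis using d(1) by (simp add: field_simps)
    qed
    have "\<bar>bern_kernel (1 - s) (- t) - (\<Sum>l<n. b l * (- t) ^ l)\<bar> \<le>
        \<bar>bern_kernel (1 - s) (- t)\<bar> + (\<Sum>l<n. \<bar>b l * (- t) ^ l\<bar>)"
      using sum_abs[of "\<lambda>l. b l * (- t) ^ l" "{..<n}"] by linarith
    also have "\<dots> \<le> t ^ n / d ^ n + (\<Sum>l<n. \<bar>b l\<bar> * (t ^ n / d ^ (n - l)))"
    proof (intro add_mono sum_mono)
      show "\<bar>bern_kernel (1 - s) (- t)\<bar> \<le> t ^ n / d ^ n"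
        using bern_kernel_le_1[OF s t] pw[of 0] by simp
      show "\<bar>b l * (- t) ^ l\<bar> \<le> \<bar>b l\<bar> * (t ^ n / d ^ (n - l))" if "l \<in> {..<n}" for l
        using mult_left_mono[OF pw[of l], of "\<bar>b l\<bar>"] that t by (simp add: abs_mult power_abs)
    qed
    also have "\<dots> = (1 / d ^ n + (\<Sum>l<n. \<bar>b l\<bar> / d ^ (n - l))) * t ^ n"
      by (simp add: algebra_simps sum_distrib_left)
    also have "\<dots> \<le> C * t ^ n" using t by (intro mult_right_mono) (auto simp: C_def)
    finally show ?thesis .
  qed
  moreover have "C \<ge> 0"
    unfolding C_def using d(1) by (auto simp: le_max_iff_disj intro!: add_nonneg_nonneg sum_nonneg)
  ultimately show ?thesis using that[of C] unfolding b_def by blast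
qed

text \<open>
  Watson's lemma: integrating the Taylor polynomial term by term gives Gamma integrals, and the
  remainder contributes one more of them.
\<close>

lemma Beta_expansion_bound:
  assumes s: "s > 0"
  obtains C where "\<And>n. n > 0 \<Longrightarrow>
    \<bar>Beta s (n + 1) - (\<Sum>l<L. gen_bernpoly l (1 - s) 1 / fact l * (-1) ^ l * (Gamma (s + l) / n powr (s + l)))\<bar>
      \<le> C / n powr (s + L)"
proof -
  define b where "b l = gen_bernpoly l (1 - s) 1 / fact l" for l
  obtain C where C: "C \<ge> 0" "\<And>t. t > 0 \<Longrightarrow>
    \<bar>bern_kernel (1 - s) (- t) - (\<Sum>l<L. b l * (- t) ^ l)\<bar> \<le> C * t ^ L"
    unfolding b_def using bern_kernel_remainder[OF s] by blast
  have "\<bar>Beta s (n + 1) - (\<Sum>l<L. b l * (-1) ^ l * (Gamma (s + l) / n powr (s + l)))\<bar>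
      \<le> C * Gamma (s + L) / n powr (s + L)" if n: "n > 0" for n :: real
  proof -
    define w where "w r t = indicator {0<..} t * (t powr (r - 1) * exp (- (n * t)))" for r t :: real
    have w: "has_bochner_integral lborel (w r) (Gamma r / n powr r)" if "r > 0" for r
      unfolding w_def using has_bochner_integral_powr_exp[OF that n] .
    have wpow: "w s t * t ^ l = w (s + l) t" for t l
      by (auto simp: w_def indicator_def powr_realpow[symmetric] powr_add powr_diff)
    have B: "has_bochner_integral lborel (\<lambda>t. w s t * bern_kernel (1 - s) (- t)) (Beta s (n + 1))"
      unfolding w_def by (rule has_bochner_integral_Beta_bern_kernel[OF s n])
    have S: "has_bochner_integral lborel (\<lambda>t. \<Sum>l<L. b l * (-1) ^ l * w (s + l) t)
        (\<Sum>l<L. b l * (-1) ^ l * (Gamma (s + l) / n powr (s + l)))"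
      using s by (intro has_bochner_integral_sum has_bochner_integral_mult_right w) auto
    have D: "has_bochner_integral lborel
        (\<lambda>t. w s t * bern_kernel (1 - s) (- t) - (\<Sum>l<L. b l * (-1) ^ l * w (s + l) t))
        (Beta s (n + 1) - (\<Sum>l<L. b l * (-1) ^ l * (Gamma (s + l) / n powr (s + l))))"
      by (rule has_bochner_integral_diff[OF B S])
    have U: "has_bochner_integral lborel (\<lambda>t. C * w (s + L) t) (C * (Gamma (s + L) / n powr (s + L)))"
      using s by (intro has_bochner_integral_mult_right w) auto
    have le: "norm (w s t * bern_kernel (1 - s) (- t) - (\<Sum>l<L. b l * (-1) ^ l * w (s + l) t)) \<le> C * w (s + L) t" for t
    proof (cases "t > 0")
      case True
      have "w s t * bern_kernel (1 - s) (- t) - (\<Sum>l<L. b l * (-1) ^ l * w (s + l) t)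
        = w s t * (bern_kernel (1 - s) (- t) - (\<Sum>l<L. b l * (- t) ^ l))"
        by (simp add: wpow[symmetric] right_diff_distrib sum_distrib_left power_minus[of t] mult_ac)
      also have "norm \<dots> \<le> w s t * (C * t ^ L)"
        using C(2)[OF True] by (auto simp: abs_mult w_def intro!: mult_mono)
      finally show ?thesis by (simp add: wpow[symmetric] mult_ac)
    qed (simp add: w_def)
    have "\<bar>Beta s (n + 1) - (\<Sum>l<L. b l * (-1) ^ l * (Gamma (s + l) / n powr (s + l)))\<bar> =
       norm (\<integral>t. w s t * bern_kernel (1 - s) (- t) - (\<Sum>l<L. b l * (-1) ^ l * w (s + l) t) \<partial>lborel)"
      using has_bochner_integral_integral_eq[OF D] by simp
    also have "\<dots> \<le> (\<integral>t. norm (w s t * bern_kernel (1 - s) (- t) - (\<Sum>l<L. b l * (-1) ^ l * w (s + l) t)) \<partial>lborel)"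
      by (rule integral_norm_bound)
    also have "\<dots> \<le> (\<integral>t. C * w (s + L) t \<partial>lborel)"
      using D U le by (intro integral_mono integrable_norm) (auto simp: has_bochner_integral_iff)
    also have "\<dots> = C * (Gamma (s + L) / n powr (s + L))"
      by (rule has_bochner_integral_integral_eq[OF U])
    finally show ?thesis by simp
  qed
  then show ?thesis using that unfolding b_def by blast
qed

text \<open>
  For \<open>s > 0\<close> this is the previous estimate divided by \<open>Gamma s\<close>, since
  \<open>Gamma (s + l) / (Gamma s * fact l)\<close> is \<open>(-s) gchoose l\<close> up to the sign \<open>(-1) ^ l\<close>. For
  \<open>s = 0\<close> the quotient is \<open>1\<close>, and so is the sum unless it is empty.
\<close>

lemma Gamma_ratio_expansion:
  fixes s :: real
  assumes s: "s \<ge> 0"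
  shows "(\<lambda>n. real n powr s * (Gamma (real n + 1) / Gamma (real n + 1 + s)) -
            (\<Sum>l<L. ((- s) gchoose l) * gen_bernpoly l (1 - s) 1 / real n ^ l)) \<in> O(\<lambda>n. 1 / real n ^ L)"
proof (cases "s = 0")
  case True
  have "(\<Sum>l<L. ((- s) gchoose l) * gen_bernpoly l (1 - s) 1 / real n ^ l) = 1" if "L > 0" for n
  proof -
    have "(\<Sum>l<L. ((- s) gchoose l) * gen_bernpoly l (1 - s) 1 / real n ^ l) = (\<Sum>l\<in>{0::nat}. 1)"
      using that True by (intro sum.mono_neutral_cong_right) (auto simp: gbinomial_0_left gen_bernpoly_0 split: if_splits)
    then show ?thesis by simp
  qed
  moreover have "Gamma (real n + 1) \<noteq> 0" for n
  proof -
    have "Gamma (real n + 1) > 0" by (rule Gamma_real_pos) (simp add: add_nonneg_pos)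
    then show ?thesis by linarith
  qed
  ultimately show ?thesis
    using True by (cases "L = 0") (auto intro!: bigoI[where c=1] eventually_mono[OF eventually_gt_at_top[of 0]])
next
  case False
  then have s: "s > 0" using assms by simp
  obtain C where C: "\<And>n. n > 0 \<Longrightarrow>
    \<bar>Beta s (n + 1) - (\<Sum>l<L. gen_bernpoly l (1 - s) 1 / fact l * (-1) ^ l * (Gamma (s + l) / n powr (s + l)))\<bar>
      \<le> C / n powr (s + L)"
    using Beta_expansion_bound[OF s] by blast
  have Gs: "Gamma s > 0" using s by (rule Gamma_real_pos)
  then have Gs0: "Gamma s \<noteq> 0" by linarith
  show ?thesis
  proof (rule bigoI[where c="C / Gamma s"], rule eventually_mono[OF eventually_gt_at_top[of 0]])
    fix k :: nat assume k: "k > 0"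
    define n where "n = real k"
    have n: "n > 0" using k by (simp add: n_def)
    have coef: "gen_bernpoly l (1 - s) 1 / fact l * (-1) ^ l * (Gamma (s + l) / n powr (s + l))
        = Gamma s / n powr s * (((- s) gchoose l) * gen_bernpoly l (1 - s) 1 / n ^ l)" for l
    proof -
      have "Gamma (s + l) = pochhammer s l * Gamma s"
        using pochhammer_Gamma[of s l] s Gs0 by (auto simp: nonpos_Ints_def)
      moreover have "n powr (s + l) = n powr s * n ^ l" using n by (simp add: powr_add powr_realpow)
      ultimately show ?thesis by (simp add: gbinomial_pochhammer mult_ac)
    qed
    have eq: "Beta s (n + 1) - (\<Sum>l<L. gen_bernpoly l (1 - s) 1 / fact l * (-1) ^ l * (Gamma (s + l) / n powr (s + l)))
       = Gamma s / n powr s * (n powr s * (Gamma (n + 1) / Gamma (n + 1 + s)) -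
            (\<Sum>l<L. ((- s) gchoose l) * gen_bernpoly l (1 - s) 1 / n ^ l))"
      unfolding coef using n by (simp add: Beta_def right_diff_distrib sum_distrib_left add_ac)
    have "Gamma s / n powr s * \<bar>n powr s * (Gamma (n + 1) / Gamma (n + 1 + s)) -
            (\<Sum>l<L. ((- s) gchoose l) * gen_bernpoly l (1 - s) 1 / n ^ l)\<bar> \<le> C / n powr (s + L)"
      using C[OF n] Gs n unfolding eq by (simp add: abs_mult)
    also have "C / n powr (s + L) = Gamma s / n powr s * (C / Gamma s * (1 / n ^ L))"
      using n Gs by (simp add: powr_add powr_realpow)
    finally have "\<bar>n powr s * (Gamma (n + 1) / Gamma (n + 1 + s)) -
            (\<Sum>l<L. ((- s) gchoose l) * gen_bernpoly l (1 - s) 1 / n ^ l)\<bar> \<le> C / Gamma s * (1 / n ^ L)"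
      using n Gs by (subst (asm) mult_le_cancel_left_pos) auto
    then show "norm (real k powr s * (Gamma (real k + 1) / Gamma (real k + 1 + s)) -
            (\<Sum>l<L. ((- s) gchoose l) * gen_bernpoly l (1 - s) 1 / real k ^ l)) \<le> C / Gamma s * norm (1 / real k ^ L)"
      using n unfolding n_def by simp
  qed
qed

section \<open>The uniform measure on the sphere\<close>

definition vec3 :: "real \<Rightarrow> real \<Rightarrow> real \<Rightarrow> real^3" where
  "vec3 a b c = a *\<^sub>R axis 1 1 + b *\<^sub>R axis 2 1 + c *\<^sub>R axis 3 1"

lemma vec3_nth [simp]: "vec3 a b c $ 1 = a" "vec3 a b c $ 2 = b" "vec3 a b c $ 3 = c"
  by (simp_all add: vec3_def axis_def)

lemma inner_3: "x \<bullet> y = x $ 1 * y $ 1 + x $ 2 * y $ 2 + x $ 3 * y $ 3" for x y :: "real^3"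
  by (simp add: inner_vec_def sum_3)

lemma norm_vec3: "norm (vec3 a b c) = sqrt (a\<^sup>2 + b\<^sup>2 + c\<^sup>2)"
  by (simp add: norm_eq_sqrt_inner inner_3 power2_eq_square)

lemma measurable_vec3 [measurable]:
  assumes [measurable]: "f \<in> borel_measurable M" "g \<in> borel_measurable M" "h \<in> borel_measurable M"
  shows "(\<lambda>x. vec3 (f x) (g x) (h x)) \<in> borel_measurable M"
  unfolding vec3_def by measurable

lemma sigma_finite_lborel_pair: "sigma_finite_measure (lborel \<Otimes>\<^sub>M lborel :: (real \<times> real) measure)"
  unfolding lborel_prod by (rule sigma_finite_lborel)

lemma lborel_vec3:
  "(lborel :: (real^3) measure) = distr (lborel \<Otimes>\<^sub>M (lborel \<Otimes>\<^sub>M lborel)) borel (\<lambda>(a, b, c). vec3 a b c)"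
proof (rule lborel_eqI)
  fix l u :: "real^3" assume le: "\<And>b. b \<in> Basis \<Longrightarrow> l \<bullet> b \<le> u \<bullet> b"
  have le': "l $ i \<le> u $ i" for i
    using le[of "axis i 1"] by (simp add: inner_axis)
  let ?M = "lborel \<Otimes>\<^sub>M (lborel \<Otimes>\<^sub>M lborel) :: (real \<times> real \<times> real) measure"
  have vim: "(\<lambda>(a, b, c). vec3 a b c) -` box l u \<inter> space ?M =
      {l $ 1<..<u $ 1} \<times> {l $ 2<..<u $ 2} \<times> {l $ 3<..<u $ 3}"
    by (auto simp: mem_box_cart forall_3 space_pair_measure)
  have "emeasure (distr ?M borel (\<lambda>(a, b, c). vec3 a b c)) (box l u) =
      emeasure ?M ({l $ 1<..<u $ 1} \<times> {l $ 2<..<u $ 2} \<times> {l $ 3<..<u $ 3})"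
    by (subst emeasure_distr) (simp_all add: vim)
  also have "\<dots> = emeasure lborel {l $ 1<..<u $ 1} * (emeasure lborel {l $ 2<..<u $ 2} * emeasure lborel {l $ 3<..<u $ 3})"
    by (subst sigma_finite_measure.emeasure_pair_measure_Times[OF sigma_finite_lborel_pair])
      (simp_all add: lborel.emeasure_pair_measure_Times del: emeasure_lborel_Ioo)
  also have "\<dots> = ennreal ((u $ 1 - l $ 1) * ((u $ 2 - l $ 2) * (u $ 3 - l $ 3)))"
    using le' by (simp add: ennreal_mult)
  also have "(u $ 1 - l $ 1) * ((u $ 2 - l $ 2) * (u $ 3 - l $ 3)) = (\<Prod>b\<in>Basis. (u - l) \<bullet> b)"
  proof -
    have b1: "(Basis :: (real^3) set) = (\<lambda>i. axis i 1) ` UNIV" by (auto simp: Basis_vec_def)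
    have b2: "inj (\<lambda>i::3. axis i (1::real))" by (auto simp: inj_def axis_eq_axis)
    have "(\<Prod>b\<in>Basis. (u - l) \<bullet> b) = (\<Prod>i\<in>(UNIV :: 3 set). (u - l) \<bullet> axis i 1)"
      unfolding b1 prod.reindex[OF b2] o_def ..
    also have "\<dots> = (\<Prod>i\<in>(UNIV :: 3 set). u $ i - l $ i)"
      by (simp only: inner_axis) simp
    also have "\<dots> = (u $ 1 - l $ 1) * ((u $ 2 - l $ 2) * (u $ 3 - l $ 3))"
      unfolding UNIV_3 by simp
    finally show ?thesis ..
  qed
  finally show "emeasure (distr ?M borel (\<lambda>(a, b, c). vec3 a b c)) (box l u) = (\<Prod>b\<in>Basis. (u - l) \<bullet> b)" .
qed simp

lemma nn_integral_lborel_vec3: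
  assumes [measurable]: "f \<in> borel_measurable (borel :: (real^3) measure)"
  shows "(\<integral>\<^sup>+x. f x \<partial>lborel) = (\<integral>\<^sup>+a. \<integral>\<^sup>+b. \<integral>\<^sup>+c. f (vec3 a b c) \<partial>lborel \<partial>lborel \<partial>lborel)"
proof -
  have "(\<integral>\<^sup>+x. f x \<partial>lborel) = (\<integral>\<^sup>+(a, b, c). f (vec3 a b c) \<partial>(lborel \<Otimes>\<^sub>M (lborel \<Otimes>\<^sub>M lborel)))"
    by (subst lborel_vec3, subst nn_integral_distr) (simp_all add: case_prod_unfold)
  also have "\<dots> = (\<integral>\<^sup>+a. \<integral>\<^sup>+(b, c). f (vec3 a b c) \<partial>(lborel \<Otimes>\<^sub>M lborel) \<partial>lborel)"
    by (subst sigma_finite_measure.nn_integral_fst[OF sigma_finite_lborel_pair, symmetric]) (simp_all add: case_prod_unfold)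
  also have "\<dots> = (\<integral>\<^sup>+a. \<integral>\<^sup>+b. \<integral>\<^sup>+c. f (vec3 a b c) \<partial>lborel \<partial>lborel \<partial>lborel)"
    by (subst lborel.nn_integral_fst[symmetric]) (simp_all add: case_prod_unfold)
  finally show ?thesis .
qed

lemma distr_lborel_orthogonal:
  fixes f :: "real^3 \<Rightarrow> real^3"
  assumes f: "orthogonal_transformation f"
  shows "distr lborel borel f = lborel"
proof (rule lborel_eqI[symmetric])
  have fm: "f \<in> borel_measurable borel"
    using f by (intro borel_measurable_continuous_onI linear_continuous_on)
      (simp add: orthogonal_transformation_linear linear_conv_bounded_linear[symmetric])
  fix l u :: "real^3" assume le: "\<And>b. b \<in> Basis \<Longrightarrow> l \<bullet> b \<le> u \<bullet> b"
  have im: "f -` box l u = inv f ` box l u"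
    using orthogonal_transformation_bij[OF f] by (simp add: bij_vimage_eq_inv_image)
  have inv: "orthogonal_transformation (inv f)" by (rule orthogonal_transformation_inv[OF f])
  have "box l u \<in> lmeasurable" by simp
  note m = measurable_orthogonal_image[OF inv this] measure_orthogonal_image[OF inv this]
  have b: "f -` box l u \<in> sets borel" using measurable_sets_borel[OF fm, of "box l u"] by simp
  have "emeasure (distr lborel borel f) (box l u) = emeasure lborel (f -` box l u)"
    using fm by (subst emeasure_distr) auto
  also have "\<dots> = emeasure lebesgue (f -` box l u)" using b by simp
  also have "\<dots> = emeasure lebesgue (box l u)"
    using m unfolding im by (metis \<open>box l u \<in> lmeasurable\<close> emeasure_eq_measure2)
  also have "\<dots> = (\<Prod>b\<in>Basis. (u - l) \<bullet> b)"
    using le by (simp add: emeasure_lborel_box_eq)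
  finally show "emeasure (distr lborel borel f) (box l u) = (\<Prod>b\<in>Basis. (u - l) \<bullet> b)" .
qed simp

lemma sets_uniform_sphere [simp, measurable_cong]: "sets uniform_sphere = sets borel"
  by (simp add: uniform_sphere_def sphere_area_def)

lemma space_uniform_sphere [simp]: "space uniform_sphere = UNIV"
  by (simp add: uniform_sphere_def sphere_area_def space_scale_measure)

interpretation uniform_sphere: prob_space uniform_sphere
  unfolding uniform_sphere_def
  by (rule prob_space_uniform_measure) (simp_all add: emeasure_sphere_area_sphere)

text \<open>
  The uniform distribution is the law of the direction of a uniform point of the unit ball, whose
  volume is \<open>4/3 pi\<close>. Both the rotation invariance and the stereographic density are derived from
  this form.
\<close>

lemma nn_integral_uniform_sphere:
  assumes [measurable]: "F \<in> borel_measurable (borel :: (real^3) measure)"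
  shows "(\<integral>\<^sup>+x. F x \<partial>uniform_sphere) =
    ennreal (3 / (4 * pi)) * (\<integral>\<^sup>+x. F (x /\<^sub>R norm x) * indicator (cball 0 1) x \<partial>lborel)"
proof -
  have m [measurable]: "(\<lambda>x::real^3. x /\<^sub>R norm x) \<in> measurable (restrict_space lborel (cball 0 1)) borel"
    by (rule measurable_restrict_space1) measurable
  have [measurable]: "sphere (0::real^3) 1 \<in> sets borel" by simp
  have "(\<integral>\<^sup>+x. F x \<partial>uniform_sphere) =
      (\<integral>\<^sup>+x. F x * indicator (sphere 0 1) x \<partial>sphere_area) / emeasure sphere_area (sphere 0 1)"
    unfolding uniform_sphere_def
    by (rule nn_integral_uniform_measure) (simp_all add: sphere_area_def)
  also have "(\<integral>\<^sup>+x. F x * indicator (sphere 0 1) x \<partial>sphere_area) =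
      3 * (\<integral>\<^sup>+x. F (x /\<^sub>R norm x) * indicator (sphere 0 1) (x /\<^sub>R norm x) * indicator (cball 0 1) x \<partial>lborel)"
    unfolding sphere_area_def
    by (subst nn_integral_scale_measure, simp, subst nn_integral_distr)
       (simp_all add: nn_integral_restrict_space)
  also have "(\<integral>\<^sup>+x. F (x /\<^sub>R norm x) * indicator (sphere 0 1) (x /\<^sub>R norm x) * indicator (cball 0 1) x \<partial>lborel)
      = (\<integral>\<^sup>+x. F (x /\<^sub>R norm x) * indicator (cball 0 1) x \<partial>lborel)"
    by (intro nn_integral_cong_AE eventually_mono[OF AE_lborel_singleton[of 0]]) (simp add: indicator_def)
  finally have eq: "(\<integral>\<^sup>+x. F x \<partial>uniform_sphere) =
      3 * (\<integral>\<^sup>+x. F (x /\<^sub>R norm x) * indicator (cball 0 1) x \<partial>lborel) / ennreal (4 * pi)"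
    unfolding emeasure_sphere_area_sphere .
  have "ennreal (3 / (4 * pi)) = 3 / ennreal (4 * pi)"
    by (subst divide_ennreal[symmetric]) simp_all
  then show ?thesis unfolding eq divide_ennreal_def by (simp only: mult_ac)
qed

lemma AE_uniform_sphere_norm: "AE x in uniform_sphere. norm x = 1"
proof -
  have "AE x in uniform_sphere. x \<in> sphere 0 1"
    unfolding uniform_sphere_def
    by (rule AE_uniform_measureI) (simp_all add: sphere_area_def)
  then show ?thesis by simp
qed

lemma nn_integral_uniform_sphere_orthogonal:
  fixes f :: "real^3 \<Rightarrow> real^3"
  assumes f: "orthogonal_transformation f" and [measurable]: "F \<in> borel_measurable borel"
  shows "(\<integral>\<^sup>+x. F (f x) \<partial>uniform_sphere) = (\<integral>\<^sup>+x. F x \<partial>uniform_sphere)"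
proof -
  have [measurable]: "f \<in> borel_measurable borel"
    using f by (intro borel_measurable_continuous_onI linear_continuous_on)
      (simp add: orthogonal_transformation_linear linear_conv_bounded_linear[symmetric])
  have "(\<integral>\<^sup>+x. F (x /\<^sub>R norm x) * indicator (cball 0 1) x \<partial>lborel) =
      (\<integral>\<^sup>+x. F (x /\<^sub>R norm x) * indicator (cball 0 1) x \<partial>distr lborel borel f)"
    by (simp add: distr_lborel_orthogonal[OF f])
  also have "\<dots> = (\<integral>\<^sup>+x. F (f (x /\<^sub>R norm x)) * indicator (cball 0 1) x \<partial>lborel)"
    using f by (subst nn_integral_distr)
      (simp_all add: orthogonal_transformation_norm orthogonal_transformation_scaleR indicator_def)
  finally show ?thesis by (simp add: nn_integral_uniform_sphere)
qed

section \<open>Stereographic coordinates\<close>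

text \<open>
  Inverse of the stereographic projection from the south pole \<open>vec3 0 0 (-1)\<close> to the plane of the
  equator.
\<close>

definition stereo :: "real \<Rightarrow> real \<Rightarrow> real^3" where
  "stereo u v = vec3 (2 * u / (1 + u\<^sup>2 + v\<^sup>2)) (2 * v / (1 + u\<^sup>2 + v\<^sup>2)) ((1 - u\<^sup>2 - v\<^sup>2) / (1 + u\<^sup>2 + v\<^sup>2))"

lemma stereo_denom_pos: "0 < 1 + u\<^sup>2 + (v::real)\<^sup>2"
  by (simp add: add_pos_nonneg)

lemma measurable_stereo [measurable]:
  assumes [measurable]: "f \<in> borel_measurable M" "g \<in> borel_measurable M"
  shows "(\<lambda>x. stereo (f x) (g x)) \<in> borel_measurable M"
  unfolding stereo_def by measurable

lemma nn_integral_sq_Icc: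
  assumes q: "(q::real) > 0"
  shows "(\<integral>\<^sup>+w. ennreal (w\<^sup>2 * q) * indicator {0<..1 / q} w \<partial>lborel) = ennreal (1 / (3 * q\<^sup>2))"
proof -
  have "(\<integral>\<^sup>+w. ennreal (w\<^sup>2 * q) * indicator {0<..1 / q} w \<partial>lborel) =
      (\<integral>\<^sup>+w. ennreal (w\<^sup>2 * q) * indicator {0..1 / q} w \<partial>lborel)"
    by (intro nn_integral_cong_AE eventually_mono[OF AE_lborel_singleton[of 0]]) (auto simp: indicator_def)
  also have "\<dots> = ennreal ((1 / q) ^ 3 * q / 3 - 0 ^ 3 * q / 3)"
    using q by (intro nn_integral_FTC_Icc) (auto intro!: derivative_eq_intros simp: power2_eq_square)
  also have "(1 / q) ^ 3 * q / 3 - 0 ^ 3 * q / 3 = 1 / (3 * q\<^sup>2)"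
    using q by (simp add: field_simps power2_eq_square power3_eq_cube)
  finally show ?thesis .
qed

text \<open>
  If \<open>r\<close> is the square sum of the first two coordinates of a point with third coordinate \<open>c\<close>, then
  \<open>w\<close> is the norm of the point plus \<open>c\<close>.
\<close>

lemma nn_integral_radial_substitution:
  fixes f :: "real \<Rightarrow> ennreal"
  assumes "f \<in> borel_measurable borel" and r: "r > 0"
  shows "(\<integral>\<^sup>+c. f c \<partial>lborel) =
    (\<integral>\<^sup>+w. f ((w - r / w) / 2) * ennreal ((1 + r / w\<^sup>2) / 2) * indicator {0<..} w \<partial>lborel)"
proof -
  let ?g = "\<lambda>w::real. (w - r / w) / 2"
  have e: "einterval 0 \<infinity> = {0<..}" by (auto simp: einterval_def)
  have img: "?g ` einterval 0 \<infinity> = UNIV"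
  proof (intro equalityI subsetI)
    fix c :: real
    (* w is the positive root of w * w - 2 * c * w = r *)
    define w where "w = c + sqrt (c\<^sup>2 + r)"
    have "\<bar>c\<bar> < sqrt (c\<^sup>2 + r)" using r by (intro real_less_rsqrt) simp
    then have w: "w > 0" unfolding w_def by linarith
    have "(w - c)\<^sup>2 = c\<^sup>2 + r" using r by (simp add: w_def)
    then have "w * w - 2 * c * w = r" by (simp add: power2_eq_square algebra_simps)
    then have "?g w = c" using w by (simp add: field_simps)
    then show "c \<in> ?g ` einterval 0 \<infinity>" using w unfolding e by force
  qed simp
  have "(\<integral>\<^sup>+c. f c \<partial>lborel) = (\<integral>\<^sup>+c. f c * indicator (?g ` einterval 0 \<infinity>) c \<partial>lborel)"
    unfolding img by simp
  also have "\<dots> = (\<integral>\<^sup>+w. f (?g w) * ennreal ((1 + r / w\<^sup>2) / 2) * indicator (einterval 0 \<infinity>) w \<partial>lborel)"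
    using assms by (intro nn_integral_substitution_open)
      (auto simp: e power2_eq_square add_nonneg_nonneg intro!: derivative_eq_intros continuous_intros)
  finally show ?thesis unfolding e .
qed

text \<open>
  A point \<open>x\<close> of the ball is written as \<open>w * (u, v)\<close> in its first two coordinates, with
  \<open>w = norm x + x $ 3\<close>. Its direction is then \<open>stereo u v\<close>, independently of \<open>w\<close>, and its norm is
  \<open>w (1 + u\<^sup>2 + v\<^sup>2) / 2\<close>, so that integrating out \<open>w\<close> leaves the density. For fixed first two
  coordinates the change from \<open>x $ 3\<close> to \<open>w\<close> is one-dimensional, and for fixed \<open>w\<close> the rest is a
  scaling, so no change of variables in several dimensions enters.
\<close>

lemma nn_integral_uniform_sphere_stereo:
  assumes [measurable]: "F \<in> borel_measurable (borel :: (real^3) measure)"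
  shows "(\<integral>\<^sup>+x. F x \<partial>uniform_sphere) =
    (\<integral>\<^sup>+u. \<integral>\<^sup>+v. F (stereo u v) * ennreal (1 / (pi * (1 + u\<^sup>2 + v\<^sup>2)\<^sup>2)) \<partial>lborel \<partial>lborel)"
proof -
  define H where "H a b c = F (vec3 a b c /\<^sub>R norm (vec3 a b c)) * indicator (cball 0 1) (vec3 a b c)" for a b c
  define K where "K w a b = H a b ((w - (a\<^sup>2 + b\<^sup>2) / w) / 2) *
      ennreal ((1 + (a\<^sup>2 + b\<^sup>2) / w\<^sup>2) / 2) * indicator {0<..} w" for w a b :: real
  have [measurable]: "cball (0 :: real^3) 1 \<in> sets borel" by simp
  have Hm [measurable]: "(\<lambda>x. H (f x) (g x) (h x)) \<in> borel_measurable M"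
    if [measurable]: "f \<in> borel_measurable M" "g \<in> borel_measurable M" "h \<in> borel_measurable M"
    for f g h :: "'z \<Rightarrow> real" and M
    unfolding H_def by measurable
  have Km [measurable]: "(\<lambda>x. K (f x) (g x) (h x)) \<in> borel_measurable M"
    if [measurable]: "f \<in> borel_measurable M" "g \<in> borel_measurable M" "h \<in> borel_measurable M"
    for f g h :: "'z \<Rightarrow> real" and M
    unfolding K_def by measurable
  have K_scale: "ennreal (w\<^sup>2) * K w (w * u) (w * v) = F (stereo u v) *
      (ennreal (w\<^sup>2 * ((1 + u\<^sup>2 + v\<^sup>2) / 2)) * indicator {0<..1 / ((1 + u\<^sup>2 + v\<^sup>2) / 2)} w)"
    for w u v :: real
  proof (cases "w > 0")
    case True
    define D where "D = 1 + u\<^sup>2 + v\<^sup>2"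
    have D: "D > 0" unfolding D_def by (rule stereo_denom_pos)
    have c: "(w - ((w * u)\<^sup>2 + (w * v)\<^sup>2) / w) / 2 = w * (2 - D) / 2"
      using True by (simp add: D_def field_simps power2_eq_square)
    have dens: "(1 + ((w * u)\<^sup>2 + (w * v)\<^sup>2) / w\<^sup>2) / 2 = D / 2"
      using True by (simp add: D_def field_simps power2_eq_square)
    have "norm (vec3 (w * u) (w * v) (w * (2 - D) / 2)) = sqrt ((w * D / 2)\<^sup>2)"
      unfolding norm_vec3 by (rule arg_cong[where f=sqrt]) (simp add: D_def power2_eq_square field_simps)
    then have n: "norm (vec3 (w * u) (w * v) (w * (2 - D) / 2)) = w * D / 2"
      using True D by simp
    have "vec3 (w * u) (w * v) (w * (2 - D) / 2) /\<^sub>R (w * D / 2) = stereo u v"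
    proof -
      have "2 - D = 1 - u\<^sup>2 - v\<^sup>2" by (simp add: D_def)
      then have S: "stereo u v = vec3 (2 * u / D) (2 * v / D) ((2 - D) / D)"
        unfolding stereo_def D_def[symmetric] by (simp only:)
      show ?thesis unfolding S using True D by (simp add: vec_eq_iff forall_3 field_simps)
    qed
    then have dir: "vec3 (w * u) (w * v) (w * (2 - D) / 2) /\<^sub>R norm (vec3 (w * u) (w * v) (w * (2 - D) / 2)) = stereo u v"
      unfolding n .
    have "vec3 (w * u) (w * v) (w * (2 - D) / 2) \<in> cball 0 1 \<longleftrightarrow> w \<in> {0<..1 / (D / 2)}"
      unfolding mem_cball dist_0_norm n using True D by (simp add: field_simps)
    then have ind: "indicator (cball 0 1) (vec3 (w * u) (w * v) (w * (2 - D) / 2)) =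
        (indicator {0<..1 / (D / 2)} w :: ennreal)"
      unfolding indicator_def by (simp only:)
    have Keq: "K w (w * u) (w * v) = F (stereo u v) * indicator {0<..1 / (D / 2)} w * ennreal (D / 2)"
      unfolding K_def c dens H_def ind dir using True by simp
    have "ennreal (w\<^sup>2 * (D / 2)) = ennreal (w\<^sup>2) * ennreal (D / 2)"
      using D by (intro ennreal_mult) auto
    then show ?thesis
      unfolding D_def[symmetric] Keq by (simp only: mult_ac)
  qed (simp add: K_def)
  have inner: "(\<integral>\<^sup>+w. ennreal (w\<^sup>2) * K w (w * u) (w * v) \<partial>lborel) =
      F (stereo u v) * ennreal (1 / (3 * ((1 + u\<^sup>2 + v\<^sup>2) / 2)\<^sup>2))" for u v
  proof -
    have "0 < (1 + u\<^sup>2 + v\<^sup>2) / 2" using stereo_denom_pos[of u v] by simp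
    from nn_integral_sq_Icc[OF this] show ?thesis
      unfolding K_scale by (subst nn_integral_cmult) simp_all
  qed
  have scale2: "(\<integral>\<^sup>+a. \<integral>\<^sup>+b. K w a b \<partial>lborel \<partial>lborel) =
      (\<integral>\<^sup>+u. \<integral>\<^sup>+v. ennreal (w\<^sup>2) * K w (w * u) (w * v) \<partial>lborel \<partial>lborel)" for w
  proof (cases "w > 0")
    case True
    have "(\<integral>\<^sup>+a. \<integral>\<^sup>+b. K w a b \<partial>lborel \<partial>lborel) = ennreal w * (\<integral>\<^sup>+u. \<integral>\<^sup>+b. K w (w * u) b \<partial>lborel \<partial>lborel)"
      using True by (subst nn_integral_real_affine[where c=w and t=0]) simp_all
    also have "\<dots> = ennreal w * (\<integral>\<^sup>+u. ennreal w * (\<integral>\<^sup>+v. K w (w * u) (w * v) \<partial>lborel) \<partial>lborel)"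
      using True by (subst (2) nn_integral_real_affine[where c=w and t=0]) simp_all
    also have "\<dots> = (\<integral>\<^sup>+u. \<integral>\<^sup>+v. ennreal w * (ennreal w * K w (w * u) (w * v)) \<partial>lborel \<partial>lborel)"
      by (simp add: nn_integral_cmult)
    finally show ?thesis using True by (simp add: power2_eq_square ennreal_mult mult.assoc)
  qed (simp add: K_def)
  have "(\<integral>\<^sup>+x. F (x /\<^sub>R norm x) * indicator (cball 0 1) x \<partial>lborel) =
      (\<integral>\<^sup>+a. \<integral>\<^sup>+b. \<integral>\<^sup>+c. H a b c \<partial>lborel \<partial>lborel \<partial>lborel)"
    unfolding H_def by (rule nn_integral_lborel_vec3) measurable
  also have "\<dots> = (\<integral>\<^sup>+a. \<integral>\<^sup>+b. \<integral>\<^sup>+w. K w a b \<partial>lborel \<partial>lborel \<partial>lborel)"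
  proof (rule nn_integral_cong_AE, rule eventually_mono[OF AE_lborel_singleton[of 0]])
    fix a :: real assume "a \<noteq> 0"
    then have "a\<^sup>2 + b\<^sup>2 > 0" for b by (simp add: add_pos_nonneg)
    then show "(\<integral>\<^sup>+b. \<integral>\<^sup>+c. H a b c \<partial>lborel \<partial>lborel) = (\<integral>\<^sup>+b. \<integral>\<^sup>+w. K w a b \<partial>lborel \<partial>lborel)"
      unfolding K_def by (intro nn_integral_cong nn_integral_radial_substitution) measurable
  qed
  also have "\<dots> = (\<integral>\<^sup>+a. \<integral>\<^sup>+w. \<integral>\<^sup>+b. K w a b \<partial>lborel \<partial>lborel \<partial>lborel)"
    by (intro nn_integral_cong lborel_pair.Fubini') measurable
  also have "\<dots> = (\<integral>\<^sup>+w. \<integral>\<^sup>+a. \<integral>\<^sup>+b. K w a b \<partial>lborel \<partial>lborel \<partial>lborel)"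
    by (intro lborel_pair.Fubini') measurable
  also have "\<dots> = (\<integral>\<^sup>+w. \<integral>\<^sup>+u. \<integral>\<^sup>+v. ennreal (w\<^sup>2) * K w (w * u) (w * v) \<partial>lborel \<partial>lborel \<partial>lborel)"
    unfolding scale2 ..
  also have "\<dots> = (\<integral>\<^sup>+u. \<integral>\<^sup>+w. \<integral>\<^sup>+v. ennreal (w\<^sup>2) * K w (w * u) (w * v) \<partial>lborel \<partial>lborel \<partial>lborel)"
    by (intro lborel_pair.Fubini') measurable
  also have "\<dots> = (\<integral>\<^sup>+u. \<integral>\<^sup>+v. \<integral>\<^sup>+w. ennreal (w\<^sup>2) * K w (w * u) (w * v) \<partial>lborel \<partial>lborel \<partial>lborel)"
    by (intro nn_integral_cong lborel_pair.Fubini') measurable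
  also have "\<dots> = (\<integral>\<^sup>+u. \<integral>\<^sup>+v. F (stereo u v) * ennreal (1 / (3 * ((1 + u\<^sup>2 + v\<^sup>2) / 2)\<^sup>2)) \<partial>lborel \<partial>lborel)"
    unfolding inner ..
  finally have eq: "(\<integral>\<^sup>+x. F x \<partial>uniform_sphere) = ennreal (3 / (4 * pi)) *
     (\<integral>\<^sup>+u. \<integral>\<^sup>+v. F (stereo u v) * ennreal (1 / (3 * ((1 + u\<^sup>2 + v\<^sup>2) / 2)\<^sup>2)) \<partial>lborel \<partial>lborel)"
    by (simp add: nn_integral_uniform_sphere)
  have const: "ennreal (3 / (4 * pi)) * (F (stereo u v) * ennreal (1 / (3 * ((1 + u\<^sup>2 + v\<^sup>2) / 2)\<^sup>2))) =
     F (stereo u v) * ennreal (1 / (pi * (1 + u\<^sup>2 + v\<^sup>2)\<^sup>2))" for u v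
  proof -
    have "3 / (4 * pi) * (1 / (3 * ((1 + u\<^sup>2 + v\<^sup>2) / 2)\<^sup>2)) = 1 / (pi * (1 + u\<^sup>2 + v\<^sup>2)\<^sup>2)"
      by (simp add: power_divide)
    then have "ennreal (3 / (4 * pi)) * ennreal (1 / (3 * ((1 + u\<^sup>2 + v\<^sup>2) / 2)\<^sup>2)) =
        ennreal (1 / (pi * (1 + u\<^sup>2 + v\<^sup>2)\<^sup>2))"
      by (simp flip: ennreal_mult)
    then show ?thesis by (simp only: mult_ac)
  qed
  show ?thesis
    unfolding eq const[symmetric] by (simp add: nn_integral_cmult)
qed

section \<open>Measure of spherical caps\<close>

text \<open>
  The function \<open>u / sqrt (1 + u\<^sup>2)\<close> is the sine of the angle with tangent \<open>u\<close>. It converts the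
  distance of a line from the origin in the projection plane into the offset of the corresponding
  plane in space.
\<close>

lemma DERIV_slope_sin:
  "((\<lambda>u::real. u / sqrt (1 + u\<^sup>2)) has_real_derivative 1 / ((1 + z\<^sup>2) * sqrt (1 + z\<^sup>2))) (at z)"
proof -
  have pos: "0 < 1 + z\<^sup>2" by (simp add: add_pos_nonneg)
  have "((\<lambda>x. x / sqrt (1 + x\<^sup>2)) has_real_derivative
      (sqrt (1 + z\<^sup>2) - z * (2 * z / (2 * sqrt (1 + z\<^sup>2)))) / (1 + z\<^sup>2)) (at z)"
    using pos by (auto intro!: derivative_eq_intros simp: power2_eq_square field_simps)
  also have "(sqrt (1 + z\<^sup>2) - z * (2 * z / (2 * sqrt (1 + z\<^sup>2)))) / (1 + z\<^sup>2) = 1 / ((1 + z\<^sup>2) * sqrt (1 + z\<^sup>2))"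
  proof -
    have "sqrt (1 + z\<^sup>2) * sqrt (1 + z\<^sup>2) = 1 + z\<^sup>2" using pos by simp
    then have "sqrt (1 + z\<^sup>2) - z * (2 * z / (2 * sqrt (1 + z\<^sup>2))) = 1 / sqrt (1 + z\<^sup>2)"
      using pos by (simp add: field_simps power2_eq_square)
    then show ?thesis by simp
  qed
  finally show ?thesis .
qed

lemma slope_sin_less_iff: "u / sqrt (1 + u\<^sup>2) < v / sqrt (1 + v\<^sup>2) \<longleftrightarrow> u < (v::real)"
proof -
  have mono: "x / sqrt (1 + x\<^sup>2) < y / sqrt (1 + y\<^sup>2)" if "x < y" for x y :: real
  proof (rule DERIV_pos_imp_increasing[OF that])
    fix z :: real
    have "0 < 1 + z\<^sup>2" by (simp add: add_pos_nonneg)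
    then show "\<exists>d. ((\<lambda>x. x / sqrt (1 + x\<^sup>2)) has_real_derivative d) (at z) \<and> 0 < d"
      by (intro exI[of _ "1 / ((1 + z\<^sup>2) * sqrt (1 + z\<^sup>2))"]) (simp add: DERIV_slope_sin)
  qed
  show ?thesis using mono[of u v] mono[of v u] by (cases u v rule: linorder_cases) auto
qed

lemma slope_sin_inverse:
  fixes h :: real
  assumes "\<bar>h\<bar> < 1"
  defines "d \<equiv> h / sqrt (1 - h\<^sup>2)"
  shows "d / sqrt (1 + d\<^sup>2) = h"
proof -
  have p: "0 < 1 - h\<^sup>2" using assms(1) by (simp add: abs_square_less_1)
  then have "1 + d\<^sup>2 = 1 / (1 - h\<^sup>2)" by (simp add: d_def power_divide field_simps)
  then show ?thesis using p by (simp add: d_def real_sqrt_divide)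
qed

lemma range_slope_sin: "range (\<lambda>u::real. u / sqrt (1 + u\<^sup>2)) = {-1<..<1}"
proof (intro equalityI subsetI)
  fix h :: real assume "h \<in> {-1<..<1}"
  then have "\<bar>h\<bar> < 1" by auto
  then show "h \<in> range (\<lambda>u. u / sqrt (1 + u\<^sup>2))"
    using slope_sin_inverse by (intro range_eqI[where x="h / sqrt (1 - h\<^sup>2)"]) (rule sym)
next
  fix h :: real assume "h \<in> range (\<lambda>u. u / sqrt (1 + u\<^sup>2))"
  then obtain u where h: "h = u / sqrt (1 + u\<^sup>2)" by blast
  define s where "s = sqrt (1 + u\<^sup>2)"
  have "\<bar>u\<bar> < s" unfolding s_def by (intro real_less_rsqrt) simp
  then show "h \<in> {-1<..<1}" unfolding h s_def[symmetric] by (auto simp: field_simps abs_less_iff)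
qed

lemma nn_integral_slope_sin:
  assumes [measurable]: "f \<in> borel_measurable (borel :: real measure)"
  shows "(\<integral>\<^sup>+u. f (u / sqrt (1 + u\<^sup>2)) * ennreal (1 / ((1 + u\<^sup>2) * sqrt (1 + u\<^sup>2))) \<partial>lborel) =
     (\<integral>\<^sup>+h. f h * indicator {-1<..<1} h \<partial>lborel)"
proof -
  have e: "einterval (-\<infinity>) \<infinity> = UNIV" by (auto simp: einterval_def)
  have pos: "0 < 1 + (z::real)\<^sup>2" for z by (simp add: add_pos_nonneg)
  have "(\<integral>\<^sup>+h. f h * indicator ((\<lambda>u. u / sqrt (1 + u\<^sup>2)) ` einterval (-\<infinity>) \<infinity>) h \<partial>lborel) =
     (\<integral>\<^sup>+u. f (u / sqrt (1 + u\<^sup>2)) * ennreal (1 / ((1 + u\<^sup>2) * sqrt (1 + u\<^sup>2))) * indicator (einterval (-\<infinity>) \<infinity>) u \<partial>lborel)"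
  proof (rule nn_integral_substitution_open)
    fix z :: real
    have "(1 + z\<^sup>2) * sqrt (1 + z\<^sup>2) \<noteq> 0" using pos[of z] by simp
    then show "isCont (\<lambda>u. 1 / ((1 + u\<^sup>2) * sqrt (1 + u\<^sup>2))) z"
      by (intro continuous_intros)
  qed (auto intro: DERIV_slope_sin)
  then show ?thesis unfolding e range_slope_sin by simp
qed

lemma nn_integral_abs_affine:
  assumes [measurable]: "f \<in> borel_measurable (borel :: real measure)" and c: "c \<noteq> 0"
  shows "(\<integral>\<^sup>+x. f x \<partial>lborel) = (\<integral>\<^sup>+x. ennreal \<bar>c\<bar> * f (t + c * x) \<partial>lborel)"
  using nn_integral_real_affine[of f c t] c by (simp add: nn_integral_cmult)

lemma nn_integral_indicator_Iio_Ioo: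
  assumes "-1 \<le> h" "h \<le> 1"
  shows "(\<integral>\<^sup>+x. indicator {..<h} x * indicator {-1<..<1} x \<partial>lborel) = ennreal (1 + h)"
proof -
  have "(\<integral>\<^sup>+x. indicator {..<h} x * indicator {-1<..<1} x \<partial>lborel) = (\<integral>\<^sup>+x. indicator {-1<..<h} x \<partial>lborel)"
    using assms by (intro nn_integral_cong) (auto simp: indicator_def)
  then show ?thesis using assms by (simp add: add.commute)
qed

text \<open>
  The south pole lies on the boundary of the cap of offset \<open>h\<close> around this image of \<open>c\<close>.
\<close>

lemma orthogonal_boundary_to_south_pole:
  fixes c :: "real^3"
  assumes c: "norm c = 1" and h: "\<bar>h\<bar> < 1"
  obtains f where "orthogonal_transformation f" "f c = vec3 (sqrt (1 - h\<^sup>2)) 0 (- h)"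
proof -
  have "0 < 1 - h\<^sup>2" using h by (simp add: abs_square_less_1)
  then have "norm (vec3 (sqrt (1 - h\<^sup>2)) 0 (- h)) = 1" by (simp add: norm_vec3)
  then show ?thesis using orthogonal_transformation_exists_1[OF c] that by metis
qed

lemma nn_integral_stereo_density:
  "(\<integral>\<^sup>+v. ennreal (1 / (pi * (1 + u\<^sup>2 + v\<^sup>2)\<^sup>2)) \<partial>lborel) =
   ennreal (1 / ((1 + u\<^sup>2) * sqrt (1 + u\<^sup>2))) * (\<integral>\<^sup>+t. ennreal (1 / (pi * (1 + t\<^sup>2)\<^sup>2)) \<partial>lborel)"
proof -
  define r where "r = sqrt (1 + u\<^sup>2)"
  have r: "r > 0" "r\<^sup>2 = 1 + u\<^sup>2" by (auto simp: r_def add_pos_nonneg)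
  have scale: "r * (1 / (pi * (r\<^sup>2 * q)\<^sup>2)) = 1 / (r\<^sup>2 * r) * (1 / (pi * q\<^sup>2))" for q
    using r(1) by (cases "q = 0") (simp_all add: field_simps power2_eq_square)
  have "(\<integral>\<^sup>+v. ennreal (1 / (pi * (1 + u\<^sup>2 + v\<^sup>2)\<^sup>2)) \<partial>lborel) =
      (\<integral>\<^sup>+t. ennreal \<bar>r\<bar> * ennreal (1 / (pi * (1 + u\<^sup>2 + (0 + r * t)\<^sup>2)\<^sup>2)) \<partial>lborel)"
    using r by (intro nn_integral_abs_affine) auto
  also have "\<dots> = (\<integral>\<^sup>+t. ennreal (1 / (r\<^sup>2 * r)) * ennreal (1 / (pi * (1 + t\<^sup>2)\<^sup>2)) \<partial>lborel)"
  proof (intro nn_integral_cong)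
    fix t
    have "1 + u\<^sup>2 + (0 + r * t)\<^sup>2 = r\<^sup>2 * (1 + t\<^sup>2)" using r(2) by (simp add: algebra_simps power_mult_distrib)
    then have "\<bar>r\<bar> * (1 / (pi * (1 + u\<^sup>2 + (0 + r * t)\<^sup>2)\<^sup>2)) = 1 / (r\<^sup>2 * r) * (1 / (pi * (1 + t\<^sup>2)\<^sup>2))"
      using r(1) scale[of "1 + t\<^sup>2"] by simp
    then show "ennreal \<bar>r\<bar> * ennreal (1 / (pi * (1 + u\<^sup>2 + (0 + r * t)\<^sup>2)\<^sup>2)) =
        ennreal (1 / (r\<^sup>2 * r)) * ennreal (1 / (pi * (1 + t\<^sup>2)\<^sup>2))"
      using r(1) by (simp flip: ennreal_mult)
  qed
  also have "\<dots> = ennreal (1 / (r\<^sup>2 * r)) * (\<integral>\<^sup>+t. ennreal (1 / (pi * (1 + t\<^sup>2)\<^sup>2)) \<partial>lborel)"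
    by (rule nn_integral_cmult) measurable
  finally show ?thesis unfolding r(2) unfolding r_def .
qed

text \<open>
  The integral is not computed directly: the total mass \<open>1\<close> of the sphere equals it times the
  integral of \<open>(1 + u\<^sup>2) powr (-3/2)\<close>, which is \<open>2\<close>.
\<close>

lemma stereo_marginal_mass: "(\<integral>\<^sup>+t. ennreal (1 / (pi * (1 + t\<^sup>2)\<^sup>2)) \<partial>lborel) = ennreal (1 / 2)"
proof -
  define \<kappa> where "\<kappa> = (\<integral>\<^sup>+t. ennreal (1 / (pi * (1 + t\<^sup>2)\<^sup>2)) \<partial>lborel)"
  have "1 = (\<integral>\<^sup>+x. 1 \<partial>uniform_sphere)"
    using uniform_sphere.emeasure_space_1 by simp
  also have "\<dots> = (\<integral>\<^sup>+u. 1 * ennreal (1 / ((1 + u\<^sup>2) * sqrt (1 + u\<^sup>2))) * \<kappa> \<partial>lborel)"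
    by (subst nn_integral_uniform_sphere_stereo) (simp_all add: nn_integral_stereo_density \<kappa>_def)
  also have "\<dots> = (\<integral>\<^sup>+u. 1 * ennreal (1 / ((1 + u\<^sup>2) * sqrt (1 + u\<^sup>2))) \<partial>lborel) * \<kappa>"
    by (rule nn_integral_multc) measurable
  also have "(\<integral>\<^sup>+u. 1 * ennreal (1 / ((1 + u\<^sup>2) * sqrt (1 + u\<^sup>2))) \<partial>lborel) = 2"
    using nn_integral_slope_sin[of "\<lambda>_. 1"] by simp
  finally have eq: "2 * \<kappa> = 1" ..
  then have "\<kappa> \<noteq> \<top>" by (auto simp: ennreal_mult_top)
  then obtain k where k: "k \<ge> 0" "\<kappa> = ennreal k" by (cases \<kappa>) auto
  with eq have "ennreal (2 * k) = ennreal 1" by (simp add: ennreal_mult)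
  then have k': "k = 1 / 2" using k(1) by (subst (asm) ennreal_inj) auto
  show ?thesis using k(2) unfolding \<kappa>_def k' .
qed

text \<open>
  After a rotation the boundary of the cap passes through the centre of projection, so that the cap
  becomes a half-plane and only the one-dimensional marginal of the planar density matters.
\<close>

lemma emeasure_uniform_sphere_cap:
  fixes c :: "real^3"
  assumes c: "norm c = 1" and h: "\<bar>h\<bar> < 1"
  shows "emeasure uniform_sphere {y. c \<bullet> y < h} = ennreal ((1 + h) / 2)"
proof -
  obtain f where f: "orthogonal_transformation f" "f c = vec3 (sqrt (1 - h\<^sup>2)) 0 (- h)"
    using orthogonal_boundary_to_south_pole[OF c h] .
  define s where "s = sqrt (1 - h\<^sup>2)"
  have s: "s > 0" unfolding s_def using h by (simp add: abs_square_less_1)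
  have "emeasure uniform_sphere {y. c \<bullet> y < h} = (\<integral>\<^sup>+y. indicator {y. f c \<bullet> y < h} (f y) \<partial>uniform_sphere)"
    using f(1) by (simp add: nn_integral_indicator[symmetric] indicator_def orthogonal_transformation_def)
  also have "\<dots> = (\<integral>\<^sup>+y. indicator {y. f c \<bullet> y < h} y \<partial>uniform_sphere)"
    by (rule nn_integral_uniform_sphere_orthogonal[OF f(1)]) measurable
  also have "\<dots> = (\<integral>\<^sup>+u. \<integral>\<^sup>+v. indicator {y. f c \<bullet> y < h} (stereo u v) * ennreal (1 / (pi * (1 + u\<^sup>2 + v\<^sup>2)\<^sup>2)) \<partial>lborel \<partial>lborel)"
    by (rule nn_integral_uniform_sphere_stereo) measurable
  also have "\<dots> = (\<integral>\<^sup>+u. (indicator {..<h} (u / sqrt (1 + u\<^sup>2)) *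
      ennreal (1 / ((1 + u\<^sup>2) * sqrt (1 + u\<^sup>2)))) * ennreal (1 / 2) \<partial>lborel)"
  proof (intro nn_integral_cong)
    fix u :: real
    have iff: "f c \<bullet> stereo u v < h \<longleftrightarrow> u / sqrt (1 + u\<^sup>2) < h" for v
    proof -
      have "f c \<bullet> stereo u v < h \<longleftrightarrow>
          s * (2 * u / (1 + u\<^sup>2 + v\<^sup>2)) - h * ((1 - u\<^sup>2 - v\<^sup>2) / (1 + u\<^sup>2 + v\<^sup>2)) < h"
        by (simp add: f(2) inner_3 stereo_def s_def)
      also have "\<dots> \<longleftrightarrow> s * (2 * u) - h * (1 - u\<^sup>2 - v\<^sup>2) < h * (1 + u\<^sup>2 + v\<^sup>2)"
        using stereo_denom_pos[of u v] by (simp add: pos_divide_less_eq flip: diff_divide_distrib)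
      also have "\<dots> \<longleftrightarrow> u < h / s" using s by (simp add: pos_less_divide_eq algebra_simps)
      also have "\<dots> \<longleftrightarrow> u / sqrt (1 + u\<^sup>2) < h"
        unfolding slope_sin_less_iff[symmetric, of u] s_def slope_sin_inverse[OF h] ..
      finally show ?thesis .
    qed
    show "(\<integral>\<^sup>+v. indicator {y. f c \<bullet> y < h} (stereo u v) * ennreal (1 / (pi * (1 + u\<^sup>2 + v\<^sup>2)\<^sup>2)) \<partial>lborel) =
       (indicator {..<h} (u / sqrt (1 + u\<^sup>2)) * ennreal (1 / ((1 + u\<^sup>2) * sqrt (1 + u\<^sup>2)))) * ennreal (1 / 2)"
      unfolding indicator_def mem_Collect_eq iff
      by (simp add: nn_integral_cmult nn_integral_stereo_density stereo_marginal_mass del: ennreal_half)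
  qed
  also have "\<dots> = (\<integral>\<^sup>+u. indicator {..<h} (u / sqrt (1 + u\<^sup>2)) *
      ennreal (1 / ((1 + u\<^sup>2) * sqrt (1 + u\<^sup>2))) \<partial>lborel) * ennreal (1 / 2)"
    by (rule nn_integral_multc) measurable
  also have "\<dots> = ennreal (1 + h) * ennreal (1 / 2)"
    using h by (subst nn_integral_slope_sin) (simp_all only: nn_integral_indicator_Iio_Ioo, auto)
  also have "\<dots> = ennreal ((1 + h) * (1 / 2))"
    using h by (intro ennreal_mult[symmetric]) auto
  finally show ?thesis by simp
qed

lemma emeasure_uniform_sphere_opposite_cap:
  fixes c :: "real^3"
  assumes c: "norm c = 1" and h: "\<bar>h\<bar> < 1"
  shows "emeasure uniform_sphere {y. c \<bullet> y > h} = ennreal ((1 - h) / 2)"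
  using emeasure_uniform_sphere_cap[of "- c" "- h"] c h by simp

text \<open>
  The two open caps bounded by the plane already have total measure \<open>1\<close>.
\<close>

lemma AE_uniform_sphere_not_in_plane:
  fixes c :: "real^3"
  assumes c: "norm c = 1" and h: "\<bar>h\<bar> < 1"
  shows "AE y in uniform_sphere. c \<bullet> y \<noteq> h"
proof -
  have "emeasure uniform_sphere ({y. c \<bullet> y < h} \<union> {y. c \<bullet> y > h}) =
      emeasure uniform_sphere {y. c \<bullet> y < h} + emeasure uniform_sphere {y. c \<bullet> y > h}"
    by (rule plus_emeasure[symmetric]) auto
  also have "\<dots> = ennreal ((1 + h) / 2 + (1 - h) / 2)"
    using h unfolding emeasure_uniform_sphere_cap[OF c h] emeasure_uniform_sphere_opposite_cap[OF c h]
    by (intro ennreal_plus[symmetric]) auto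
  also have "(1 + h) / 2 + (1 - h) / 2 = 1" by (simp add: field_simps)
  also have "{y. c \<bullet> y < h} \<union> {y. c \<bullet> y > h} = {y. c \<bullet> y \<noteq> h}" by auto
  finally have "emeasure uniform_sphere {y \<in> space uniform_sphere. c \<bullet> y \<noteq> h} = 1" by simp
  then show ?thesis
    by (subst uniform_sphere.AE_iff_emeasure_eq_1) auto
qed

section \<open>Law of the plane through three random points\<close>

lemma measurable_vec_nth3 [measurable]:
  assumes [measurable]: "f \<in> borel_measurable M"
  shows "(\<lambda>x. (f x :: real^3) $ i) \<in> borel_measurable M"
proof -
  have "(\<lambda>x. f x \<bullet> axis i 1) \<in> borel_measurable M" by measurable
  then show ?thesis by (simp add: inner_axis)
qed

lemma cross3_vec3:
  "cross3 x y = vec3 (x $ 2 * y $ 3 - x $ 3 * y $ 2) (x $ 3 * y $ 1 - x $ 1 * y $ 3) (x $ 1 * y $ 2 - x $ 2 * y $ 1)"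
  by (simp add: vec_eq_iff forall_3 cross3_def)

lemma measurable_cross3 [measurable]:
  assumes [measurable]: "f \<in> borel_measurable M" "g \<in> borel_measurable M"
  shows "(\<lambda>x. cross3 (f x) (g x)) \<in> borel_measurable M"
  unfolding cross3_vec3 by measurable

definition plane_normal :: "real^3 \<Rightarrow> real^3 \<Rightarrow> real^3 \<Rightarrow> real^3" where
  "plane_normal x y z = cross3 (y - x) (z - x)"

text \<open>
  The offset is signed: exchanging two of the points reverses the normal and the sign. For collinear
  points it is \<open>0\<close>.
\<close>

definition plane_offset :: "real^3 \<Rightarrow> real^3 \<Rightarrow> real^3 \<Rightarrow> real" where
  "plane_offset x y z = plane_normal x y z \<bullet> x / norm (plane_normal x y z)"

lemma measurable_plane_normal [measurable]:
  assumes [measurable]: "f \<in> borel_measurable M" "g \<in> borel_measurable M" "h \<in> borel_measurable M"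
  shows "(\<lambda>x. plane_normal (f x) (g x) (h x)) \<in> borel_measurable M"
  unfolding plane_normal_def by measurable

lemma measurable_plane_offset [measurable]:
  assumes [measurable]: "f \<in> borel_measurable M" "g \<in> borel_measurable M" "h \<in> borel_measurable M"
  shows "(\<lambda>x. plane_offset (f x) (g x) (h x)) \<in> borel_measurable M"
  unfolding plane_offset_def by measurable

lemma abs_plane_offset_orthogonal:
  assumes f: "orthogonal_transformation f"
  shows "\<bar>plane_offset (f x) (f y) (f z)\<bar> = \<bar>plane_offset x y z\<bar>"
proof -
  have "plane_normal (f x) (f y) (f z) = det (matrix f) *\<^sub>R f (plane_normal x y z)"
    unfolding plane_normal_def cross_orthogonal_transformation[OF f, symmetric]
    using f by (simp add: linear_diff orthogonal_transformation_linear)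
  moreover have "\<bar>det (matrix f)\<bar> = 1" by (rule orthogonal_transformation_det[OF f])
  moreover have "f a \<bullet> f b = a \<bullet> b" for a b using f by (simp add: orthogonal_transformation_def)
  ultimately show ?thesis
    using f by (simp add: plane_offset_def abs_mult orthogonal_transformation_norm)
qed

text \<open>
  Seen from the pole, \<open>stereo u v\<close> lies in the direction \<open>(u, v, 1)\<close>. So the plane through the pole
  and two such points contains the line through \<open>(u, v)\<close> and \<open>(u', v')\<close> at height \<open>0\<close>, and its
  offset depends only on the distance of that line from the origin.
\<close>

lemma abs_plane_offset_stereo:
  "\<bar>plane_offset (vec3 0 0 (-1)) (stereo u v) (stereo u' v')\<bar> =
    \<bar>u * v' - v * u'\<bar> / sqrt ((v - v')\<^sup>2 + (u' - u)\<^sup>2 + (u * v' - v * u')\<^sup>2)"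
proof -
  define n where "n = vec3 (v - v') (u' - u) (u * v' - v * u')"
  define D where "D = 1 + u\<^sup>2 + v\<^sup>2"
  define D' where "D' = 1 + u'\<^sup>2 + v'\<^sup>2"
  have D: "D > 0" "D' > 0" unfolding D_def D'_def by (rule stereo_denom_pos)+
  have "stereo u v - vec3 0 0 (-1) = (2 / D) *\<^sub>R vec3 u v 1"
    using D by (simp add: vec_eq_iff forall_3 stereo_def D_def[symmetric]) (simp add: field_simps D_def)
  moreover have "stereo u' v' - vec3 0 0 (-1) = (2 / D') *\<^sub>R vec3 u' v' 1"
    using D by (simp add: vec_eq_iff forall_3 stereo_def D'_def[symmetric]) (simp add: field_simps D'_def)
  ultimately have "plane_normal (vec3 0 0 (-1)) (stereo u v) (stereo u' v') = (4 / (D * D')) *\<^sub>R n"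
    unfolding plane_normal_def by (simp add: cross_mult_left cross_mult_right)
      (simp add: cross3_vec3 n_def mult.commute)
  then have "\<bar>plane_offset (vec3 0 0 (-1)) (stereo u v) (stereo u' v')\<bar> = \<bar>n $ 3\<bar> / norm n"
    using D by (simp add: plane_offset_def inner_3 abs_mult)
  then show ?thesis by (simp add: n_def norm_vec3)
qed

text \<open>
  The affine Blaschke--Petkantschin formula in the plane, with the line through the two points written
  as \<open>v = m * u + b\<close>. For fixed \<open>u \<noteq> u'\<close> the map from \<open>(m, b)\<close> to \<open>(v, v')\<close> is linear, with
  determinant \<open>u' - u\<close> up to sign; it is a composition of two one-dimensional affine substitutions.
\<close>

lemma nn_integral_pairs_by_lines:
  fixes G :: "real \<times> real \<times> real \<times> real \<Rightarrow> ennreal"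
  assumes G: "G \<in> borel_measurable borel"
  shows "(\<integral>\<^sup>+u. \<integral>\<^sup>+v. \<integral>\<^sup>+u'. \<integral>\<^sup>+v'. G (u, v, u', v') \<partial>lborel \<partial>lborel \<partial>lborel \<partial>lborel) =
    (\<integral>\<^sup>+m. \<integral>\<^sup>+b. \<integral>\<^sup>+u. \<integral>\<^sup>+u'. ennreal \<bar>u' - u\<bar> * G (u, b + m * u, u', b + m * u') \<partial>lborel \<partial>lborel \<partial>lborel \<partial>lborel)"
proof -
  have [measurable]: "(\<lambda>x. G (f x, g x, h x, k x)) \<in> borel_measurable M"
    if [measurable]: "f \<in> borel_measurable M" "g \<in> borel_measurable M" "h \<in> borel_measurable M" "k \<in> borel_measurable M"
    for f g h k :: "'z \<Rightarrow> real" and M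
    by (rule measurable_compose[OF _ G]) (simp add: borel_prod[symmetric])
  have inner: "(\<integral>\<^sup>+v. \<integral>\<^sup>+v'. G (u, v, u', v') \<partial>lborel \<partial>lborel) =
      (\<integral>\<^sup>+m. \<integral>\<^sup>+b. ennreal \<bar>u' - u\<bar> * G (u, b + m * u, u', b + m * u') \<partial>lborel \<partial>lborel)"
    if ne: "u' \<noteq> u" for u u'
  proof -
    have "(\<integral>\<^sup>+v. \<integral>\<^sup>+v'. G (u, v, u', v') \<partial>lborel \<partial>lborel) =
        (\<integral>\<^sup>+v. \<integral>\<^sup>+m. ennreal \<bar>u' - u\<bar> * G (u, v, u', v + (u' - u) * m) \<partial>lborel \<partial>lborel)"
      using ne by (intro nn_integral_cong nn_integral_abs_affine) auto
    also have "\<dots> = (\<integral>\<^sup>+m. \<integral>\<^sup>+v. ennreal \<bar>u' - u\<bar> * G (u, v, u', v + (u' - u) * m) \<partial>lborel \<partial>lborel)"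
      by (intro lborel_pair.Fubini') measurable
    also have "\<dots> = (\<integral>\<^sup>+m. \<integral>\<^sup>+b. ennreal \<bar>1\<bar> * (ennreal \<bar>u' - u\<bar> * G (u, m * u + 1 * b, u', (m * u + 1 * b) + (u' - u) * m)) \<partial>lborel \<partial>lborel)"
      by (intro nn_integral_cong nn_integral_abs_affine) auto
    finally show ?thesis by (simp add: algebra_simps)
  qed
  have "(\<integral>\<^sup>+u. \<integral>\<^sup>+v. \<integral>\<^sup>+u'. \<integral>\<^sup>+v'. G (u, v, u', v') \<partial>lborel \<partial>lborel \<partial>lborel \<partial>lborel) =
    (\<integral>\<^sup>+u. \<integral>\<^sup>+u'. \<integral>\<^sup>+v. \<integral>\<^sup>+v'. G (u, v, u', v') \<partial>lborel \<partial>lborel \<partial>lborel \<partial>lborel)"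
    by (intro nn_integral_cong lborel_pair.Fubini') measurable
  also have "\<dots> = (\<integral>\<^sup>+u. \<integral>\<^sup>+u'. \<integral>\<^sup>+m. \<integral>\<^sup>+b. ennreal \<bar>u' - u\<bar> * G (u, b + m * u, u', b + m * u') \<partial>lborel \<partial>lborel \<partial>lborel \<partial>lborel)"
    by (intro nn_integral_cong nn_integral_cong_AE eventually_mono[OF AE_lborel_singleton] inner)
  also have "\<dots> = (\<integral>\<^sup>+u. \<integral>\<^sup>+m. \<integral>\<^sup>+u'. \<integral>\<^sup>+b. ennreal \<bar>u' - u\<bar> * G (u, b + m * u, u', b + m * u') \<partial>lborel \<partial>lborel \<partial>lborel \<partial>lborel)"
    by (intro nn_integral_cong lborel_pair.Fubini') measurable
  also have "\<dots> = (\<integral>\<^sup>+m. \<integral>\<^sup>+u. \<integral>\<^sup>+u'. \<integral>\<^sup>+b. ennreal \<bar>u' - u\<bar> * G (u, b + m * u, u', b + m * u') \<partial>lborel \<partial>lborel \<partial>lborel \<partial>lborel)"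
    by (intro lborel_pair.Fubini') measurable
  also have "\<dots> = (\<integral>\<^sup>+m. \<integral>\<^sup>+u. \<integral>\<^sup>+b. \<integral>\<^sup>+u'. ennreal \<bar>u' - u\<bar> * G (u, b + m * u, u', b + m * u') \<partial>lborel \<partial>lborel \<partial>lborel \<partial>lborel)"
    by (intro nn_integral_cong lborel_pair.Fubini') measurable
  also have "\<dots> = (\<integral>\<^sup>+m. \<integral>\<^sup>+b. \<integral>\<^sup>+u. \<integral>\<^sup>+u'. ennreal \<bar>u' - u\<bar> * G (u, b + m * u, u', b + m * u') \<partial>lborel \<partial>lborel \<partial>lborel \<partial>lborel)"
    by (intro nn_integral_cong lborel_pair.Fubini') measurable
  finally show ?thesis .
qed

text \<open>
  The integral over pairs of points on a line through the origin, weighted by their distance. The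
  normalization in \<open>nn_integral_plane_offset\<close> fixes its value implicitly.
\<close>

definition chord_constant :: ennreal where
  "chord_constant = (\<integral>\<^sup>+s. \<integral>\<^sup>+s'. ennreal (\<bar>s' - s\<bar> * (1 / (pi * (1 + s\<^sup>2)\<^sup>2) * (1 / (pi * (1 + s'\<^sup>2)\<^sup>2)))) \<partial>lborel \<partial>lborel)"

text \<open>
  On the line \<open>v = r * d + m * u\<close>, at distance \<open>\<bar>d\<bar>\<close> from the origin, completing the square gives
  \<open>1 + u\<^sup>2 + v\<^sup>2 = q\<^sup>2 (1 + s\<^sup>2)\<close> for \<open>u = t + (q / r) * s\<close>, where \<open>t\<close> belongs to the foot of
  the perpendicular. Hence the pairs on any line look like those on a line through the origin, up to
  powers of \<open>q\<close> and \<open>r\<close>.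
\<close>

lemma nn_integral_chord:
  fixes m d :: real
  defines "r \<equiv> sqrt (1 + m\<^sup>2)" and "q \<equiv> sqrt (1 + d\<^sup>2)"
  shows "(\<integral>\<^sup>+u. \<integral>\<^sup>+u'. ennreal (\<bar>u' - u\<bar> * (1 / (pi * (1 + u\<^sup>2 + (r * d + m * u)\<^sup>2)\<^sup>2) *
      (1 / (pi * (1 + u'\<^sup>2 + (r * d + m * u')\<^sup>2)\<^sup>2)))) \<partial>lborel \<partial>lborel) =
    ennreal (1 / (q ^ 5 * r ^ 3)) * chord_constant"
proof -
  have r: "r > 0" "r\<^sup>2 = 1 + m\<^sup>2" by (auto simp: r_def add_pos_nonneg)
  have q: "q > 0" "q\<^sup>2 = 1 + d\<^sup>2" by (auto simp: q_def add_pos_nonneg)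
  define \<sigma> where "\<sigma> = q / r"
  define t where "t = - m * d / r"
  have \<sigma>: "\<sigma> > 0" using r q by (simp add: \<sigma>_def)
  define J where "J u u' = \<bar>u' - u\<bar> * (1 / (pi * (1 + u\<^sup>2 + (r * d + m * u)\<^sup>2)\<^sup>2) *
      (1 / (pi * (1 + u'\<^sup>2 + (r * d + m * u')\<^sup>2)\<^sup>2)))" for u u'
  have J: "J u u' \<ge> 0" for u u' by (auto simp: J_def intro!: mult_nonneg_nonneg)
  have [measurable]: "(\<lambda>x. J (f x) (g x)) \<in> borel_measurable M"
    if [measurable]: "f \<in> borel_measurable M" "g \<in> borel_measurable M" for f g :: "'z \<Rightarrow> real" and M
    unfolding J_def by measurable
  (* the mixed terms in s cancel by the choice of t *)
  have quad: "1 + (t + \<sigma> * s)\<^sup>2 + (r * d + m * (t + \<sigma> * s))\<^sup>2 = q\<^sup>2 * (1 + s\<^sup>2)" for s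
  proof -
    have 1: "t + \<sigma> * s = (q * s - m * d) / r" by (simp add: t_def \<sigma>_def diff_divide_distrib)
    have 2: "r * d + m * (t + \<sigma> * s) = (r\<^sup>2 * d + m * (q * s - m * d)) / r"
      using r(1) unfolding 1 by (simp add: field_simps power2_eq_square)
    have 3: "r\<^sup>2 * d + m * (q * s - m * d) = d + m * q * s"
      unfolding r(2) by (simp add: algebra_simps power2_eq_square)
    have "(q * s - m * d)\<^sup>2 + (d + m * q * s)\<^sup>2 = (1 + m\<^sup>2) * (d\<^sup>2 + q\<^sup>2 * s\<^sup>2)"
      by (simp add: algebra_simps power2_eq_square)
    then have "((q * s - m * d) / r)\<^sup>2 + ((d + m * q * s) / r)\<^sup>2 = (r\<^sup>2 * (d\<^sup>2 + q\<^sup>2 * s\<^sup>2)) / r\<^sup>2"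
      unfolding power_divide add_divide_distrib[symmetric] r(2)[symmetric] by (simp only:)
    also have "\<dots> = d\<^sup>2 + q\<^sup>2 * s\<^sup>2" using r(1) by simp
    finally have "(t + \<sigma> * s)\<^sup>2 + (r * d + m * (t + \<sigma> * s))\<^sup>2 = d\<^sup>2 + q\<^sup>2 * s\<^sup>2"
      unfolding 2 3 unfolding 1 .
    then show ?thesis using q(2) by (simp add: algebra_simps)
  qed
  have J_eq: "\<sigma> * (\<sigma> * J (t + \<sigma> * s) (t + \<sigma> * s')) =
      1 / (q ^ 5 * r ^ 3) * (\<bar>s' - s\<bar> * (1 / (pi * (1 + s\<^sup>2)\<^sup>2) * (1 / (pi * (1 + s'\<^sup>2)\<^sup>2))))" for s s'
  proof -
    have "\<bar>t + \<sigma> * s' - (t + \<sigma> * s)\<bar> = \<sigma> * \<bar>s' - s\<bar>"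
      using \<sigma> by (simp add: abs_mult flip: right_diff_distrib)
    then have "\<sigma> * (\<sigma> * J (t + \<sigma> * s) (t + \<sigma> * s')) =
        \<sigma> * (\<sigma> * (\<sigma> * \<bar>s' - s\<bar> * (1 / (pi * (q\<^sup>2 * (1 + s\<^sup>2))\<^sup>2) * (1 / (pi * (q\<^sup>2 * (1 + s'\<^sup>2))\<^sup>2)))))"
      unfolding J_def quad by simp
    also have "\<dots> = \<sigma> ^ 3 / (q\<^sup>2)\<^sup>2 / (q\<^sup>2)\<^sup>2 * (\<bar>s' - s\<bar> * (1 / (pi * (1 + s\<^sup>2)\<^sup>2) * (1 / (pi * (1 + s'\<^sup>2)\<^sup>2))))"
      by (simp only: power3_eq_cube power_mult_distrib divide_inverse inverse_mult_distrib mult_1_left mult_ac)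
    also have "\<sigma> ^ 3 / (q\<^sup>2)\<^sup>2 / (q\<^sup>2)\<^sup>2 = 1 / (q ^ 5 * r ^ 3)"
      using q(1) r(1) by (simp add: \<sigma>_def power_divide field_simps flip: power_mult power_add)
    finally show ?thesis .
  qed
  have "(\<integral>\<^sup>+u. \<integral>\<^sup>+u'. ennreal (J u u') \<partial>lborel \<partial>lborel) =
      (\<integral>\<^sup>+s. ennreal \<bar>\<sigma>\<bar> * (\<integral>\<^sup>+u'. ennreal (J (t + \<sigma> * s) u') \<partial>lborel) \<partial>lborel)"
    using \<sigma> by (intro nn_integral_abs_affine) auto
  also have "\<dots> = (\<integral>\<^sup>+s. ennreal \<bar>\<sigma>\<bar> * (\<integral>\<^sup>+s'. ennreal \<bar>\<sigma>\<bar> * ennreal (J (t + \<sigma> * s) (t + \<sigma> * s')) \<partial>lborel) \<partial>lborel)"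
    using \<sigma> by (intro nn_integral_cong arg_cong[where f="\<lambda>x. _ * x"] nn_integral_abs_affine) auto
  also have "\<dots> = (\<integral>\<^sup>+s. \<integral>\<^sup>+s'. ennreal \<bar>\<sigma>\<bar> * (ennreal \<bar>\<sigma>\<bar> * ennreal (J (t + \<sigma> * s) (t + \<sigma> * s'))) \<partial>lborel \<partial>lborel)"
    by (intro nn_integral_cong nn_integral_cmult[symmetric]) measurable
  also have "\<dots> = (\<integral>\<^sup>+s. \<integral>\<^sup>+s'. ennreal (\<sigma> * (\<sigma> * J (t + \<sigma> * s) (t + \<sigma> * s'))) \<partial>lborel \<partial>lborel)"
    using \<sigma> J by (simp add: ennreal_mult)
  also have "\<dots> = (\<integral>\<^sup>+s. \<integral>\<^sup>+s'. ennreal (1 / (q ^ 5 * r ^ 3)) *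
      ennreal (\<bar>s' - s\<bar> * (1 / (pi * (1 + s\<^sup>2)\<^sup>2) * (1 / (pi * (1 + s'\<^sup>2)\<^sup>2)))) \<partial>lborel \<partial>lborel)"
    unfolding J_eq using q r by (intro nn_integral_cong ennreal_mult) auto
  also have "\<dots> = ennreal (1 / (q ^ 5 * r ^ 3)) * chord_constant"
    unfolding chord_constant_def by (simp add: nn_integral_cmult)
  finally show ?thesis unfolding J_def .
qed

text \<open>
  In the coordinates \<open>(m, d)\<close> of the line the integrand is a product. The slope \<open>m\<close> contributes a
  constant, and in \<open>h = d / sqrt (1 + d\<^sup>2)\<close>, the offset of the plane, the density in \<open>d\<close> becomes
  \<open>1 - h\<^sup>2\<close>.
\<close>

lemma nn_integral_plane_offset_pole:
  fixes K :: "real \<Rightarrow> ennreal"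
  assumes [measurable]: "K \<in> borel_measurable borel"
  shows "(\<integral>\<^sup>+y. \<integral>\<^sup>+z. K \<bar>plane_offset (vec3 0 0 (-1)) y z\<bar> \<partial>uniform_sphere \<partial>uniform_sphere) =
    (\<integral>\<^sup>+m. ennreal (1 / (1 + m\<^sup>2)) \<partial>lborel) * chord_constant *
    (\<integral>\<^sup>+h. K \<bar>h\<bar> * ennreal (1 - h\<^sup>2) * indicator {-1<..<1} h \<partial>lborel)"
proof -
  let ?p = "vec3 0 0 (-1)"
  define w where "w u v = 1 / (pi * (1 + u\<^sup>2 + v\<^sup>2)\<^sup>2)" for u v :: real
  define G where "G = (\<lambda>(u, v, u', v'). K \<bar>plane_offset ?p (stereo u v) (stereo u' v')\<bar> *
      (ennreal (w u v) * ennreal (w u' v')))"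
  have w: "w u v \<ge> 0" for u v by (simp add: w_def)
  have [measurable]: "(\<lambda>x. w (f x) (g x)) \<in> borel_measurable M"
    if [measurable]: "f \<in> borel_measurable M" "g \<in> borel_measurable M" for f g :: "'z \<Rightarrow> real" and M
    unfolding w_def by measurable
  have G: "G \<in> borel_measurable borel"
    unfolding G_def borel_prod[symmetric] by measurable
  have "(\<integral>\<^sup>+y. \<integral>\<^sup>+z. K \<bar>plane_offset ?p y z\<bar> \<partial>uniform_sphere \<partial>uniform_sphere) =
    (\<integral>\<^sup>+u. \<integral>\<^sup>+v. (\<integral>\<^sup>+z. K \<bar>plane_offset ?p (stereo u v) z\<bar> \<partial>uniform_sphere) * ennreal (w u v) \<partial>lborel \<partial>lborel)"
    unfolding w_def by (rule nn_integral_uniform_sphere_stereo) measurable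
  also have "\<dots> = (\<integral>\<^sup>+u. \<integral>\<^sup>+v. (\<integral>\<^sup>+u'. \<integral>\<^sup>+v'. K \<bar>plane_offset ?p (stereo u v) (stereo u' v')\<bar> *
      ennreal (w u' v') \<partial>lborel \<partial>lborel) * ennreal (w u v) \<partial>lborel \<partial>lborel)"
    unfolding w_def by (subst nn_integral_uniform_sphere_stereo) simp_all
  also have "\<dots> = (\<integral>\<^sup>+u. \<integral>\<^sup>+v. \<integral>\<^sup>+u'. \<integral>\<^sup>+v'. G (u, v, u', v') \<partial>lborel \<partial>lborel \<partial>lborel \<partial>lborel)"
    by (simp add: G_def nn_integral_cmult mult_ac)
  also have "\<dots> = (\<integral>\<^sup>+m. \<integral>\<^sup>+b. \<integral>\<^sup>+u. \<integral>\<^sup>+u'. ennreal \<bar>u' - u\<bar> * G (u, b + m * u, u', b + m * u') \<partial>lborel \<partial>lborel \<partial>lborel \<partial>lborel)"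
    by (rule nn_integral_pairs_by_lines[OF G])
  also have "\<dots> = (\<integral>\<^sup>+m. \<integral>\<^sup>+b. K (\<bar>b\<bar> / sqrt (1 + m\<^sup>2 + b\<^sup>2)) * (\<integral>\<^sup>+u. \<integral>\<^sup>+u'. ennreal (\<bar>u' - u\<bar> *
      (w u (b + m * u) * w u' (b + m * u'))) \<partial>lborel \<partial>lborel) \<partial>lborel \<partial>lborel)"
  proof -
    have "ennreal \<bar>u' - u\<bar> * G (u, b + m * u, u', b + m * u') =
       K (\<bar>b\<bar> / sqrt (1 + m\<^sup>2 + b\<^sup>2)) * ennreal (\<bar>u' - u\<bar> * (w u (b + m * u) * w u' (b + m * u')))" for m b u u'
    proof (cases "u' = u")
      case False
      have 1: "u * (b + m * u') - (b + m * u) * u' = b * (u - u')" by (simp add: algebra_simps)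
      have "((b + m * u) - (b + m * u'))\<^sup>2 + (u' - u)\<^sup>2 + (b * (u - u'))\<^sup>2 = (u' - u)\<^sup>2 * (1 + m\<^sup>2 + b\<^sup>2)"
        by (simp add: algebra_simps power2_eq_square)
      then have "\<bar>plane_offset ?p (stereo u (b + m * u)) (stereo u' (b + m * u'))\<bar> =
          \<bar>b * (u - u')\<bar> / sqrt ((u' - u)\<^sup>2 * (1 + m\<^sup>2 + b\<^sup>2))"
        unfolding abs_plane_offset_stereo 1 by simp
      also have "\<dots> = \<bar>b\<bar> / sqrt (1 + m\<^sup>2 + b\<^sup>2)"
        using False by (simp add: real_sqrt_mult abs_mult abs_minus_commute)
      finally show ?thesis using w by (simp add: G_def ennreal_mult mult_ac)
    qed simp
    then show ?thesis by (simp add: nn_integral_cmult)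
  qed
  also have "\<dots> = (\<integral>\<^sup>+m. \<integral>\<^sup>+d. ennreal \<bar>sqrt (1 + m\<^sup>2)\<bar> * (K (\<bar>0 + sqrt (1 + m\<^sup>2) * d\<bar> / sqrt (1 + m\<^sup>2 + (0 + sqrt (1 + m\<^sup>2) * d)\<^sup>2)) *
      (\<integral>\<^sup>+u. \<integral>\<^sup>+u'. ennreal (\<bar>u' - u\<bar> * (w u ((0 + sqrt (1 + m\<^sup>2) * d) + m * u) *
         w u' ((0 + sqrt (1 + m\<^sup>2) * d) + m * u'))) \<partial>lborel \<partial>lborel)) \<partial>lborel \<partial>lborel)"
  proof (rule nn_integral_cong, rule nn_integral_abs_affine)
    fix m :: real
    show "sqrt (1 + m\<^sup>2) \<noteq> 0" by (simp add: add_pos_nonneg less_imp_neq[symmetric])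
  qed measurable
  also have "\<dots> = (\<integral>\<^sup>+m. \<integral>\<^sup>+d. ennreal (1 / (1 + m\<^sup>2)) * (chord_constant * (K \<bar>d / sqrt (1 + d\<^sup>2)\<bar> *
      ennreal (1 - (d / sqrt (1 + d\<^sup>2))\<^sup>2) * ennreal (1 / ((1 + d\<^sup>2) * sqrt (1 + d\<^sup>2))))) \<partial>lborel \<partial>lborel)"
  proof (intro nn_integral_cong)
    fix m d :: real
    define r where "r = sqrt (1 + m\<^sup>2)"
    define q where "q = sqrt (1 + d\<^sup>2)"
    have r: "r > 0" "r\<^sup>2 = 1 + m\<^sup>2" by (auto simp: r_def add_pos_nonneg)
    have q: "q > 0" "q\<^sup>2 = 1 + d\<^sup>2" by (auto simp: q_def add_pos_nonneg)
    have "1 + m\<^sup>2 + (0 + r * d)\<^sup>2 = (r * q)\<^sup>2"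
      by (simp add: power_mult_distrib r q algebra_simps)
    then have arg: "\<bar>0 + r * d\<bar> / sqrt (1 + m\<^sup>2 + (0 + r * d)\<^sup>2) = \<bar>d / q\<bar>"
      using r(1) q(1) by (simp add: abs_mult)
    have sq: "1 - (d / q)\<^sup>2 = 1 / q\<^sup>2"
    proof -
      have "1 - (d / q)\<^sup>2 = (q\<^sup>2 - d\<^sup>2) / q\<^sup>2"
        using q(1) by (simp add: power_divide diff_divide_distrib)
      also have "q\<^sup>2 - d\<^sup>2 = 1" using q(2) by simp
      finally show ?thesis .
    qed
    have chord: "(\<integral>\<^sup>+u. \<integral>\<^sup>+u'. ennreal (\<bar>u' - u\<bar> * (w u ((0 + r * d) + m * u) *
         w u' ((0 + r * d) + m * u'))) \<partial>lborel \<partial>lborel) = ennreal (1 / (q ^ 5 * r ^ 3)) * chord_constant"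
      unfolding w_def r_def q_def add_0 by (rule nn_integral_chord)
    have "r * (1 / (q ^ 5 * r ^ 3)) = 1 / r\<^sup>2 * (1 / q\<^sup>2 * (1 / (q\<^sup>2 * q)))"
      using r(1) q(1) by (simp add: field_simps flip: power_add power_Suc power_Suc2)
    then have coef: "ennreal r * ennreal (1 / (q ^ 5 * r ^ 3)) =
        ennreal (1 / r\<^sup>2) * (ennreal (1 / q\<^sup>2) * ennreal (1 / (q\<^sup>2 * q)))"
      using r(1) q(1) by (simp flip: ennreal_mult)
    have "ennreal \<bar>r\<bar> * (K \<bar>d / q\<bar> * (ennreal (1 / (q ^ 5 * r ^ 3)) * chord_constant)) =
        ennreal r * ennreal (1 / (q ^ 5 * r ^ 3)) * (K \<bar>d / q\<bar> * chord_constant)"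
      using r(1) by (simp only: abs_of_pos mult_ac)
    also have "\<dots> = ennreal (1 / r\<^sup>2) * (chord_constant * (K \<bar>d / q\<bar> *
      ennreal (1 - (d / q)\<^sup>2) * ennreal (1 / (q\<^sup>2 * q))))"
      unfolding coef sq by (simp only: mult_ac)
    finally have E: "ennreal \<bar>r\<bar> * (K \<bar>d / q\<bar> * (ennreal (1 / (q ^ 5 * r ^ 3)) * chord_constant)) =
        ennreal (1 / r\<^sup>2) * (chord_constant * (K \<bar>d / q\<bar> *
          ennreal (1 - (d / q)\<^sup>2) * ennreal (1 / (q\<^sup>2 * q))))" .
    show "ennreal \<bar>sqrt (1 + m\<^sup>2)\<bar> * (K (\<bar>0 + sqrt (1 + m\<^sup>2) * d\<bar> / sqrt (1 + m\<^sup>2 + (0 + sqrt (1 + m\<^sup>2) * d)\<^sup>2)) *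
      (\<integral>\<^sup>+u. \<integral>\<^sup>+u'. ennreal (\<bar>u' - u\<bar> * (w u ((0 + sqrt (1 + m\<^sup>2) * d) + m * u) *
         w u' ((0 + sqrt (1 + m\<^sup>2) * d) + m * u'))) \<partial>lborel \<partial>lborel)) =
      ennreal (1 / (1 + m\<^sup>2)) * (chord_constant * (K \<bar>d / sqrt (1 + d\<^sup>2)\<bar> *
      ennreal (1 - (d / sqrt (1 + d\<^sup>2))\<^sup>2) * ennreal (1 / ((1 + d\<^sup>2) * sqrt (1 + d\<^sup>2)))))"
      unfolding r_def[symmetric] q_def[symmetric] arg chord by (rule E[unfolded r(2) q(2)])
  qed
  also have "\<dots> = (\<integral>\<^sup>+m. ennreal (1 / (1 + m\<^sup>2)) \<partial>lborel) * (chord_constant *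
      (\<integral>\<^sup>+d. K \<bar>d / sqrt (1 + d\<^sup>2)\<bar> *
      ennreal (1 - (d / sqrt (1 + d\<^sup>2))\<^sup>2) * ennreal (1 / ((1 + d\<^sup>2) * sqrt (1 + d\<^sup>2))) \<partial>lborel))"
    by (simp add: nn_integral_cmult nn_integral_multc del: divide_ennreal_def)
  also have "\<dots> = (\<integral>\<^sup>+m. ennreal (1 / (1 + m\<^sup>2)) \<partial>lborel) * (chord_constant *
      (\<integral>\<^sup>+h. K \<bar>h\<bar> * ennreal (1 - h\<^sup>2) * indicator {-1<..<1} h \<partial>lborel))"
    by (subst nn_integral_slope_sin) simp_all
  finally show ?thesis by (simp only: mult.assoc)
qed

lemma nn_integral_parabola: "(\<integral>\<^sup>+h. ennreal (1 - h\<^sup>2) * indicator {-1<..<1} h \<partial>lborel) = ennreal (4 / 3)"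
proof -
  have "(\<integral>\<^sup>+h. ennreal (1 - h\<^sup>2) * indicator {-1<..<1} h \<partial>lborel) =
      (\<integral>\<^sup>+h. ennreal (1 - h\<^sup>2) * indicator {-1..1} h \<partial>lborel)"
    by (rule nn_integral_cong) (auto simp: indicator_def power2_eq_1_iff)
  also have "\<dots> = ennreal ((1 - 1 ^ 3 / 3) - (- 1 - (- 1) ^ 3 / 3))"
    by (rule nn_integral_FTC_Icc) (auto intro!: derivative_eq_intros simp: power_le_one abs_square_le_1)
  finally show ?thesis by simp
qed

text \<open>
  The inner double integral does not depend on the first point, which can therefore be rotated to the
  south pole. The case \<open>K = 1\<close> determines the constant.
\<close>

lemma nn_integral_plane_offset:
  fixes K :: "real \<Rightarrow> ennreal"
  assumes [measurable]: "K \<in> borel_measurable borel"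
  shows "(\<integral>\<^sup>+x. \<integral>\<^sup>+y. \<integral>\<^sup>+z. K \<bar>plane_offset x y z\<bar> \<partial>uniform_sphere \<partial>uniform_sphere \<partial>uniform_sphere) =
    ennreal (3 / 4) * (\<integral>\<^sup>+h. K \<bar>h\<bar> * ennreal (1 - h\<^sup>2) * indicator {-1<..<1} h \<partial>lborel)"
proof -
  let ?p = "vec3 0 0 (-1)"
  define A where "A = (\<integral>\<^sup>+m. ennreal (1 / (1 + m\<^sup>2)) \<partial>lborel) * chord_constant"
  have rot: "(\<integral>\<^sup>+x. \<integral>\<^sup>+y. \<integral>\<^sup>+z. L \<bar>plane_offset x y z\<bar> \<partial>uniform_sphere \<partial>uniform_sphere \<partial>uniform_sphere) =
    A * (\<integral>\<^sup>+h. L \<bar>h\<bar> * ennreal (1 - h\<^sup>2) * indicator {-1<..<1} h \<partial>lborel)"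
    if [measurable]: "L \<in> borel_measurable borel" for L :: "real \<Rightarrow> ennreal"
  proof -
    have "(\<integral>\<^sup>+x. \<integral>\<^sup>+y. \<integral>\<^sup>+z. L \<bar>plane_offset x y z\<bar> \<partial>uniform_sphere \<partial>uniform_sphere \<partial>uniform_sphere) =
      (\<integral>\<^sup>+x. (\<integral>\<^sup>+y. \<integral>\<^sup>+z. L \<bar>plane_offset ?p y z\<bar> \<partial>uniform_sphere \<partial>uniform_sphere) \<partial>uniform_sphere)"
    proof (rule nn_integral_cong_AE, rule eventually_mono[OF AE_uniform_sphere_norm])
      fix x :: "real^3" assume "norm x = 1"
      moreover have "norm ?p = 1" by (simp add: norm_vec3)
      ultimately obtain f where f: "orthogonal_transformation f" "f x = ?p"
        by (rule orthogonal_transformation_exists_1)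
      have [measurable]: "f \<in> borel_measurable borel"
        using f by (intro borel_measurable_continuous_onI linear_continuous_on)
          (simp add: orthogonal_transformation_linear linear_conv_bounded_linear[symmetric])
      have "(\<integral>\<^sup>+y. \<integral>\<^sup>+z. L \<bar>plane_offset x y z\<bar> \<partial>uniform_sphere \<partial>uniform_sphere) =
          (\<integral>\<^sup>+y. \<integral>\<^sup>+z. L \<bar>plane_offset ?p (f y) (f z)\<bar> \<partial>uniform_sphere \<partial>uniform_sphere)"
        unfolding f(2)[symmetric] abs_plane_offset_orthogonal[OF f(1)] ..
      also have "\<dots> = (\<integral>\<^sup>+y. \<integral>\<^sup>+z. L \<bar>plane_offset ?p (f y) z\<bar> \<partial>uniform_sphere \<partial>uniform_sphere)"
        by (rule nn_integral_cong, rule nn_integral_uniform_sphere_orthogonal[OF f(1)]) measurable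
      also have "\<dots> = (\<integral>\<^sup>+y. \<integral>\<^sup>+z. L \<bar>plane_offset ?p y z\<bar> \<partial>uniform_sphere \<partial>uniform_sphere)"
        by (rule nn_integral_uniform_sphere_orthogonal[OF f(1)]) measurable
      finally show "(\<integral>\<^sup>+y. \<integral>\<^sup>+z. L \<bar>plane_offset x y z\<bar> \<partial>uniform_sphere \<partial>uniform_sphere) =
        (\<integral>\<^sup>+y. \<integral>\<^sup>+z. L \<bar>plane_offset ?p y z\<bar> \<partial>uniform_sphere \<partial>uniform_sphere)" .
    qed
    also have "\<dots> = (\<integral>\<^sup>+y. \<integral>\<^sup>+z. L \<bar>plane_offset ?p y z\<bar> \<partial>uniform_sphere \<partial>uniform_sphere)"
      by (simp add: uniform_sphere.emeasure_space_1[simplified])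
    finally show ?thesis unfolding A_def nn_integral_plane_offset_pole[OF that] .
  qed
  have "1 = A * ennreal (4 / 3)"
    using rot[of "\<lambda>_. 1"] by (simp add: nn_integral_parabola uniform_sphere.emeasure_space_1[simplified])
  then have "ennreal (3 / 4) * 1 = ennreal (3 / 4) * (A * ennreal (4 / 3))" by (simp only:)
  also have "\<dots> = A * (ennreal (3 / 4) * ennreal (4 / 3))" by (simp only: mult_ac)
  also have "ennreal (3 / 4) * ennreal (4 / 3) = 1" by (simp flip: ennreal_mult)
  finally have "A = ennreal (3 / 4)" by simp
  then show ?thesis using rot[OF assms] by simp
qed

section \<open>Facets and their holes\<close>

lemma plane_normal_swap: "plane_normal x z y = - plane_normal x y z"
  unfolding plane_normal_def by (rule cross_skew)

lemma plane_offset_swap: "plane_offset x z y = - plane_offset x y z"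
  by (simp add: plane_offset_def plane_normal_swap[of x z y])

lemma inner_plane_normal:
  "plane_normal x y z \<bullet> y = plane_normal x y z \<bullet> x" "plane_normal x y z \<bullet> z = plane_normal x y z \<bullet> x"
proof -
  have "plane_normal x y z \<bullet> (y - x) = 0" "plane_normal x y z \<bullet> (z - x) = 0"
    by (simp_all add: plane_normal_def dot_cross_self)
  then show "plane_normal x y z \<bullet> y = plane_normal x y z \<bullet> x" "plane_normal x y z \<bullet> z = plane_normal x y z \<bullet> x"
    by (simp_all add: inner_diff_right)
qed

lemma plane_normal_eq_0_iff: "plane_normal x y z = 0 \<longleftrightarrow> collinear {x, y, z}"
proof -
  have "collinear {x, y, z} \<longleftrightarrow> collinear {y, x, z}" by (simp add: insert_commute)
  also have "\<dots> \<longleftrightarrow> collinear {0, y - x, z - x}" by (rule collinear_3) (simp add: NO_MATCH_def)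
  finally show ?thesis by (simp add: plane_normal_def cross_eq_0)
qed

text \<open>
  A line meets the sphere in at most two points: \<open>x + c (y - x)\<close> has norm \<open>1\<close> only for \<open>c = 0\<close> and
  \<open>c = 1\<close>.
\<close>

lemma sphere_triple_not_collinear:
  fixes x y z :: "real^3"
  assumes n: "norm x = 1" "norm y = 1" "norm z = 1" and d: "x \<noteq> y" "x \<noteq> z" "y \<noteq> z"
  shows "plane_normal x y z \<noteq> 0"
proof
  assume "plane_normal x y z = 0"
  then have "collinear {0, y - x, z - x}" by (simp add: plane_normal_def cross_eq_0)
  then obtain c where c: "z - x = c *\<^sub>R (y - x)"
    using d by (auto simp: collinear_lemma)
  have u: "x \<bullet> x = 1" "y \<bullet> y = 1" "z \<bullet> z = 1" using n by (simp_all add: norm_eq_1)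
  define e where "e = (y - x) \<bullet> (y - x)"
  have e: "e \<noteq> 0" using d by (simp add: e_def)
  have xy: "2 * (x \<bullet> (y - x)) = - e"
    using u by (simp add: e_def inner_diff_left inner_diff_right inner_commute)
  have sq: "(x + c *\<^sub>R w) \<bullet> (x + c *\<^sub>R w) = x \<bullet> x + c * (2 * (x \<bullet> w)) + c * c * (w \<bullet> w)" for w
    by (simp add: inner_add_left inner_add_right inner_commute)
  have "z = x + c *\<^sub>R (y - x)" using c by (simp add: algebra_simps)
  then have "z \<bullet> z = x \<bullet> x + c * (2 * (x \<bullet> (y - x))) + c * c * e"
    unfolding e_def sq[symmetric] by (simp only:)
  then have "1 = 1 + c * (- e) + c * c * e" unfolding u xy .
  then have "c * (c - 1) * e = 0" by (simp add: algebra_simps)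
  then have "c = 0 \<or> c = 1" using e by simp
  then show False using c d by auto
qed

lemma affine_hull_triple:
  assumes n: "plane_normal x y z \<noteq> 0"
  shows "affine hull {x, y, z} = {w. plane_normal x y z \<bullet> w = plane_normal x y z \<bullet> x}"
    and "aff_dim {x, y, z} = 2"
proof -
  have nc: "\<not> collinear {x, y, z}" using n by (simp add: plane_normal_eq_0_iff)
  then have d: "x \<noteq> y" "x \<noteq> z" "y \<noteq> z" and ind: "\<not> affine_dependent {x, y, z}"
    by (auto simp: collinear_3_eq_affine_dependent)
  show dim: "aff_dim {x, y, z} = 2"
    using aff_dim_affine_independent[OF ind] d by simp
  show "affine hull {x, y, z} = {w. plane_normal x y z \<bullet> w = plane_normal x y z \<bullet> x}"
  proof (rule affine_dim_equal)
    show "affine hull {x, y, z} \<subseteq> {w. plane_normal x y z \<bullet> w = plane_normal x y z \<bullet> x}"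
      by (rule hull_minimal) (auto simp: inner_plane_normal affine_hyperplane)
    show "aff_dim (affine hull {x, y, z}) = aff_dim {w. plane_normal x y z \<bullet> w = plane_normal x y z \<bullet> x}"
      using n dim by simp
  qed (auto simp: affine_hyperplane)
qed

lemma plane_unique:
  assumes n: "plane_normal x y z \<noteq> 0" and a: "a \<noteq> 0" and T: "{x, y, z} \<subseteq> {w. a \<bullet> w = b}"
  shows "{w. plane_normal x y z \<bullet> w = plane_normal x y z \<bullet> x} = {w. a \<bullet> w = b}"
proof (rule affine_dim_equal)
  show "{w. plane_normal x y z \<bullet> w = plane_normal x y z \<bullet> x} \<subseteq> {w. a \<bullet> w = b}"
    unfolding affine_hull_triple(1)[OF n, symmetric]
    using T by (intro hull_minimal) (auto simp: affine_hyperplane)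
qed (use n a in \<open>auto simp: affine_hyperplane\<close>)

lemma
  fixes x y z :: "real^3"
  assumes n: "plane_normal x y z \<noteq> 0" and nx: "norm x = 1" and ny: "norm y = 1"
  defines "c \<equiv> plane_normal x y z /\<^sub>R norm (plane_normal x y z)"
  shows norm_unit_normal: "norm c = 1"
    and unit_normal_iff: "plane_normal x y z \<bullet> w < plane_normal x y z \<bullet> x \<longleftrightarrow> c \<bullet> w < plane_offset x y z"
      "plane_normal x y z \<bullet> w > plane_normal x y z \<bullet> x \<longleftrightarrow> c \<bullet> w > plane_offset x y z"
      "plane_normal x y z \<bullet> w = plane_normal x y z \<bullet> x \<longleftrightarrow> c \<bullet> w = plane_offset x y z"
    and abs_plane_offset_less_1: "\<bar>plane_offset x y z\<bar> < 1"
proof -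
  define r where "r = norm (plane_normal x y z)"
  have r: "r > 0" using n by (simp add: r_def)
  show c1: "norm c = 1" using n by (simp add: c_def)
  have cw: "c \<bullet> w = (plane_normal x y z \<bullet> w) / r" for w by (simp add: c_def r_def divide_inverse)
  have h: "plane_offset x y z = (plane_normal x y z \<bullet> x) / r" by (simp add: plane_offset_def r_def)
  show "plane_normal x y z \<bullet> w < plane_normal x y z \<bullet> x \<longleftrightarrow> c \<bullet> w < plane_offset x y z"
      "plane_normal x y z \<bullet> w > plane_normal x y z \<bullet> x \<longleftrightarrow> c \<bullet> w > plane_offset x y z"
      "plane_normal x y z \<bullet> w = plane_normal x y z \<bullet> x \<longleftrightarrow> c \<bullet> w = plane_offset x y z"
    unfolding cw h using r by (simp_all add: divide_less_cancel)
  have cx: "c \<bullet> x = plane_offset x y z" "c \<bullet> y = plane_offset x y z"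
    unfolding cw h by (simp_all add: inner_plane_normal)
  have le: "\<bar>plane_offset x y z\<bar> \<le> 1"
    using Cauchy_Schwarz_ineq2[of c x] c1 nx by (simp add: cx)
  have "\<bar>plane_offset x y z\<bar> \<noteq> 1"
  proof
    assume "\<bar>plane_offset x y z\<bar> = 1"
    then have h2: "plane_offset x y z * plane_offset x y z = 1" by (metis abs_mult_self_eq mult_1)
    have on: "w = plane_offset x y z *\<^sub>R c" if "norm w = 1" "c \<bullet> w = plane_offset x y z" for w
    proof -
      have "(w - plane_offset x y z *\<^sub>R c) \<bullet> (w - plane_offset x y z *\<^sub>R c) = 1 - 1"
        using that c1 h2 by (simp add: inner_diff_left inner_diff_right norm_eq_1 inner_commute)
      then show ?thesis by simp
    qed
    have "x = y" using on[OF nx cx(1)] on[OF ny cx(2)] by simp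
    then show False using n by (simp add: plane_normal_def)
  qed
  with le show "\<bar>plane_offset x y z\<bar> < 1" by simp
qed

text \<open>
  The difficulty is uniqueness of the radius. The boundary circle of any candidate spans the plane of
  the triple, so the offset of the candidate agrees with that of the plane up to sign, and the opposite
  sign would put a fourth point of \<open>P\<close> into the open cap.
\<close>

lemma hole_angle_triple:
  fixes x y z :: "real^3"
  assumes sph: "P \<subseteq> sphere 0 1" and T: "{x, y, z} \<subseteq> P" and n: "plane_normal x y z \<noteq> 0"
    and side: "\<And>t. t \<in> P - {x, y, z} \<Longrightarrow> plane_normal x y z \<bullet> t < plane_normal x y z \<bullet> x"
    and ne: "P - {x, y, z} \<noteq> {}"
  shows "hole_angle P (convex hull {x, y, z}) = arccos (plane_offset x y z)"
proof -
  define c where "c = plane_normal x y z /\<^sub>R norm (plane_normal x y z)"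
  define h where "h = plane_offset x y z"
  have unit: "norm w = 1" if "w \<in> P" for w using sph that by auto
  note u = norm_unit_normal[OF n, folded c_def] unit_normal_iff[OF n, folded c_def h_def]
    abs_plane_offset_less_1[OF n, folded h_def]
  have xy: "norm x = 1" "norm y = 1" using T unit by auto
  have nc: "norm c = 1" and h1: "\<bar>h\<bar> < 1" using u(1,5) xy by auto
  have less: "c \<bullet> t < h" if "t \<in> P - {x, y, z}" for t using side[OF that] u(2) xy by simp
  have plane: "affine hull {x, y, z} = {w. c \<bullet> w = h}"
    unfolding affine_hull_triple(1)[OF n] using u(4) xy by simp
  have on: "c \<bullet> t = h" if "t \<in> {x, y, z}" for t
    using that plane hull_subset[of "{x, y, z}" affine] by blast
  have bound: "\<bar>a \<bullet> w\<bar> \<le> 1" if "norm a = 1" "norm w = 1" for a w :: "real^3"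
    using Cauchy_Schwarz_ineq2[of a w] that by simp
  show ?thesis
    unfolding hole_angle_def affine_hull_convex_hull h_def[symmetric]
  proof (rule the_equality)
    have "cap_boundary c (arccos h) = {w. c \<bullet> w = h} \<inter> sphere 0 1"
      using h1 bound[OF nc] by (auto simp: cap_boundary_def arccos_eq_iff)
    moreover have "open_cap c (arccos h) \<inter> P = {}"
    proof -
      have "c \<bullet> t \<le> h" if "t \<in> P" for t using less[of t] on[of t] that by fastforce
      then have "arccos h \<le> arccos (c \<bullet> t)" if "t \<in> P" for t
        using h1 bound[OF nc unit[OF that]] that by (intro arccos_le_arccos) auto
      then show ?thesis by (force simp: open_cap_def)
    qed
    ultimately show "0 \<le> arccos h \<and> arccos h \<le> pi \<and>
        (\<exists>c\<in>sphere 0 1. cap_boundary c (arccos h) = affine hull {x, y, z} \<inter> sphere 0 1 \<and>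
          open_cap c (arccos h) \<inter> P = {})"
      using nc h1 unfolding plane by (auto intro!: arccos_lbound arccos_ubound)
  next
    fix r assume "0 \<le> r \<and> r \<le> pi \<and> (\<exists>c\<in>sphere 0 1. cap_boundary c r = affine hull {x, y, z} \<inter> sphere 0 1 \<and>
          open_cap c r \<inter> P = {})"
    then obtain a where r: "0 \<le> r" "r \<le> pi" and a: "norm a = 1"
      and cb: "cap_boundary a r = affine hull {x, y, z} \<inter> sphere 0 1" and oc: "open_cap a r \<inter> P = {}"
      by auto
    define k where "k = cos r"
    have "a \<bullet> w = k" if "w \<in> {x, y, z}" for w
    proof -
      have "w \<in> cap_boundary a r"
        unfolding cb using that T unit hull_subset[of "{x, y, z}" affine] by auto
      then have w: "norm w = 1" "arccos (a \<bullet> w) = r" by (auto simp: cap_boundary_def)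
      then show ?thesis unfolding k_def using bound[OF a w(1)] by (metis abs_le_iff cos_arccos minus_le_iff)
    qed
    then have "{w. plane_normal x y z \<bullet> w = plane_normal x y z \<bullet> x} = {w. a \<bullet> w = k}"
      using a by (intro plane_unique[OF n]) auto
    then have planes: "{w. c \<bullet> w = h} = {w. a \<bullet> w = k}"
      using plane unfolding affine_hull_triple(1)[OF n] by simp
    have cc: "c \<bullet> c = 1" "a \<bullet> a = 1" using nc a by (simp_all add: norm_eq_1)
    then have "h *\<^sub>R c \<in> {w. a \<bullet> w = k}" "k *\<^sub>R a \<in> {w. c \<bullet> w = h}"
      by (subst planes[symmetric], simp, subst planes, simp)
    then have hk: "h * (a \<bullet> c) = k" "k * (c \<bullet> a) = h" by simp_all
    have ac: "\<bar>a \<bullet> c\<bar> \<le> 1" by (rule bound[OF a nc])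
    (* hk forces the two offsets to agree up to sign, and for h different from 0 the unit normals too *)
    have "h = k"
    proof (cases "h = 0")
      case False
      from hk have "h * ((a \<bullet> c) * (a \<bullet> c)) = h * 1" by (simp add: inner_commute mult.assoc[symmetric])
      then have "(a \<bullet> c) * (a \<bullet> c) = 1" using False by simp
      then have "a \<bullet> c = 1 \<or> a \<bullet> c = - 1" by (simp add: square_eq_1_iff)
      moreover have "a \<bullet> c \<noteq> - 1"
      proof
        assume m: "a \<bullet> c = - 1"
        have "(a + c) \<bullet> (a + c) = 0" using cc m by (simp add: inner_add_left inner_add_right inner_commute)
        then have a': "a = - c" by (simp add: eq_neg_iff_add_eq_0)
        obtain t where t: "t \<in> P - {x, y, z}" using ne by blast
        then have "t \<notin> open_cap a r" using oc by blast
        then have "r \<le> arccos (a \<bullet> t)" using t unit by (auto simp: open_cap_def)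
        moreover have "\<bar>a \<bullet> t\<bar> \<le> 1" using t unit by (intro bound[OF a]) auto
        ultimately have "a \<bullet> t \<le> k" unfolding k_def
          using r cos_monotone_0_pi_le[of r "arccos (a \<bullet> t)"] arccos_ubound[of "a \<bullet> t"]
          by (simp add: cos_arccos_abs abs_le_iff)
        moreover have "k = - h" using hk m by simp
        ultimately show False using less[OF t] by (simp add: a')
      qed
      ultimately show ?thesis using hk by simp
    qed (use hk in simp)
    then show "r = arccos h" unfolding k_def using r by (simp add: arccos_cos)
  qed
qed

lemma hole_radius_triple:
  fixes x y z :: "real^3"
  assumes sph: "P \<subseteq> sphere 0 1" and T: "{x, y, z} \<subseteq> P" and n: "plane_normal x y z \<noteq> 0"
    and side: "\<And>t. t \<in> P - {x, y, z} \<Longrightarrow> plane_normal x y z \<bullet> t < plane_normal x y z \<bullet> x"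
    and ne: "P - {x, y, z} \<noteq> {}"
  shows "hole_radius P (convex hull {x, y, z}) powr p = (2 * (1 - plane_offset x y z)) powr (p / 2)"
proof -
  define h where "h = plane_offset x y z"
  have h: "\<bar>h\<bar> < 1" unfolding h_def using T sph by (intro abs_plane_offset_less_1[OF n]) auto
  define s where "s = 2 * sin (arccos h / 2)"
  have "0 < arccos h" "arccos h < pi" using h arccos_lt_bounded[of h] by auto
  then have s: "s > 0" unfolding s_def by (intro mult_pos_pos sin_gt_zero) auto
  have "s\<^sup>2 = 2 * (1 - cos (2 * (arccos h / 2)))"
    unfolding s_def cos_double_sin by (simp add: power_mult_distrib)
  then have s2: "s\<^sup>2 = 2 * (1 - h)" using h by simp
  have "s powr p = (s powr 2) powr (p / 2)" by (simp only: powr_powr) simp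
  also have "s powr 2 = s\<^sup>2" using s by simp
  finally have "s powr p = (2 * (1 - h)) powr (p / 2)" unfolding s2 .
  moreover have "hole_angle P (convex hull {x, y, z}) = arccos h"
    unfolding h_def by (rule hole_angle_triple[OF sph T n side ne])
  ultimately show ?thesis by (simp add: hole_radius_def s_def h_def)
qed

definition general_position :: "(real^3) set \<Rightarrow> bool" where
  "general_position P \<longleftrightarrow> (\<forall>x\<in>P. \<forall>y\<in>P. \<forall>z\<in>P. \<forall>t\<in>P - {x, y, z}. x \<noteq> y \<longrightarrow> x \<noteq> z \<longrightarrow> y \<noteq> z \<longrightarrow>
     plane_normal x y z \<bullet> t \<noteq> plane_normal x y z \<bullet> x)"

text \<open>
  The condition depends on the orientation of the triple: one orientation expresses that the remaining
  points are below the plane, the other one that they are above it.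
\<close>

definition one_sided :: "(real^3) set \<Rightarrow> real^3 \<Rightarrow> real^3 \<Rightarrow> real^3 \<Rightarrow> bool" where
  "one_sided P x y z \<longleftrightarrow> (\<forall>t\<in>P - {x, y, z}. plane_normal x y z \<bullet> t < plane_normal x y z \<bullet> x)"

lemma one_sided_swap:
  "one_sided P x z y \<longleftrightarrow> (\<forall>t\<in>P - {x, y, z}. plane_normal x y z \<bullet> t > plane_normal x y z \<bullet> x)"
  by (simp add: one_sided_def plane_normal_swap[of x z y] insert_commute)

definition facet_value :: "real \<Rightarrow> (real^3) set \<Rightarrow> (real^3) set \<Rightarrow> real" where
  "facet_value p P T = (if convex hull T facet_of convex hull P then hole_radius P (convex hull T) powr p else 0)"

context
  fixes P :: "(real^3) set"
  assumes fin: "finite P" and sph: "P \<subseteq> sphere 0 1" and gp: "general_position P" and card: "4 \<le> card P"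
begin

lemma nonzero_normal:
  assumes "{x, y, z} \<subseteq> P" "x \<noteq> y" "x \<noteq> z" "y \<noteq> z"
  shows "plane_normal x y z \<noteq> 0"
  using assms sph by (intro sphere_triple_not_collinear) auto

lemma fourth_point: "P - {x, y, z} \<noteq> {}"
proof
  assume "P - {x, y, z} = {}"
  then have "card P \<le> card {x, y, z}" by (intro card_mono) auto
  also have "\<dots> \<le> 3" by (simp add: card_insert_if)
  finally show False using card by simp
qed

lemma off_plane:
  assumes "{x, y, z} \<subseteq> P" "x \<noteq> y" "x \<noteq> z" "y \<noteq> z" "t \<in> P - {x, y, z}"
  shows "plane_normal x y z \<bullet> t \<noteq> plane_normal x y z \<bullet> x"
  using gp assms unfolding general_position_def by blast

lemma aff_dim_points: "aff_dim P = 3"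
proof -
  have "3 \<le> card P" using card by simp
  then obtain T where T: "T \<subseteq> P" "card T = 3" "finite T"
    by (rule obtain_subset_with_card_n)
  then obtain x y z where xyz: "T = {x, y, z}" "x \<noteq> y" "x \<noteq> z" "y \<noteq> z"
    by (auto simp: card_3_iff)
  note n = nonzero_normal[OF T(1)[unfolded xyz(1)] xyz(2-4)]
  obtain t where t: "t \<in> P - {x, y, z}" using fourth_point by blast
  then have "t \<notin> affine hull {x, y, z}"
    unfolding affine_hull_triple(1)[OF n] using off_plane[OF T(1)[unfolded xyz(1)] xyz(2-4) t] by simp
  then have "aff_dim (insert t {x, y, z}) = 3"
    by (subst aff_dim_insert) (simp add: affine_hull_triple(2)[OF n])
  moreover have "aff_dim (insert t {x, y, z}) \<le> aff_dim P"
    using t T xyz by (intro aff_dim_subset) auto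
  moreover have "aff_dim P \<le> 3" using aff_dim_le_DIM[of P] by simp
  ultimately show ?thesis by simp
qed

text \<open>
  With this, a triple is recovered from its facet, so that facets can be counted by triples.
\<close>

lemma points_in_hull_triple:
  assumes T: "{x, y, z} \<subseteq> P" and d: "x \<noteq> y" "x \<noteq> z" "y \<noteq> z"
  shows "P \<inter> convex hull {x, y, z} = {x, y, z}"
proof -
  have "convex hull {x, y, z} \<subseteq> {w. plane_normal x y z \<bullet> w = plane_normal x y z \<bullet> x}"
    using convex_hull_subset_affine_hull[of "{x, y, z}"]
    unfolding affine_hull_triple(1)[OF nonzero_normal[OF T d]] .
  then show ?thesis using off_plane[OF T d] T hull_subset[of "{x, y, z}" convex] by blast
qed

text \<open>
  The supporting plane cuts out a face, which is the hull of some of the points; general position leaves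
  only the three given ones, and the dimension makes the face a facet.
\<close>

lemma one_sided_imp_facet:
  assumes T: "{x, y, z} \<subseteq> P" and d: "x \<noteq> y" "x \<noteq> z" "y \<noteq> z" and os: "one_sided P x y z"
  shows "convex hull {x, y, z} facet_of convex hull P"
proof -
  define a where "a = plane_normal x y z"
  have n: "a \<noteq> 0" unfolding a_def by (rule nonzero_normal[OF T d])
  have on: "a \<bullet> t = a \<bullet> x" if "t \<in> {x, y, z}" for t
    using that by (auto simp: a_def inner_plane_normal)
  have "a \<bullet> t \<le> a \<bullet> x" if "t \<in> P" for t
    using os on[of t] that unfolding one_sided_def a_def[symmetric] by (cases "t \<in> {x, y, z}") (auto intro: less_imp_le)
  then have "convex hull P \<subseteq> {w. a \<bullet> w \<le> a \<bullet> x}"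
    by (intro hull_minimal) (auto simp: convex_halfspace_le)
  then have face: "(convex hull P \<inter> {w. a \<bullet> w = a \<bullet> x}) face_of convex hull P"
    by (intro face_of_Int_supporting_hyperplane_le) auto
  obtain S where S: "S \<subseteq> P" "convex hull P \<inter> {w. a \<bullet> w = a \<bullet> x} = convex hull S"
    using face_of_convex_hull_subset[OF finite_imp_compact[OF fin] face] by blast
  have "S \<subseteq> {w. a \<bullet> w = a \<bullet> x}" using S(2) hull_subset[of S convex] by blast
  then have "S \<subseteq> {x, y, z}" using S(1) off_plane[OF T d] unfolding a_def by blast
  then have "convex hull S \<subseteq> convex hull {x, y, z}" by (rule hull_mono)
  moreover have "convex hull {x, y, z} \<subseteq> convex hull P \<inter> {w. a \<bullet> w = a \<bullet> x}"
  proof (rule Int_greatest)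
    show "convex hull {x, y, z} \<subseteq> convex hull P" by (rule hull_mono[OF T])
    show "convex hull {x, y, z} \<subseteq> {w. a \<bullet> w = a \<bullet> x}"
    proof (rule hull_minimal)
      show "{x, y, z} \<subseteq> {w. a \<bullet> w = a \<bullet> x}" using on by blast
    qed (rule convex_hyperplane)
  qed
  ultimately have eq: "convex hull P \<inter> {w. a \<bullet> w = a \<bullet> x} = convex hull {x, y, z}"
    unfolding S(2) by (rule subset_antisym)
  show ?thesis
    unfolding facet_of_def using face[unfolded eq] affine_hull_triple(2)[OF n[unfolded a_def]]
    by (simp add: aff_dim_convex_hull aff_dim_points)
qed

text \<open>
  The plane of the triple is the supporting plane of the facet. If points of \<open>P\<close> lay strictly on both
  sides of it, the segment between them would cross it at a point strictly inside the supporting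
  half-space.
\<close>

lemma facet_triple:
  assumes T: "{x, y, z} \<subseteq> P" and d: "x \<noteq> y" "x \<noteq> z" "y \<noteq> z"
    and F: "F facet_of convex hull P" and TF: "{x, y, z} \<subseteq> F"
  shows "F = convex hull {x, y, z}" and "one_sided P x y z \<or> one_sided P x z y"
proof -
  define n where "n = plane_normal x y z"
  have n: "n \<noteq> 0" unfolding n_def by (rule nonzero_normal[OF T d])
  have "polyhedron (convex hull P)"
    using fin by (intro polytope_imp_polyhedron polytope_convex_hull)
  then obtain a b where ab: "a \<noteq> 0" "convex hull P \<subseteq> {w. a \<bullet> w \<le> b}" "F = convex hull P \<inter> {w. a \<bullet> w = b}"
    using facet_of_polyhedron[OF _ F] by blast
  have plane: "{w. n \<bullet> w = n \<bullet> x} = {w. a \<bullet> w = b}"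
    unfolding n_def using TF ab(1,3) by (intro plane_unique n[unfolded n_def]) auto
  obtain S where S: "S \<subseteq> P" "F = convex hull S"
    using face_of_convex_hull_subset[OF finite_imp_compact[OF fin] facet_of_imp_face_of[OF F]] by blast
  have "S \<subseteq> {w. n \<bullet> w = n \<bullet> x}" using S(2) ab(3) hull_subset[of S convex] unfolding plane by blast
  then have "S \<subseteq> {x, y, z}" using S(1) off_plane[OF T d] unfolding n_def by blast
  then have "F \<subseteq> convex hull {x, y, z}" unfolding S(2) by (rule hull_mono)
  moreover have "convex hull {x, y, z} \<subseteq> F"
    using TF unfolding S(2) by (rule hull_minimal) (rule convex_convex_hull)
  ultimately show "F = convex hull {x, y, z}" by blast
  have less: "a \<bullet> t < b" if "t \<in> P - {x, y, z}" for t
  proof -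
    have "a \<bullet> t \<le> b" using ab(2) that hull_subset[of P convex] by blast
    moreover have "a \<bullet> t \<noteq> b" using off_plane[OF T d that] plane unfolding n_def by blast
    ultimately show ?thesis by simp
  qed
  show "one_sided P x y z \<or> one_sided P x z y"
  proof (rule ccontr)
    assume "\<not> ?thesis"
    then obtain s t where s: "s \<in> P - {x, y, z}" "n \<bullet> s \<ge> n \<bullet> x" and t: "t \<in> P - {x, y, z}" "n \<bullet> t \<le> n \<bullet> x"
      unfolding one_sided_swap[of P x z y] unfolding one_sided_def n_def by (meson not_less)
    then have s': "n \<bullet> s > n \<bullet> x" and t': "n \<bullet> t < n \<bullet> x"
      using off_plane[OF T d s(1)] off_plane[OF T d t(1)] unfolding n_def by auto
    (* the segment from t to s meets the plane at parameter l *)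
    define l where "l = (n \<bullet> x - n \<bullet> t) / (n \<bullet> s - n \<bullet> t)"
    have l: "0 < l" "l < 1" using s' t' by (auto simp: l_def)
    define w where "w = l *\<^sub>R s + (1 - l) *\<^sub>R t"
    have "l * (n \<bullet> s - n \<bullet> t) = n \<bullet> x - n \<bullet> t" unfolding l_def using s' t' by simp
    then have "n \<bullet> w = n \<bullet> x" by (simp add: w_def inner_add_right algebra_simps)
    then have "a \<bullet> w = b" using plane by blast
    moreover have "a \<bullet> w < l * b + (1 - l) * b"
      unfolding w_def inner_add_right inner_scaleR_right
      using less[OF s(1)] less[OF t(1)] l by (intro add_strict_mono mult_strict_left_mono) auto
    ultimately show False by (simp add: algebra_simps)
  qed
qed

lemma facet_imp_triple:
  assumes F: "F facet_of convex hull P"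
  obtains T where "T \<subseteq> P" "card T = 3" "F = convex hull T"
proof -
  obtain S where S: "S \<subseteq> P" "F = convex hull S"
    using face_of_convex_hull_subset[OF finite_imp_compact[OF fin] facet_of_imp_face_of[OF F]] by blast
  have "aff_dim S = 2"
    using F unfolding facet_of_def S(2) by (simp add: aff_dim_convex_hull aff_dim_points)
  moreover have "finite S" using S(1) fin by (rule finite_subset)
  ultimately have "3 \<le> card S" using aff_dim_le_card[of S] by simp
  then obtain T where T: "T \<subseteq> S" "card T = 3" "finite T"
    by (rule obtain_subset_with_card_n)
  then obtain x y z where xyz: "T = {x, y, z}" "x \<noteq> y" "x \<noteq> z" "y \<noteq> z"
    by (auto simp: card_3_iff)
  have "F = convex hull {x, y, z}"
    using T S hull_subset[of S convex] xyz by (intro facet_triple(1)[OF _ _ _ _ F]) auto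
  then have "F = convex hull T" using xyz(1) by simp
  with order_trans[OF T(1) S(1)] T(2) show ?thesis by (rule that)
qed

lemma facet_value_triple:
  assumes T: "{x, y, z} \<subseteq> P" and d: "x \<noteq> y" "x \<noteq> z" "y \<noteq> z"
  shows "facet_value p P {x, y, z} =
    of_bool (one_sided P x y z) * (2 * (1 - plane_offset x y z)) powr (p / 2) +
    of_bool (one_sided P x z y) * (2 * (1 - plane_offset x z y)) powr (p / 2)"
proof -
  have xzy: "{x, z, y} = {x, y, z}" by auto
  have T': "{x, z, y} \<subseteq> P" and d': "z \<noteq> y" using T d by auto
  have val: "facet_value p P {x, y, z} = (2 * (1 - plane_offset x y z)) powr (p / 2)"
    if "{x, y, z} \<subseteq> P" "x \<noteq> y" "x \<noteq> z" "y \<noteq> z" "one_sided P x y z" for x y z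
  proof -
    have "hole_radius P (convex hull {x, y, z}) powr p = (2 * (1 - plane_offset x y z)) powr (p / 2)"
      using that(5) unfolding one_sided_def
      by (intro hole_radius_triple sph that(1) nonzero_normal[OF that(1-4)] fourth_point) auto
    then show ?thesis using one_sided_imp_facet[OF that] by (simp add: facet_value_def)
  qed
  have excl: "\<not> (one_sided P x y z \<and> one_sided P x z y)"
  proof
    assume *: "one_sided P x y z \<and> one_sided P x z y"
    obtain t where "t \<in> P - {x, y, z}" using fourth_point by blast
    with * show False unfolding one_sided_swap[of P x z y] unfolding one_sided_def by (meson order.asym)
  qed
  have "facet_value p P {x, y, z} = 0" if "\<not> one_sided P x y z" "\<not> one_sided P x z y"
    using facet_triple(2)[OF T d, of "convex hull {x, y, z}"] that hull_subset[of "{x, y, z}" convex]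
    by (auto simp: facet_value_def)
  then show ?thesis
    using val[OF T d] val[OF T' d(2,1) d'] excl unfolding xzy by auto
qed

lemma hole_power_sum_eq: "hole_power_sum p P = (\<Sum>T | T \<subseteq> P \<and> card T = 3. facet_value p P T)"
proof -
  let ?A = "{T. T \<subseteq> P \<and> card T = 3 \<and> convex hull T facet_of convex hull P}"
  have bij: "bij_betw (\<lambda>T. convex hull T) ?A {F. F facet_of convex hull P}"
  proof (rule bij_betw_imageI)
    have "P \<inter> convex hull T = T" if "T \<in> ?A" for T
      using that points_in_hull_triple by (auto simp: card_3_iff)
    then show "inj_on (\<lambda>T. convex hull T) ?A" by (metis (no_types, lifting) inj_onI)
    show "(\<lambda>T. convex hull T) ` ?A = {F. F facet_of convex hull P}"
      using facet_imp_triple by blast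
  qed
  have "hole_power_sum p P = (\<Sum>T\<in>?A. hole_radius P (convex hull T) powr p)"
    unfolding hole_power_sum_def using sum.reindex_bij_betw[OF bij, of "\<lambda>F. hole_radius P F powr p"] by simp
  also have "\<dots> = (\<Sum>T | T \<subseteq> P \<and> card T = 3. facet_value p P T)"
    using fin by (intro sum.mono_neutral_cong_left) (auto simp: facet_value_def)
  finally show ?thesis .
qed

end

section \<open>Independent points\<close>

interpretation sphere_product: product_prob_space "\<lambda>_ :: nat. uniform_sphere" UNIV ..

interpretation sphere_pair: pair_sigma_finite uniform_sphere uniform_sphere ..

text \<open>
  Fubini in one coordinate. For general position it suffices to let one of four points vary while the
  plane of the other three is fixed.
\<close>

lemma AE_PiM_coordinate:
  assumes I: "finite I" "l \<in> I"
    and P [measurable]: "Measurable.pred (Pi\<^sub>M I (\<lambda>_. uniform_sphere)) P"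
    and AE: "\<And>x. AE y in uniform_sphere. P (x(l := y))"
  shows "AE x in Pi\<^sub>M (I :: nat set) (\<lambda>_. uniform_sphere). P x"
proof -
  define J where "J = I - {l}"
  have J: "finite J" "l \<notin> J" "insert l J = I" using I by (auto simp: J_def)
  have "(\<integral>\<^sup>+x. indicator {x. \<not> P x} x \<partial>Pi\<^sub>M (insert l J) (\<lambda>_. uniform_sphere)) =
     (\<integral>\<^sup>+x. \<integral>\<^sup>+y. indicator {x. \<not> P x} (x(l := y)) \<partial>uniform_sphere \<partial>Pi\<^sub>M J (\<lambda>_. uniform_sphere))"
    using J P by (intro sphere_product.product_nn_integral_insert) (auto simp: J(3))
  also have "\<dots> = (\<integral>\<^sup>+x. \<integral>\<^sup>+y. 0 \<partial>uniform_sphere \<partial>Pi\<^sub>M J (\<lambda>_. uniform_sphere))"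
  proof (rule nn_integral_cong, rule nn_integral_cong_AE)
    fix x
    show "AE y in uniform_sphere. indicator {x. \<not> P x} (x(l := y)) = (0 :: ennreal)"
      using AE[of x] by eventually_elim simp
  qed
  finally have "(\<integral>\<^sup>+x. indicator {x. \<not> P x} x \<partial>Pi\<^sub>M I (\<lambda>_. uniform_sphere)) = 0"
    unfolding J(3) by simp
  then have "AE x in Pi\<^sub>M I (\<lambda>_. uniform_sphere). indicator {x. \<not> P x} x = (0 :: ennreal)"
    by (subst (asm) nn_integral_0_iff_AE) auto
  then show ?thesis by eventually_elim (simp add: indicator_eq_0_iff)
qed

text \<open>
  The point \<open>a\<close> lies in a plane through the origin, which is a null set.
\<close>

lemma AE_uniform_sphere_neq: "AE y in uniform_sphere. y \<noteq> a"
proof -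
  obtain e where e: "e \<noteq> 0" "orthogonal a e"
    using orthogonal_to_vector_exists[of a] by auto
  have "AE y in uniform_sphere. (e /\<^sub>R norm e) \<bullet> y \<noteq> 0"
    using e by (intro AE_uniform_sphere_not_in_plane) auto
  then show ?thesis
    by eventually_elim (use e in \<open>auto simp: orthogonal_def inner_commute\<close>)
qed

lemma measurable_off_plane:
  assumes [measurable]: "a \<in> borel_measurable M" "b \<in> borel_measurable M" "c \<in> borel_measurable M" "d \<in> borel_measurable M"
  shows "Measurable.pred M (\<lambda>x. norm (a x) = 1 \<and> norm (b x) = 1 \<and> norm (plane_normal (a x) (b x) (c x)) \<noteq> 0 \<longrightarrow>
    plane_normal (a x) (b x) (c x) \<bullet> d x \<noteq> plane_normal (a x) (b x) (c x) \<bullet> a x)"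
  by measurable

lemma AE_sphere_points:
  fixes I :: "nat set"
  assumes I: "finite I"
  shows "AE x in Pi\<^sub>M I (\<lambda>_. uniform_sphere). x ` I \<subseteq> sphere 0 1 \<and> inj_on x I \<and> general_position (x ` I)"
proof -
  let ?Q = "Pi\<^sub>M I (\<lambda>_. uniform_sphere)"
  have 1: "AE x in ?Q. \<forall>i\<in>I. norm (x i) = 1"
  proof (rule AE_finite_allI[OF I])
    fix i assume i: "i \<in> I"
    show "AE x in ?Q. norm (x i) = 1"
      by (rule AE_PiM_coordinate[OF I i]) (use i AE_uniform_sphere_norm in simp_all)
  qed
  have 2: "AE x in ?Q. \<forall>i\<in>I. \<forall>j\<in>I. i \<noteq> j \<longrightarrow> x j \<noteq> x i"
  proof ((rule AE_finite_allI[OF I])+)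
    fix i j assume ij: "i \<in> I" "j \<in> I"
    show "AE x in ?Q. i \<noteq> j \<longrightarrow> x j \<noteq> x i"
    proof (cases "i = j")
      case False
      have ae: "AE y in uniform_sphere. (x(j := y)) j \<noteq> (x(j := y)) i" for x :: "nat \<Rightarrow> real^3"
        using AE_uniform_sphere_neq[of "x i"] by eventually_elim (use False in simp)
      have [measurable]: "(\<lambda>x. x i) \<in> ?Q \<rightarrow>\<^sub>M borel" "(\<lambda>x. x j) \<in> ?Q \<rightarrow>\<^sub>M borel"
        using ij by measurable
      have "Measurable.pred ?Q (\<lambda>x. norm (x j - x i) \<noteq> 0)" by measurable
      then have m: "Measurable.pred ?Q (\<lambda>x. x j \<noteq> x i)" by simp
      show ?thesis using AE_PiM_coordinate[OF I ij(2) m ae] by simp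
    qed simp
  qed
  define Off where "Off a b c t \<longleftrightarrow> (norm a = 1 \<and> norm b = 1 \<and> norm (plane_normal a b c) \<noteq> 0 \<longrightarrow>
      plane_normal a b c \<bullet> t \<noteq> plane_normal a b c \<bullet> a)" for a b c t
  have 3: "AE x in ?Q. \<forall>i\<in>I. \<forall>j\<in>I. \<forall>k\<in>I. \<forall>l\<in>I. l \<noteq> i \<and> l \<noteq> j \<and> l \<noteq> k \<longrightarrow> Off (x i) (x j) (x k) (x l)"
  proof ((rule AE_finite_allI[OF I])+)
    fix i j k l assume ijkl: "i \<in> I" "j \<in> I" "k \<in> I" "l \<in> I"
    have "AE x in ?Q. Off (x i) (x j) (x k) (x l)" if l: "l \<noteq> i" "l \<noteq> j" "l \<noteq> k"
    proof (rule AE_PiM_coordinate[OF I ijkl(4)])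
      show "Measurable.pred ?Q (\<lambda>x. Off (x i) (x j) (x k) (x l))"
        unfolding Off_def by (rule measurable_off_plane) (use ijkl in measurable)
    next
      fix x :: "nat \<Rightarrow> real^3"
      have "AE y in uniform_sphere. Off (x i) (x j) (x k) y"
      proof (cases "plane_normal (x i) (x j) (x k) \<noteq> 0 \<and> norm (x i) = 1 \<and> norm (x j) = 1")
        case True
        then have n: "plane_normal (x i) (x j) (x k) \<noteq> 0" "norm (x i) = 1" "norm (x j) = 1" by auto
        have "AE y in uniform_sphere. (plane_normal (x i) (x j) (x k) /\<^sub>R norm (plane_normal (x i) (x j) (x k))) \<bullet> y
            \<noteq> plane_offset (x i) (x j) (x k)"
          by (intro AE_uniform_sphere_not_in_plane norm_unit_normal abs_plane_offset_less_1 n)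
        then show ?thesis
          unfolding Off_def unit_normal_iff(3)[OF n] by eventually_elim blast
      qed (auto simp: Off_def)
      then show "AE y in uniform_sphere. Off ((x(l := y)) i) ((x(l := y)) j) ((x(l := y)) k) ((x(l := y)) l)"
        using l by simp
    qed
    then show "AE x in ?Q. l \<noteq> i \<and> l \<noteq> j \<and> l \<noteq> k \<longrightarrow> Off (x i) (x j) (x k) (x l)"
      by (cases "l \<noteq> i \<and> l \<noteq> j \<and> l \<noteq> k") (auto elim: eventually_mono)
  qed
  from 1 2 3 show ?thesis
  proof eventually_elim
    case (elim x)
    have "inj_on x I" using elim(2) by (auto simp: inj_on_def)
    moreover have "general_position (x ` I)"
      unfolding general_position_def
    proof (intro ballI impI)
      fix a b c t assume *: "a \<in> x ` I" "b \<in> x ` I" "c \<in> x ` I" "t \<in> x ` I - {a, b, c}" "a \<noteq> b" "a \<noteq> c" "b \<noteq> c"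
      then obtain i j k l where ijkl: "i \<in> I" "j \<in> I" "k \<in> I" "l \<in> I" "a = x i" "b = x j" "c = x k" "t = x l"
        by blast
      then have "plane_normal a b c \<noteq> 0"
        using * elim(1) by (intro sphere_triple_not_collinear) auto
      moreover have "l \<noteq> i" "l \<noteq> j" "l \<noteq> k" using * ijkl by auto
      ultimately show "plane_normal a b c \<bullet> t \<noteq> plane_normal a b c \<bullet> a"
        using elim(1) elim(3)[rule_format, OF ijkl(1-4)] ijkl by (simp add: Off_def)
    qed
    ultimately show ?case using elim(1) by auto
  qed
qed

text \<open>
  This applies to \<open>hole_power_sum\<close>, which equals a measurable expression only outside the null event
  of degenerate configurations.
\<close>

lemma borel_measurable_completion_AE:
  fixes f g :: "'a \<Rightarrow> real"
  assumes g [measurable]: "g \<in> borel_measurable M" and AE: "AE x in M. f x = g x"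
  shows "f \<in> borel_measurable (completion M)"
proof (rule measurableI)
  fix A :: "real set" assume A [measurable]: "A \<in> sets borel"
  have g' [measurable]: "g \<in> borel_measurable (completion M)" using g by (rule measurable_completion)
  have [measurable]: "Measurable.pred (completion M) (\<lambda>x. f x \<noteq> g x \<and> f x \<in> A)"
    "Measurable.pred (completion M) (\<lambda>x. f x \<noteq> g x)"
    using AE by (auto intro!: sets_completion_AE elim: eventually_mono)
  have "Measurable.pred (completion M) (\<lambda>x. (f x \<noteq> g x \<and> f x \<in> A) \<or> (\<not> f x \<noteq> g x \<and> g x \<in> A))"
    by measurable
  also have "(\<lambda>x. (f x \<noteq> g x \<and> f x \<in> A) \<or> (\<not> f x \<noteq> g x \<and> g x \<in> A)) = (\<lambda>x. f x \<in> A)" by auto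
  finally show "f -` A \<inter> space (completion M) \<in> sets (completion M)"
    by (simp add: pred_def vimage_def Int_def conj_commute)
qed simp

definition below :: "real^3 \<Rightarrow> real^3 \<Rightarrow> real^3 \<Rightarrow> real^3 \<Rightarrow> bool" where
  "below x y z t \<longleftrightarrow> plane_normal x y z \<bullet> t < plane_normal x y z \<bullet> x"

lemma measurable_below [measurable]:
  assumes [measurable]: "a \<in> borel_measurable M" "b \<in> borel_measurable M" "c \<in> borel_measurable M" "d \<in> borel_measurable M"
  shows "Measurable.pred M (\<lambda>x. below (a x) (b x) (c x) (d x))"
  unfolding below_def by measurable

lemma nn_integral_PiM_triple:
  fixes \<Phi> :: "real^3 \<Rightarrow> real^3 \<Rightarrow> real^3 \<Rightarrow> ennreal"
  assumes d: "i \<noteq> j" "i \<noteq> k" "j \<noteq> k"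
    and m [measurable]: "(\<lambda>(a, b, c). \<Phi> a b c) \<in> borel_measurable (borel \<Otimes>\<^sub>M borel \<Otimes>\<^sub>M borel)"
  shows "(\<integral>\<^sup>+x. \<Phi> (x i) (x j) (x k) \<partial>Pi\<^sub>M {i, j, k :: nat} (\<lambda>_. uniform_sphere)) =
    (\<integral>\<^sup>+a. \<integral>\<^sup>+b. \<integral>\<^sup>+c. \<Phi> a b c \<partial>uniform_sphere \<partial>uniform_sphere \<partial>uniform_sphere)"
proof -
  have M: "(\<lambda>x. \<Phi> (f x) (g x) (h x)) \<in> borel_measurable N"
    if [measurable]: "f \<in> borel_measurable N" "g \<in> borel_measurable N" "h \<in> borel_measurable N"
    for f g h :: "'z \<Rightarrow> real^3" and N
    using measurable_compose[OF _ m, of "\<lambda>x. (f x, g x, h x)" N] by simp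
  have "(\<integral>\<^sup>+x. \<Phi> (x i) (x j) (x k) \<partial>Pi\<^sub>M {i, j, k} (\<lambda>_. uniform_sphere)) =
      (\<integral>\<^sup>+a. \<integral>\<^sup>+x. \<Phi> ((x(i := a)) i) ((x(i := a)) j) ((x(i := a)) k) \<partial>Pi\<^sub>M {j, k} (\<lambda>_. uniform_sphere) \<partial>uniform_sphere)"
    using d by (intro sphere_product.product_nn_integral_insert_rev M) (auto intro!: measurable_component_singleton)
  also have "\<dots> = (\<integral>\<^sup>+a. \<integral>\<^sup>+x. \<Phi> a (x j) (x k) \<partial>Pi\<^sub>M {j, k} (\<lambda>_. uniform_sphere) \<partial>uniform_sphere)"
    using d by simp
  also have "\<dots> = (\<integral>\<^sup>+a. \<integral>\<^sup>+b. \<integral>\<^sup>+x. \<Phi> a ((x(j := b)) j) ((x(j := b)) k) \<partial>Pi\<^sub>M {k} (\<lambda>_. uniform_sphere) \<partial>uniform_sphere \<partial>uniform_sphere)"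
    using d by (intro nn_integral_cong sphere_product.product_nn_integral_insert_rev M) (auto intro!: measurable_component_singleton)
  also have "\<dots> = (\<integral>\<^sup>+a. \<integral>\<^sup>+b. \<integral>\<^sup>+x. \<Phi> a b (x k) \<partial>Pi\<^sub>M {k} (\<lambda>_. uniform_sphere) \<partial>uniform_sphere \<partial>uniform_sphere)"
    using d by simp
  also have "\<dots> = (\<integral>\<^sup>+a. \<integral>\<^sup>+b. \<integral>\<^sup>+c. \<Phi> a b c \<partial>uniform_sphere \<partial>uniform_sphere \<partial>uniform_sphere)"
    by (intro nn_integral_cong sphere_product.product_nn_integral_singleton M) auto
  finally show ?thesis .
qed

lemma measurable_point:
  assumes "l \<in> I"
  shows "(\<lambda>x. x l) \<in> borel_measurable (Pi\<^sub>M I (\<lambda>_ :: nat. uniform_sphere))"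
  unfolding measurable_cong_sets[OF refl sets_uniform_sphere, symmetric]
  by (rule measurable_component_singleton[OF assms])

text \<open>
  Given the three points of the triple, the others are independent of them and of each other, so they
  all lie below the plane with a probability that is a power of the measure of one cap.
\<close>

lemma nn_integral_empty_cap:
  fixes I :: "nat set" and v :: "real^3 \<Rightarrow> real^3 \<Rightarrow> real^3 \<Rightarrow> ennreal"
  assumes I: "finite I" "{i, j, k} \<subseteq> I" and d: "i \<noteq> j" "i \<noteq> k" "j \<noteq> k"
    and m: "(\<lambda>(a, b, c). v a b c) \<in> borel_measurable (borel \<Otimes>\<^sub>M borel \<Otimes>\<^sub>M borel)"
  shows "(\<integral>\<^sup>+x. v (x i) (x j) (x k) * (\<Prod>l\<in>I - {i, j, k}. indicator {y. below (x i) (x j) (x k) y} (x l))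
       \<partial>Pi\<^sub>M I (\<lambda>_. uniform_sphere)) =
    (\<integral>\<^sup>+a. \<integral>\<^sup>+b. \<integral>\<^sup>+c. v a b c * emeasure uniform_sphere {y. below a b c y} ^ (card I - 3)
       \<partial>uniform_sphere \<partial>uniform_sphere \<partial>uniform_sphere)"
proof -
  define K where "K = I - {i, j, k}"
  have K: "finite K" "{i, j, k} \<inter> K = {}" "{i, j, k} \<union> K = I" "card K = card I - 3"
    using I d by (auto simp: K_def card_Diff_subset)
  have vm [measurable]: "(\<lambda>x. v (f x) (g x) (h x)) \<in> borel_measurable N"
    if [measurable]: "f \<in> borel_measurable N" "g \<in> borel_measurable N" "h \<in> borel_measurable N"
    for f g h :: "'z \<Rightarrow> real^3" and N
    using measurable_compose[OF _ m, of "\<lambda>x. (f x, g x, h x)" N] by simp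
  define W where "W x = v (x i) (x j) (x k) * (\<Prod>l\<in>K. indicator {y. below (x i) (x j) (x k) y} (x l))" for x :: "nat \<Rightarrow> real^3"
  have comp [measurable]: "(\<lambda>x. x l) \<in> Pi\<^sub>M ({i, j, k} \<union> K) (\<lambda>_. uniform_sphere) \<rightarrow>\<^sub>M borel" if "l \<in> {i, j, k} \<union> K" for l
    using measurable_point[OF that] .
  have ind: "(\<lambda>x. indicator {y. below (x i) (x j) (x k) y} (x l) :: ennreal) \<in> borel_measurable (Pi\<^sub>M ({i, j, k} \<union> K) (\<lambda>_. uniform_sphere))"
    if l: "l \<in> K" for l
  proof -
    have [measurable]: "Measurable.pred (Pi\<^sub>M ({i, j, k} \<union> K) (\<lambda>_. uniform_sphere)) (\<lambda>x. below (x i) (x j) (x k) (x l))"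
      by (rule measurable_below) (use l in \<open>simp_all add: measurable_point\<close>)
    have "(\<lambda>x. if below (x i) (x j) (x k) (x l) then 1 else 0 :: ennreal) \<in> borel_measurable (Pi\<^sub>M ({i, j, k} \<union> K) (\<lambda>_. uniform_sphere))"
      by measurable
    then show ?thesis by (simp add: indicator_def of_bool_def)
  qed
  have Wm: "W \<in> borel_measurable (Pi\<^sub>M ({i, j, k} \<union> K) (\<lambda>_. uniform_sphere))"
    unfolding W_def
    by (intro borel_measurable_times_ennreal vm borel_measurable_prod_ennreal ind) (simp_all add: measurable_point)
  have "(\<integral>\<^sup>+x. W x \<partial>Pi\<^sub>M ({i, j, k} \<union> K) (\<lambda>_. uniform_sphere)) =
      (\<integral>\<^sup>+x. \<integral>\<^sup>+y. W (merge {i, j, k} K (x, y)) \<partial>Pi\<^sub>M K (\<lambda>_. uniform_sphere) \<partial>Pi\<^sub>M {i, j, k} (\<lambda>_. uniform_sphere))"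
    by (rule sphere_product.product_nn_integral_fold[OF K(2) _ K(1) Wm]) simp
  also have "\<dots> = (\<integral>\<^sup>+x. v (x i) (x j) (x k) * emeasure uniform_sphere {y. below (x i) (x j) (x k) y} ^ card K
      \<partial>Pi\<^sub>M {i, j, k} (\<lambda>_. uniform_sphere))"
  proof (rule nn_integral_cong)
    fix x :: "nat \<Rightarrow> real^3"
    let ?A = "{y. below (x i) (x j) (x k) y}"
    have A: "?A \<in> sets borel"
    proof -
      have "Measurable.pred borel (\<lambda>y. below (x i) (x j) (x k) y)" by measurable
      then show ?thesis by (simp add: pred_def)
    qed
    have "(\<integral>\<^sup>+y. W (merge {i, j, k} K (x, y)) \<partial>Pi\<^sub>M K (\<lambda>_. uniform_sphere)) =
        (\<integral>\<^sup>+y. v (x i) (x j) (x k) * (\<Prod>l\<in>K. indicator ?A (y l)) \<partial>Pi\<^sub>M K (\<lambda>_. uniform_sphere))"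
      using K(2) by (intro nn_integral_cong) (auto simp: W_def merge_def intro!: arg_cong[where f="\<lambda>x. _ * x"] prod.cong)
    also have "\<dots> = v (x i) (x j) (x k) * (\<integral>\<^sup>+y. (\<Prod>l\<in>K. indicator ?A (y l)) \<partial>Pi\<^sub>M K (\<lambda>_. uniform_sphere))"
    proof (rule nn_integral_cmult)
      have "(\<lambda>y. indicator ?A (y l) :: ennreal) \<in> borel_measurable (Pi\<^sub>M K (\<lambda>_. uniform_sphere))" if "l \<in> K" for l
        by (rule measurable_compose[OF measurable_point[OF that] borel_measurable_indicator[OF A]])
      then show "(\<lambda>y. \<Prod>l\<in>K. indicator ?A (y l) :: ennreal) \<in> borel_measurable (Pi\<^sub>M K (\<lambda>_. uniform_sphere))"
        by (intro borel_measurable_prod_ennreal)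
    qed
    also have "(\<integral>\<^sup>+y. (\<Prod>l\<in>K. indicator ?A (y l)) \<partial>Pi\<^sub>M K (\<lambda>_. uniform_sphere)) = (\<Prod>l\<in>K. \<integral>\<^sup>+y. indicator ?A y \<partial>uniform_sphere)"
      using A by (intro sphere_product.product_nn_integral_prod K(1) borel_measurable_indicator) simp
    finally show "(\<integral>\<^sup>+y. W (merge {i, j, k} K (x, y)) \<partial>Pi\<^sub>M K (\<lambda>_. uniform_sphere)) =
        v (x i) (x j) (x k) * emeasure uniform_sphere ?A ^ card K"
      using A by simp
  qed
  also have "\<dots> = (\<integral>\<^sup>+a. \<integral>\<^sup>+b. \<integral>\<^sup>+c. v a b c * emeasure uniform_sphere {y. below a b c y} ^ card K
       \<partial>uniform_sphere \<partial>uniform_sphere \<partial>uniform_sphere)"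
  proof (rule nn_integral_PiM_triple[OF d])
    have "(\<lambda>p. emeasure uniform_sphere {y. below (fst p) (fst (snd p)) (snd (snd p)) y}) \<in> borel_measurable (borel \<Otimes>\<^sub>M borel \<Otimes>\<^sub>M borel)"
    proof -
      have "(\<lambda>p. \<integral>\<^sup>+y. (if below (fst p) (fst (snd p)) (snd (snd p)) y then 1 else 0) \<partial>uniform_sphere) \<in> borel_measurable (borel \<Otimes>\<^sub>M borel \<Otimes>\<^sub>M borel)"
        by measurable
      also have "(\<lambda>p. \<integral>\<^sup>+y. (if below (fst p) (fst (snd p)) (snd (snd p)) y then 1 else 0) \<partial>uniform_sphere) =
          (\<lambda>p. emeasure uniform_sphere {y. below (fst p) (fst (snd p)) (snd (snd p)) y})"
      proof
        fix p :: "(real^3) \<times> (real^3) \<times> (real^3)"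
        have "Measurable.pred borel (\<lambda>y. below (fst p) (fst (snd p)) (snd (snd p)) y)" by measurable
        then have "{y. below (fst p) (fst (snd p)) (snd (snd p)) y} \<in> sets uniform_sphere" by (simp add: pred_def)
        then show "(\<integral>\<^sup>+y. (if below (fst p) (fst (snd p)) (snd (snd p)) y then 1 else 0) \<partial>uniform_sphere) =
          emeasure uniform_sphere {y. below (fst p) (fst (snd p)) (snd (snd p)) y}"
          using nn_integral_indicator[of "{y. below (fst p) (fst (snd p)) (snd (snd p)) y}" uniform_sphere]
          unfolding indicator_def of_bool_def mem_Collect_eq by blast
      qed
      finally show ?thesis .
    qed
    then show "(\<lambda>(a, b, c). v a b c * emeasure uniform_sphere {y. below a b c y} ^ card K) \<in> borel_measurable (borel \<Otimes>\<^sub>M borel \<Otimes>\<^sub>M borel)"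
      unfolding case_prod_unfold by (intro borel_measurable_times_ennreal borel_measurable_power_ennreal m[unfolded case_prod_unfold])
  qed
  finally show ?thesis unfolding K(3,4) W_def unfolding K_def .
qed

lemma nn_integral_plane_offset_swap:
  fixes f :: "real \<Rightarrow> ennreal"
  assumes [measurable]: "f \<in> borel_measurable borel"
  shows "(\<integral>\<^sup>+a. \<integral>\<^sup>+b. \<integral>\<^sup>+c. f (- plane_offset a b c) \<partial>uniform_sphere \<partial>uniform_sphere \<partial>uniform_sphere) =
    (\<integral>\<^sup>+a. \<integral>\<^sup>+b. \<integral>\<^sup>+c. f (plane_offset a b c) \<partial>uniform_sphere \<partial>uniform_sphere \<partial>uniform_sphere)"
proof (rule nn_integral_cong)
  fix a :: "real^3"
  have "(\<integral>\<^sup>+b. \<integral>\<^sup>+c. f (- plane_offset a b c) \<partial>uniform_sphere \<partial>uniform_sphere) =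
      (\<integral>\<^sup>+b. \<integral>\<^sup>+c. f (plane_offset a c b) \<partial>uniform_sphere \<partial>uniform_sphere)"
    by (simp only: plane_offset_swap[symmetric])
  also have "\<dots> = (\<integral>\<^sup>+c. \<integral>\<^sup>+b. f (plane_offset a c b) \<partial>uniform_sphere \<partial>uniform_sphere)"
    by (rule sphere_pair.Fubini') measurable
  finally show "(\<integral>\<^sup>+b. \<integral>\<^sup>+c. f (- plane_offset a b c) \<partial>uniform_sphere \<partial>uniform_sphere) =
    (\<integral>\<^sup>+b. \<integral>\<^sup>+c. f (plane_offset a b c) \<partial>uniform_sphere \<partial>uniform_sphere)" .
qed

lemma nn_integral_cap_Beta:
  assumes p: "p \<ge> 0"
  shows "(\<integral>\<^sup>+h. ennreal ((2 * (1 - h)) powr (p / 2) * ((1 + h) / 2) ^ n) * ennreal (1 - h\<^sup>2) * indicator {-1<..<1} h \<partial>lborel) =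
     ennreal (8 * 2 powr p * Beta (p / 2 + 2) (real n + 2))"
proof -
  let ?f = "\<lambda>h::real. ennreal ((2 * (1 - h)) powr (p / 2) * ((1 + h) / 2) ^ n) * ennreal (1 - h\<^sup>2) * indicator {-1<..<1} h"
  have "(\<integral>\<^sup>+h. ?f h \<partial>lborel) = (\<integral>\<^sup>+u. ennreal \<bar>-2\<bar> * ?f (1 + (-2) * u) \<partial>lborel)"
    by (rule nn_integral_abs_affine) simp_all
  also have "\<dots> = (\<integral>\<^sup>+u. ennreal (8 * 2 powr p) *
      ennreal (indicator {0..1} u * (u powr (p / 2 + 2 - 1) * (1 - u) powr (real n + 2 - 1))) \<partial>lborel)"
  proof (rule nn_integral_cong)
    fix u :: real
    show "ennreal \<bar>-2\<bar> * ?f (1 + (-2) * u) = ennreal (8 * 2 powr p) *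
        ennreal (indicator {0..1} u * (u powr (p / 2 + 2 - 1) * (1 - u) powr (real n + 2 - 1)))"
    proof (cases "0 < u \<and> u < 1")
      case True
      have "(2 * (1 - (1 + (-2) * u))) powr (p / 2) = (4 * u) powr (p / 2)" by (simp add: algebra_simps)
      also have "\<dots> = 4 powr (p / 2) * u powr (p / 2)" using True by (simp add: powr_mult)
      also have "4 powr (p / 2) = (2 powr 2) powr (p / 2)" by simp
      also have "\<dots> = 2 powr p" by (simp only: powr_powr) simp
      finally have 1: "(2 * (1 - (1 + (-2) * u))) powr (p / 2) = 2 powr p * u powr (p / 2)" .
      have 2: "(1 + (1 + (-2) * u)) / 2 = 1 - u" by simp
      have 3: "1 - (1 + (-2) * u)\<^sup>2 = 4 * (u * (1 - u))" by (simp add: power2_eq_square algebra_simps)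
      have 4: "u powr (p / 2 + 2 - 1) = u powr (p / 2) * u" "(1 - u) powr (real n + 2 - 1) = (1 - u) ^ n * (1 - u)"
        using True by (simp_all add: powr_realpow powr_add)
      have "\<bar>-2\<bar> * (2 powr p * u powr (p / 2) * (1 - u) ^ n * (4 * (u * (1 - u)))) =
          8 * 2 powr p * (u powr (p / 2 + 2 - 1) * (1 - u) powr (real n + 2 - 1))"
        unfolding 4 by simp
      then have "ennreal \<bar>-2\<bar> * (ennreal (2 powr p * u powr (p / 2) * (1 - u) ^ n) * ennreal (4 * (u * (1 - u)))) =
          ennreal (8 * 2 powr p) * ennreal (u powr (p / 2 + 2 - 1) * (1 - u) powr (real n + 2 - 1))"
        using True by (simp only: ennreal_mult[symmetric] abs_ge_zero mult_nonneg_nonneg zero_le_power powr_ge_zero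
            less_imp_le zero_le_numeral diff_ge_0_iff_ge)
      then show ?thesis using True unfolding 1 2 3 by simp
    next
      case False
      then consider "u < 0" | "u = 0" | "u = 1" | "u > 1" by linarith
      then show ?thesis using p by cases auto
    qed
  qed
  also have "\<dots> = ennreal (8 * 2 powr p) * ennreal (Beta (p / 2 + 2) (real n + 2))"
    using p nn_integral_has_integral_lebesgue[OF _ has_integral_Beta_real[of "p / 2 + 2" "real n + 2"]]
    by (simp add: nn_integral_cmult)
  finally show ?thesis by (simp add: ennreal_mult')
qed

text \<open>
  \<open>nn_integral_plane_offset\<close> gives the law of the absolute value of the offset. The two orientations of
  a triple have the same integral, so the factor \<open>2\<close> turns the integrand into an even function of the
  offset.
\<close>

lemma nn_integral_facet:
  assumes p: "p \<ge> 0"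
  shows "2 * (\<integral>\<^sup>+a. \<integral>\<^sup>+b. \<integral>\<^sup>+c. ennreal ((2 * (1 - plane_offset a b c)) powr (p / 2)) *
      emeasure uniform_sphere {y. below a b c y} ^ n \<partial>uniform_sphere \<partial>uniform_sphere \<partial>uniform_sphere) =
    ennreal (12 * 2 powr p * Beta (p / 2 + 2) (real n + 2))"
proof -
  define G where "G h = ennreal ((2 * (1 - h)) powr (p / 2) * ((1 + h) / 2) ^ n)" for h :: real
  have [measurable]: "G \<in> borel_measurable borel" unfolding G_def by measurable
  have S: "(\<integral>\<^sup>+a. \<integral>\<^sup>+b. \<integral>\<^sup>+c. ennreal ((2 * (1 - plane_offset a b c)) powr (p / 2)) *
      emeasure uniform_sphere {y. below a b c y} ^ n \<partial>uniform_sphere \<partial>uniform_sphere \<partial>uniform_sphere) =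
    (\<integral>\<^sup>+a. \<integral>\<^sup>+b. \<integral>\<^sup>+c. G (plane_offset a b c) \<partial>uniform_sphere \<partial>uniform_sphere \<partial>uniform_sphere)"
  proof (rule nn_integral_cong_AE, rule eventually_mono[OF AE_uniform_sphere_norm],
      rule nn_integral_cong_AE, rule eventually_mono[OF eventually_conj[OF AE_uniform_sphere_norm AE_uniform_sphere_neq]],
      rule nn_integral_cong_AE, rule eventually_mono[OF eventually_conj[OF AE_uniform_sphere_norm
          eventually_conj[OF AE_uniform_sphere_neq AE_uniform_sphere_neq]]])
    fix a b c :: "real^3"
    assume a: "norm a = 1" and b: "norm b = 1 \<and> b \<noteq> a" and c: "norm c = 1 \<and> c \<noteq> a \<and> c \<noteq> b"
    then have n: "plane_normal a b c \<noteq> 0" "norm a = 1" "norm b = 1"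
      using sphere_triple_not_collinear[of a b c] by auto
    have "emeasure uniform_sphere {y. below a b c y} = ennreal ((1 + plane_offset a b c) / 2)"
      unfolding below_def unit_normal_iff(1)[OF n]
      by (intro emeasure_uniform_sphere_cap norm_unit_normal abs_plane_offset_less_1 n)
    then show "ennreal ((2 * (1 - plane_offset a b c)) powr (p / 2)) * emeasure uniform_sphere {y. below a b c y} ^ n =
        G (plane_offset a b c)"
      using abs_plane_offset_less_1[OF n] by (simp add: G_def ennreal_power ennreal_mult)
  qed
  (* The sum over both orientations is even in h, so it may be evaluated at the absolute offset. *)
  have K: "G \<bar>h\<bar> + G (- \<bar>h\<bar>) = G h + G (- h)" for h by (simp add: abs_if add.commute)
  have refl: "(\<integral>\<^sup>+h. G (- h) * ennreal (1 - h\<^sup>2) * indicator {-1<..<1} h \<partial>lborel) =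
      (\<integral>\<^sup>+h. G h * ennreal (1 - h\<^sup>2) * indicator {-1<..<1} h \<partial>lborel)"
  proof -
    have "(\<integral>\<^sup>+h. G h * ennreal (1 - h\<^sup>2) * indicator {-1<..<1} h \<partial>lborel) =
        (\<integral>\<^sup>+h. ennreal \<bar>-1\<bar> * (G (0 + (-1) * h) * ennreal (1 - (0 + (-1) * h)\<^sup>2) * indicator {-1<..<1} (0 + (-1) * h)) \<partial>lborel)"
      by (rule nn_integral_abs_affine) simp_all
    then show ?thesis by (simp add: indicator_def conj_commute)
  qed
  have "2 * (\<integral>\<^sup>+a. \<integral>\<^sup>+b. \<integral>\<^sup>+c. G (plane_offset a b c) \<partial>uniform_sphere \<partial>uniform_sphere \<partial>uniform_sphere) =
    (\<integral>\<^sup>+a. \<integral>\<^sup>+b. \<integral>\<^sup>+c. G (plane_offset a b c) \<partial>uniform_sphere \<partial>uniform_sphere \<partial>uniform_sphere) +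
    (\<integral>\<^sup>+a. \<integral>\<^sup>+b. \<integral>\<^sup>+c. G (- plane_offset a b c) \<partial>uniform_sphere \<partial>uniform_sphere \<partial>uniform_sphere)"
    by (subst nn_integral_plane_offset_swap) (simp_all add: mult_2)
  also have "\<dots> = (\<integral>\<^sup>+a. \<integral>\<^sup>+b. \<integral>\<^sup>+c. G \<bar>plane_offset a b c\<bar> + G (- \<bar>plane_offset a b c\<bar>) \<partial>uniform_sphere \<partial>uniform_sphere \<partial>uniform_sphere)"
    unfolding K by (simp add: nn_integral_add)
  also have "\<dots> = ennreal (3 / 4) * (\<integral>\<^sup>+h. (G \<bar>h\<bar> + G (- \<bar>h\<bar>)) * ennreal (1 - h\<^sup>2) * indicator {-1<..<1} h \<partial>lborel)"
    by (rule nn_integral_plane_offset) measurable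
  also have "(\<integral>\<^sup>+h. (G \<bar>h\<bar> + G (- \<bar>h\<bar>)) * ennreal (1 - h\<^sup>2) * indicator {-1<..<1} h \<partial>lborel) =
      2 * (\<integral>\<^sup>+h. G h * ennreal (1 - h\<^sup>2) * indicator {-1<..<1} h \<partial>lborel)"
    unfolding K by (simp add: distrib_right nn_integral_add refl mult_2)
  also have "\<dots> = 2 * ennreal (8 * 2 powr p * Beta (p / 2 + 2) (real n + 2))"
    unfolding G_def nn_integral_cap_Beta[OF p] ..
  also have "ennreal (3 / 4) * (2 * ennreal (8 * 2 powr p * Beta (p / 2 + 2) (real n + 2))) =
      ennreal (3 / 4 * (2 * (8 * 2 powr p * Beta (p / 2 + 2) (real n + 2))))"
    by (simp only: ennreal_mult' ennreal_numeral)
  also have "3 / 4 * (2 * (8 * 2 powr p * Beta (p / 2 + 2) (real n + 2))) = 12 * 2 powr p * Beta (p / 2 + 2) (real n + 2)"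
    by simp
  finally show ?thesis unfolding S .
qed

text \<open>
  The contribution of the oriented triple \<open>(i, j, k)\<close>. In contrast to \<open>facet_value\<close> it is visibly a
  measurable function of the points.
\<close>

definition facet_term :: "real \<Rightarrow> nat set \<Rightarrow> nat \<Rightarrow> nat \<Rightarrow> nat \<Rightarrow> (nat \<Rightarrow> real^3) \<Rightarrow> real" where
  "facet_term p I i j k x = of_bool (\<forall>l\<in>I - {i, j, k}. below (x i) (x j) (x k) (x l)) *
     (2 * (1 - plane_offset (x i) (x j) (x k))) powr (p / 2)"

lemma facet_term_nonneg: "facet_term p I i j k x \<ge> 0"
  by (simp add: facet_term_def)

lemma measurable_facet_term:
  assumes "finite I" "{i, j, k} \<subseteq> I"
  shows "facet_term p I i j k \<in> borel_measurable (Pi\<^sub>M I (\<lambda>_. uniform_sphere))"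
proof -
  have pt [measurable]: "(\<lambda>x. x i) \<in> borel_measurable (Pi\<^sub>M I (\<lambda>_. uniform_sphere))"
    "(\<lambda>x. x j) \<in> borel_measurable (Pi\<^sub>M I (\<lambda>_. uniform_sphere))"
    "(\<lambda>x. x k) \<in> borel_measurable (Pi\<^sub>M I (\<lambda>_. uniform_sphere))"
    using assms by (simp_all add: measurable_point)
  have "Measurable.pred (Pi\<^sub>M I (\<lambda>_. uniform_sphere)) (\<lambda>x. \<forall>l\<in>I - {i, j, k}. below (x i) (x j) (x k) (x l))"
    using assms by (intro pred_intros_finite measurable_below) (auto simp: measurable_point)
  note [measurable] = this
  show ?thesis unfolding facet_term_def[abs_def] by measurable
qed

lemma nn_integral_facet_term:
  assumes I: "finite I" "{i, j, k} \<subseteq> I" and d: "i \<noteq> j" "i \<noteq> k" "j \<noteq> k"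
  shows "(\<integral>\<^sup>+x. ennreal (facet_term p I i j k x) \<partial>Pi\<^sub>M I (\<lambda>_. uniform_sphere)) =
    (\<integral>\<^sup>+a. \<integral>\<^sup>+b. \<integral>\<^sup>+c. ennreal ((2 * (1 - plane_offset a b c)) powr (p / 2)) *
      emeasure uniform_sphere {y. below a b c y} ^ (card I - 3) \<partial>uniform_sphere \<partial>uniform_sphere \<partial>uniform_sphere)"
proof -
  have eq: "ennreal (facet_term p I i j k x) = ennreal ((2 * (1 - plane_offset (x i) (x j) (x k))) powr (p / 2)) *
      (\<Prod>l\<in>I - {i, j, k}. indicator {y. below (x i) (x j) (x k) y} (x l))" for x
  proof (cases "\<forall>l\<in>I - {i, j, k}. below (x i) (x j) (x k) (x l)")
    case True
    then have "(\<Prod>l\<in>I - {i, j, k}. indicator {y. below (x i) (x j) (x k) y} (x l)) = (1 :: ennreal)"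
      by (intro prod.neutral) auto
    with True show ?thesis by (simp add: facet_term_def)
  next
    case False
    then obtain l where l: "l \<in> I - {i, j, k}" "\<not> below (x i) (x j) (x k) (x l)" by blast
    then have "(\<Prod>l\<in>I - {i, j, k}. indicator {y. below (x i) (x j) (x k) y} (x l)) = (0 :: ennreal)"
      using I(1) by (intro prod_zero) (auto intro!: bexI[of _ l])
    moreover have "facet_term p I i j k x = 0" using False unfolding facet_term_def by simp
    ultimately show ?thesis by simp
  qed
  show ?thesis
    unfolding eq by (rule nn_integral_empty_cap[OF I d]) measurable
qed

text \<open>
  The functions \<open>a\<close>, \<open>b\<close>, \<open>c\<close> choose an order of the elements of each three-element index set, as
  needed to speak of oriented triples.
\<close>

lemma hole_power_sum_points:
  assumes I: "finite I" "4 \<le> card I" and good: "x ` I \<subseteq> sphere 0 1" "inj_on x I" "general_position (x ` I)"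
    and enum: "\<And>J. J \<subseteq> I \<Longrightarrow> card J = 3 \<Longrightarrow> J = {a J, b J, c J} \<and> a J \<noteq> b J \<and> a J \<noteq> c J \<and> b J \<noteq> c J"
  shows "hole_power_sum p (x ` I) = (\<Sum>J | J \<subseteq> I \<and> card J = 3.
    facet_term p I (a J) (b J) (c J) x + facet_term p I (a J) (c J) (b J) x)"
proof -
  have cardP: "4 \<le> card (x ` I)" using I good(2) by (simp add: card_image)
  have finP: "finite (x ` I)" using I(1) by simp
  have img: "{T. T \<subseteq> x ` I \<and> card T = 3} = (`) x ` {J. J \<subseteq> I \<and> card J = 3}"
  proof (intro equalityI subsetI)
    fix T assume "T \<in> {T. T \<subseteq> x ` I \<and> card T = 3}"
    then obtain J where "J \<subseteq> I" "T = x ` J" "card T = 3" by (auto simp: subset_image_iff)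
    moreover then have "card J = 3" using inj_on_subset[OF good(2)] by (metis card_image)
    ultimately show "T \<in> (`) x ` {J. J \<subseteq> I \<and> card J = 3}" by blast
  next
    fix T assume "T \<in> (`) x ` {J. J \<subseteq> I \<and> card J = 3}"
    then obtain J where J: "J \<subseteq> I" "card J = 3" "T = x ` J" by blast
    then have "card T = 3" using card_image[OF inj_on_subset[OF good(2) J(1)]] by simp
    then show "T \<in> {T. T \<subseteq> x ` I \<and> card T = 3}" using J by blast
  qed
  have inj: "inj_on ((`) x) {J. J \<subseteq> I \<and> card J = 3}"
    using inj_on_image_eq_iff[OF good(2)] by (auto simp: inj_on_def)
  have "hole_power_sum p (x ` I) = (\<Sum>T | T \<subseteq> x ` I \<and> card T = 3. facet_value p (x ` I) T)"
    by (rule hole_power_sum_eq[OF finP good(1,3) cardP])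
  also have "\<dots> = (\<Sum>J | J \<subseteq> I \<and> card J = 3. facet_value p (x ` I) (x ` J))"
    unfolding img by (simp add: sum.reindex[OF inj])
  also have "\<dots> = (\<Sum>J | J \<subseteq> I \<and> card J = 3. facet_term p I (a J) (b J) (c J) x + facet_term p I (a J) (c J) (b J) x)"
  proof (rule sum.cong[OF refl])
    fix J assume "J \<in> {J. J \<subseteq> I \<and> card J = 3}"
    then have J: "J \<subseteq> I" "card J = 3" by auto
    define i where "i = a J"
    define j where "j = b J"
    define k where "k = c J"
    have ijk: "J = {i, j, k}" "i \<noteq> j" "i \<noteq> k" "j \<noteq> k" using enum[OF J] by (auto simp: i_def j_def k_def)
    then have inI: "i \<in> I" "j \<in> I" "k \<in> I" using J by auto
    have side: "one_sided (x ` I) (x i) (x j) (x k) \<longleftrightarrow> (\<forall>l\<in>I - {i, j, k}. below (x i) (x j) (x k) (x l))"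
      if "i \<in> I" "j \<in> I" "k \<in> I" for i j k
    proof -
      have "x ` I - {x i, x j, x k} = x ` (I - {i, j, k})"
        using inj_on_image_set_diff[OF good(2), of I "{i, j, k}"] that by auto
      then show ?thesis by (simp add: one_sided_def below_def)
    qed
    have kj: "I - {i, k, j} = I - {i, j, k}" by auto
    have xne: "x i \<noteq> x j" "x i \<noteq> x k" "x j \<noteq> x k"
      using ijk inI inj_onD[OF good(2)] by blast+
    have sub: "{x i, x j, x k} \<subseteq> x ` I" using inI by auto
    have "x ` J = {x i, x j, x k}" unfolding ijk(1) by simp
    then have "facet_value p (x ` I) (x ` J) = facet_value p (x ` I) {x i, x j, x k}" by simp
    also have "\<dots> = facet_term p I i j k x + facet_term p I i k j x"
      unfolding facet_value_triple[OF finP good(1,3) cardP sub xne] facet_term_def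
        side[OF inI] side[OF inI(1) inI(3) inI(2)] ..
    finally show "facet_value p (x ` I) (x ` J) = facet_term p I (a J) (b J) (c J) x + facet_term p I (a J) (c J) (b J) x"
      unfolding i_def j_def k_def .
  qed
  finally show ?thesis .
qed

lemma nn_integral_hole_power_sum:
  fixes I :: "nat set"
  assumes I: "finite I" "4 \<le> card I" and p: "p \<ge> 0"
  obtains g where "g \<in> borel_measurable (Pi\<^sub>M I (\<lambda>_. uniform_sphere))"
    "AE x in Pi\<^sub>M I (\<lambda>_. uniform_sphere). hole_power_sum p (x ` I) = g x"
    "(\<integral>\<^sup>+x. ennreal (g x) \<partial>Pi\<^sub>M I (\<lambda>_. uniform_sphere)) =
      ennreal (real (card I choose 3) * (12 * 2 powr p * Beta (p / 2 + 2) (real (card I - 3) + 2)))"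
proof -
  let ?Q = "Pi\<^sub>M I (\<lambda>_. uniform_sphere)"
  let ?\<J> = "{J. J \<subseteq> I \<and> card J = 3}"
  let ?B = "12 * 2 powr p * Beta (p / 2 + 2) (real (card I - 3) + 2)"
  have "\<exists>t :: nat \<times> nat \<times> nat. J = {fst t, fst (snd t), snd (snd t)} \<and>
      fst t \<noteq> fst (snd t) \<and> fst t \<noteq> snd (snd t) \<and> fst (snd t) \<noteq> snd (snd t)" if "card J = 3" for J :: "nat set"
    using that by (auto simp: card_3_iff)
  then obtain t :: "nat set \<Rightarrow> nat \<times> nat \<times> nat" where
    t: "\<And>J. card J = 3 \<Longrightarrow> J = {fst (t J), fst (snd (t J)), snd (snd (t J))} \<and>
      fst (t J) \<noteq> fst (snd (t J)) \<and> fst (t J) \<noteq> snd (snd (t J)) \<and> fst (snd (t J)) \<noteq> snd (snd (t J))"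
    by metis
  define a where "a J = fst (t J)" for J
  define b where "b J = fst (snd (t J))" for J
  define c where "c J = snd (snd (t J))" for J
  have enum: "J = {a J, b J, c J} \<and> a J \<noteq> b J \<and> a J \<noteq> c J \<and> b J \<noteq> c J" if "J \<subseteq> I" "card J = 3" for J
    using t[OF that(2)] unfolding a_def b_def c_def .
  have sub: "{a J, b J, c J} \<subseteq> I" "{a J, c J, b J} \<subseteq> I" if "J \<in> ?\<J>" for J
    using that enum[of J] by auto
  have finJ: "finite ?\<J>" using I(1) by simp
  define g where "g x = (\<Sum>J\<in>?\<J>. facet_term p I (a J) (b J) (c J) x + facet_term p I (a J) (c J) (b J) x)" for x
  have tm: "facet_term p I (a J) (b J) (c J) \<in> borel_measurable ?Q" "facet_term p I (a J) (c J) (b J) \<in> borel_measurable ?Q"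
    if "J \<in> ?\<J>" for J
    using sub[OF that] by (intro measurable_facet_term I(1); simp)+
  have gm: "g \<in> borel_measurable ?Q"
    unfolding g_def[abs_def] by (intro borel_measurable_sum borel_measurable_add tm)
  have ae: "AE x in ?Q. hole_power_sum p (x ` I) = g x"
    using AE_sphere_points[OF I(1)]
  proof eventually_elim
    case (elim x)
    then show ?case unfolding g_def by (intro hole_power_sum_points[OF I _ _ _ enum]) auto
  qed
  have "(\<integral>\<^sup>+x. ennreal (g x) \<partial>?Q) =
      (\<integral>\<^sup>+x. (\<Sum>J\<in>?\<J>. ennreal (facet_term p I (a J) (b J) (c J) x) + ennreal (facet_term p I (a J) (c J) (b J) x)) \<partial>?Q)"
    unfolding g_def by (subst sum_ennreal[symmetric]) (simp_all add: facet_term_nonneg)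
  also have "\<dots> = (\<Sum>J\<in>?\<J>. (\<integral>\<^sup>+x. ennreal (facet_term p I (a J) (b J) (c J) x) + ennreal (facet_term p I (a J) (c J) (b J) x) \<partial>?Q))"
    by (intro nn_integral_sum borel_measurable_add measurable_compose[OF tm(1) measurable_ennreal] measurable_compose[OF tm(2) measurable_ennreal])
  also have "\<dots> = (\<Sum>J\<in>?\<J>. ennreal ?B)"
  proof (rule sum.cong[OF refl])
    fix J assume J: "J \<in> ?\<J>"
    then have d: "a J \<noteq> b J" "a J \<noteq> c J" "b J \<noteq> c J" "c J \<noteq> b J" using enum[of J] by auto
    have "(\<integral>\<^sup>+x. ennreal (facet_term p I (a J) (b J) (c J) x) + ennreal (facet_term p I (a J) (c J) (b J) x) \<partial>?Q) =
       (\<integral>\<^sup>+x. ennreal (facet_term p I (a J) (b J) (c J) x) \<partial>?Q) + (\<integral>\<^sup>+x. ennreal (facet_term p I (a J) (c J) (b J) x) \<partial>?Q)"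
      by (intro nn_integral_add measurable_compose[OF tm(1)[OF J] measurable_ennreal] measurable_compose[OF tm(2)[OF J] measurable_ennreal])
    also have "\<dots> = ennreal ?B"
      unfolding nn_integral_facet_term[OF I(1) sub(1)[OF J] d(1-3)] nn_integral_facet_term[OF I(1) sub(2)[OF J] d(2,1,4)]
      by (subst mult_2[symmetric]) (rule nn_integral_facet[OF p])
    finally show "(\<integral>\<^sup>+x. ennreal (facet_term p I (a J) (b J) (c J) x) + ennreal (facet_term p I (a J) (c J) (b J) x) \<partial>?Q) = ennreal ?B" .
  qed
  also have "\<dots> = of_nat (card ?\<J>) * ennreal ?B" by simp
  also have "card ?\<J> = card I choose 3" using I(1) by (rule n_subsets)
  also have "of_nat (card I choose 3) * ennreal ?B = ennreal (real (card I choose 3) * ?B)"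
    by (simp add: ennreal_mult' ennreal_of_nat_eq_real_of_nat)
  finally show ?thesis using that[OF gm ae] by blast
qed

text \<open>
  The joint law of the points is the product measure, so the expectation is that of the measurable
  version of \<open>hole_power_sum\<close> on the product space.
\<close>

lemma expected_hole_power_sum_eq:
  assumes M: "prob_space M" and indep: "prob_space.indep_vars M (\<lambda>_. borel) X {1..N}"
    and X: "\<And>i. i \<in> {1..N} \<Longrightarrow> distr M borel (X i) = uniform_sphere"
    and N: "N \<ge> 4" and p: "p \<ge> 0"
  shows "expected_hole_power_sum p N M X = real (N choose 3) * (12 * 2 powr p * Beta (p / 2 + 2) (real (N - 3) + 2))"
proof -
  interpret prob_space M by (rule M)
  let ?I = "{1..N}"
  let ?Q = "Pi\<^sub>M ?I (\<lambda>_. uniform_sphere)"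
  let ?E = "real (N choose 3) * (12 * 2 powr p * Beta (p / 2 + 2) (real (N - 3) + 2))"
  define Y where "Y \<omega> = (\<lambda>i\<in>?I. X i \<omega>)" for \<omega>
  have rv: "X i \<in> borel_measurable M" if "i \<in> ?I" for i
    using indep that unfolding indep_vars_def by blast
  have Q: "distr M (Pi\<^sub>M ?I (\<lambda>_. borel)) Y = ?Q"
  proof -
    have "distr M (Pi\<^sub>M ?I (\<lambda>_. borel)) Y = Pi\<^sub>M ?I (\<lambda>i. distr M borel (X i))"
      using indep N rv unfolding Y_def by (subst (asm) indep_vars_iff_distr_eq_PiM') auto
    also have "\<dots> = ?Q" using X by (intro PiM_cong) auto
    finally show ?thesis .
  qed
  have Ym: "Y \<in> M \<rightarrow>\<^sub>M Pi\<^sub>M ?I (\<lambda>_. borel)"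
    unfolding Y_def using rv by (intro measurable_restrict) auto
  obtain g where g: "g \<in> borel_measurable ?Q"
    "AE x in ?Q. hole_power_sum p (x ` ?I) = g x"
    "(\<integral>\<^sup>+x. ennreal (g x) \<partial>?Q) = ennreal ?E"
    using nn_integral_hole_power_sum[of ?I p] N p by auto
  have gm: "g \<in> borel_measurable (Pi\<^sub>M ?I (\<lambda>_. borel))"
    using g(1) by (simp add: measurable_def sets_PiM_cong[OF refl sets_uniform_sphere] space_PiM cong: measurable_cong_sets)
  define f where "f \<omega> = hole_power_sum p ((\<lambda>i. X i \<omega>) ` ?I)" for \<omega>
  have f_Y: "f \<omega> = hole_power_sum p (Y \<omega> ` ?I)" for \<omega>
    by (simp add: f_def Y_def image_restrict_eq)
  have "AE \<omega> in M. hole_power_sum p (Y \<omega> ` ?I) = g (Y \<omega>)"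
    using g(2) unfolding Q[symmetric] by (rule AE_distrD[OF Ym])
  then have fg: "AE \<omega> in M. f \<omega> = g (Y \<omega>)" unfolding f_Y .
  have gY: "(\<lambda>\<omega>. g (Y \<omega>)) \<in> borel_measurable M" by (rule measurable_compose[OF Ym gm])
  have "f \<omega> \<ge> 0" for \<omega> unfolding f_def hole_power_sum_def by (intro sum_nonneg) simp
  then have "integral\<^sup>L (completion M) f = enn2real (\<integral>\<^sup>+\<omega>. ennreal (f \<omega>) \<partial>completion M)"
    by (intro integral_eq_nn_integral borel_measurable_completion_AE[OF gY fg]) simp
  also have "(\<integral>\<^sup>+\<omega>. ennreal (f \<omega>) \<partial>completion M) = (\<integral>\<^sup>+\<omega>. ennreal (f \<omega>) \<partial>M)"
    by (rule nn_integral_completion)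
  also have "\<dots> = (\<integral>\<^sup>+\<omega>. ennreal (g (Y \<omega>)) \<partial>M)"
    using fg by (intro nn_integral_cong_AE) (auto elim: eventually_mono)
  also have "\<dots> = (\<integral>\<^sup>+x. ennreal (g x) \<partial>distr M (Pi\<^sub>M ?I (\<lambda>_. borel)) Y)"
    using gm by (subst nn_integral_distr[OF Ym]) auto
  also have "\<dots> = ennreal ?E" unfolding Q g(3) ..
  also have "enn2real (ennreal ?E) = ?E"
    using p by (intro enn2real_ennreal mult_nonneg_nonneg) (simp_all add: Beta_def Gamma_real_pos less_imp_le)
  finally show ?thesis unfolding expected_hole_power_sum_def f_def .
qed

lemma choose_3_Beta_eq_Gamma:
  assumes N: "N \<ge> 4" and p: "p \<ge> 0"
  shows "real (N choose 3) * (12 * 2 powr p * Beta (p / 2 + 2) (real (N - 3) + 2)) =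
    (2 * real N - 4) * 2 powr p * (Gamma (2 + p / 2) * Gamma (real N + 1) / Gamma (real N + 1 + p / 2))"
proof -
  have A: "real (N choose 3) * 6 = real N * (real N - 1) * (real N - 2)"
  proof -
    have "real (N choose 3) = real N gchoose 3" by (rule binomial_gbinomial)
    also have "\<dots> = real N * (real N - 1) * (real N - 2) / 6"
      by (simp add: gbinomial_prod_rev numeral_3_eq_3 fact_numeral)
    finally show ?thesis by simp
  qed
  have B: "Gamma (real N + 1) = real N * (real N - 1) * Gamma (real N - 1)"
  proof -
    have "Gamma (real N + 1) = real N * Gamma (real N)"
      using N by (intro Gamma_plus1) auto
    also have "Gamma (real N) = (real N - 1) * Gamma (real N - 1)"
      using Gamma_plus1[of "real N - 1"] nonpos_Ints_nonpos[of "real N - 1"] N by auto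
    finally show ?thesis by simp
  qed
  have C: "Beta (p / 2 + 2) (real (N - 3) + 2) = Gamma (2 + p / 2) * Gamma (real N - 1) / Gamma (real N + 1 + p / 2)"
    using N by (simp add: Beta_def of_nat_diff algebra_simps)
  have "real (N choose 3) * (12 * P * (G * g / d)) = real (N choose 3) * 6 * (2 * P * (G * g / d))" for P G g d :: real
    by simp
  also have "real (N choose 3) * 6 * (2 * P * (G * g / d)) =
      (2 * real N - 4) * P * (G * (real N * (real N - 1) * g) / d)" for P G g d :: real
    unfolding A by (simp add: divide_inverse algebra_simps)
  finally show ?thesis unfolding B C .
qed

section \<open>Expected sum of powers of the hole radii\<close>

theorem mainTheorem2:
  fixes p :: real
    and M :: "nat \<Rightarrow> 'a measure"
    and X :: "nat \<Rightarrow> nat \<Rightarrow> 'a \<Rightarrow> real^3"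
    and E :: "nat \<Rightarrow> real"
  assumes "p \<ge> 0"
    and "\<And>N. prob_space (M N)"
    and "\<And>N. prob_space.indep_vars (M N) (\<lambda>_. borel) (X N) {1..N}"
    and "\<And>N i. i \<in> {1..N} \<Longrightarrow> distr (M N) borel (X N i) = uniform_sphere"
    and "\<And>N. E N = expected_hole_power_sum p N (M N) (X N)"
  shows
    "(\<exists>\<epsilon> :: nat \<Rightarrow> real. \<exists>c > 0.
        \<epsilon> \<in> O(\<lambda>N. exp (- c * real N)) \<and>
        (\<forall>\<^sub>F N in sequentially.
           E N = (2 * real N - 4) * 2 powr p *
                 (Gamma (2 + p / 2) * Gamma (real N + 1) / Gamma (real N + 1 + p / 2)) *
                 (1 + \<epsilon> N)))
     \<and>
     (\<forall>L :: nat. L \<ge> 1 \<longrightarrow>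
        (\<exists>\<delta> :: nat \<Rightarrow> real.
           \<delta> \<in> O(\<lambda>N. 1 / real N ^ L) \<and>
           (\<forall>\<^sub>F N in sequentially.
              E N = (2 * real N - 4) * 2 powr p * Gamma (2 + p / 2) * real N powr (- p / 2) *
                    (1 + (\<Sum>l = 1..L - 1.
                            ((- p / 2) gchoose l) * gen_bernpoly l (1 - p / 2) 1 / real N ^ l)
                       + \<delta> N))))"
proof -
  have exact: "E N = (2 * real N - 4) * 2 powr p *
      (Gamma (2 + p / 2) * Gamma (real N + 1) / Gamma (real N + 1 + p / 2))" if "N \<ge> 4" for N
    unfolding assms(5) choose_3_Beta_eq_Gamma[OF that assms(1), symmetric]
    by (intro expected_hole_power_sum_eq assms that)
  show ?thesis
  proof (intro conjI allI impI)
    (* The formula is exact from N = 4 on, so the error term is 0 and any rate c works. *)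
    show "\<exists>\<epsilon> :: nat \<Rightarrow> real. \<exists>c > 0. \<epsilon> \<in> O(\<lambda>N. exp (- c * real N)) \<and>
        (\<forall>\<^sub>F N in sequentially.
           E N = (2 * real N - 4) * 2 powr p *
                 (Gamma (2 + p / 2) * Gamma (real N + 1) / Gamma (real N + 1 + p / 2)) *
                 (1 + \<epsilon> N))"
      using exact by (intro exI[of _ "\<lambda>_. 0"] exI[of _ "1 :: real"])
        (auto intro!: eventually_mono[OF eventually_ge_at_top[of 4]])
  next
    fix L :: nat assume L: "L \<ge> 1"
    define S where "S N = (\<Sum>l<L. ((- p / 2) gchoose l) * gen_bernpoly l (1 - p / 2) 1 / real N ^ l)" for N :: nat
    define R where "R N = real N powr (p / 2) * (Gamma (real N + 1) / Gamma (real N + 1 + p / 2))" for N :: nat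
    have S: "S N = 1 + (\<Sum>l = 1..L - 1. ((- p / 2) gchoose l) * gen_bernpoly l (1 - p / 2) 1 / real N ^ l)" for N
    proof -
      have "{..<L} = insert 0 {1..L - 1}" using L by auto
      then show ?thesis by (simp add: S_def gen_bernpoly_0)
    qed
    have big: "(\<lambda>N. R N - S N) \<in> O(\<lambda>N. 1 / real N ^ L)"
      using Gamma_ratio_expansion[of "p / 2" L] assms(1) by (simp add: R_def S_def)
    have ev: "E N = (2 * real N - 4) * 2 powr p * Gamma (2 + p / 2) * real N powr (- p / 2) * (S N + (R N - S N))"
      if "N \<ge> 4" for N
    proof -
      have "real N powr (- p / 2) * R N = Gamma (real N + 1) / Gamma (real N + 1 + p / 2)"
        using that by (simp add: R_def powr_minus field_simps)
      then show ?thesis unfolding exact[OF that] by (simp add: mult.assoc)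
    qed
    show "\<exists>\<delta> :: nat \<Rightarrow> real. \<delta> \<in> O(\<lambda>N. 1 / real N ^ L) \<and>
           (\<forall>\<^sub>F N in sequentially.
              E N = (2 * real N - 4) * 2 powr p * Gamma (2 + p / 2) * real N powr (- p / 2) *
                    (1 + (\<Sum>l = 1..L - 1.
                            ((- p / 2) gchoose l) * gen_bernpoly l (1 - p / 2) 1 / real N ^ l)
                       + \<delta> N))"
      using big ev unfolding S[symmetric]
      by (intro exI[of _ "\<lambda>N. R N - S N"] conjI eventually_mono[OF eventually_ge_at_top[of 4]])
  qed
qed

end
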